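(* Let $K$ be a field of characteristic $0$, $d\ge2$, and let $\beta=(\beta_1,\beta_2)\in K^2$, $\beta\ne(0,0)$, with $\beta_1-\beta_2=0$. In $G_d(\mathfrak V_\beta)$ the consequences of degree $n+1$ of the following polynomials of degree $n$ are equivalent to the polynomials listed (with $\gamma_1,\gamma_2\in K$): (i) for $w_{(1)}=x_1$: $w_{(2)}^{(1)}=y_1z_1$, $w_{(1^2)}^{(0)}=y_1z_2-y_2z_1$; (ii) for $w_{(2)}^{(1)}=y_1z_1$: $w_{(3)}^{(2)}=y_1^2z_1$, $w_{(3)}^{(1)}=y_1z_1^2$, $w_{(2,1)}^{(1)}$; (iii) for $w_{(1^2)}^{(0)}=y_1z_2-y_2z_1$: $w_{(3)}^{(2)}-w_{(3)}^{(1)}=y_1z_1(y_1-z_1)$, $w_{(2,1)}^{(1)}$; (iv) for $w_{(3)}=\gamma_1w_{(3)}^{(2)}+\gamma_2w_{(3)}^{(1)}$, $\gamma_1+\gamma_2\ne0$: $w_{(4)}^{(3)}$, $w_{(4)}^{(2)}$; (v) for $w_{(3)}=w_{(3)}^{(2)}-w_{(3)}^{(1)}$: $w_{(4)}^{(3)}-w_{(4)}^{(2)}$; (vi) for $w_{(2,1)}=w_{(2,1)}^{(1)}$: $w_{(4)}^{(3)}-w_{(4)}^{(2)}$; (vii) for $w_{(4)}=\gamma_1w_{(4)}^{(3)}+\gamma_2w_{(4)}^{(2)}$, $\gamma_1+\gamma_2\ne0$: $w_{(5)}^{(4)}$; (viii) for $w_{(4)}=w_{(4)}^{(3)}-w_{(4)}^{(2)}$: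 there are no (nonzero) consequences of degree $5$; (ix) for $w_{(n)}^{(n-1)}$, $n\ge5$: $w_{(n+1)}^{(n)}$.
   Context: A bicommutative algebra is a nonassociative $K$-algebra satisfying $(x_1x_2)x_3=(x_1x_3)x_2$ and $x_1(x_2x_3)=x_2(x_1x_3)$; $\mathfrak B$ is the variety of all of them. The free bicommutative algebra $F_d(\mathfrak B)$ on $x_1,\dots,x_d$ is identified (via $x_i\mapsto x_i$) with the algebra $G_d$ having as basis $x_1,\dots,x_d$ together with all monomials $Y^aZ^b=y_1^{a_1}\cdots y_d^{a_d}z_1^{b_1}\cdots z_d^{b_d}$ in the polynomial algebra $K[y_1,\dots,y_d,z_1,\dots,z_d]$ with $|a|\ge1$ and $|b|\ge1$, and multiplication $x_ix_j=y_iz_j$, $x_i(Y^aZ^b)=y_iY^aZ^b$, $(Y^aZ^b)x_i=Y^aZ^bz_i$, $(Y^aZ^b)(Y^cZ^e)=Y^{a+c}Z^{b+e}$. The group $GL_d(K)$ acts on $G_d$ by automorphisms extending its linear action on the span of $x_1,\dots,x_d$. Put $w_{(1)}=x_1$, $w_{(n)}^{(j)}=y_1^jz_1^{n-j}$ ($1\le j\le n-1$), and $w_{(\lambda_1,\lambda_2)}^{(j)}=y_1^j(y_1z_2-y_2z_1)^{\lambda_2}z_1^{\lambda_1-\lambda_2-j}$ for $\lambda_2>0$, $0\le j\le\lambda_1-\lambda_2$; $(1^2)=(1,1)$. $\mathfrak V_\beta$ is the variety of bicommutative algebras defined by the identity $\beta_1x(xy-yx)+\beta_2(xy-yx)x=0$,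 and $G_d(\mathfrak V_\beta)\cong F_d(\mathfrak V_\beta)$ is the factor algebra of $G_d$ modulo the T-ideal (ideal closed under all endomorphisms) generated by $(\beta_1y_1+\beta_2z_1)(y_1z_2-y_2z_1)$; elements of $G_d$ denote also their images. For a homogeneous $f$ of degree $n$ in $G_d(\mathfrak V_\beta)$, its consequences of degree $n+1$ are the elements of the degree $n+1$ homogeneous component of the T-ideal of $G_d(\mathfrak V_\beta)$ generated by $f$. They are "equivalent to" a list of polynomials if this component equals the $GL_d(K)$-submodule generated by the images of the polynomials in the list. *)

theory Defs
  imports
    "HOL-Library.Poly_Mapping"
    "HOL-Library.Product_Plus"
    "Jordan_Normal_Form.Matrix"
begin

section \<open>Nonassociative algebras\<close>

record ('k, 'a) nalg =
  acarrier :: "'a set"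
  aadd :: "'a \<Rightarrow> 'a \<Rightarrow> 'a"
  azero :: "'a"
  ascale :: "'k \<Rightarrow> 'a \<Rightarrow> 'a"
  amult :: "'a \<Rightarrow> 'a \<Rightarrow> 'a"

definition alg_subspace :: "('k, 'a) nalg \<Rightarrow> 'a set \<Rightarrow> bool" where
  "alg_subspace A W \<longleftrightarrow>
     W \<subseteq> acarrier A \<and> azero A \<in> W \<and>
     (\<forall>u\<in>W. \<forall>v\<in>W. aadd A u v \<in> W) \<and>
     (\<forall>c. \<forall>u\<in>W. ascale A c u \<in> W)"

definition alg_ideal :: "('k, 'a) nalg \<Rightarrow> 'a set \<Rightarrow> bool" where
  "alg_ideal A I \<longleftrightarrow>
     alg_subspace A I \<and>
     (\<forall>a\<in>acarrier A. \<forall>u\<in>I. amult A a u \<in> I \<and> amult A u a \<in> I)"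

text \<open>Only the values of \<open>\<phi>\<close> on the carrier matter.\<close>

definition alg_endo :: "('k, 'a) nalg \<Rightarrow> ('a \<Rightarrow> 'a) \<Rightarrow> bool" where
  "alg_endo A \<phi> \<longleftrightarrow>
     (\<forall>a\<in>acarrier A. \<phi> a \<in> acarrier A) \<and>
     (\<forall>a\<in>acarrier A. \<forall>b\<in>acarrier A. \<phi> (aadd A a b) = aadd A (\<phi> a) (\<phi> b)) \<and>
     (\<forall>c. \<forall>a\<in>acarrier A. \<phi> (ascale A c a) = ascale A c (\<phi> a)) \<and>
     (\<forall>a\<in>acarrier A. \<forall>b\<in>acarrier A. \<phi> (amult A a b) = amult A (\<phi> a) (\<phi> b))"

definition alg_auto :: "('k, 'a) nalg \<Rightarrow> ('a \<Rightarrow> 'a) \<Rightarrow> bool" where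
  "alg_auto A \<phi> \<longleftrightarrow> alg_endo A \<phi> \<and> bij_betw \<phi> (acarrier A) (acarrier A)"

definition T_ideal :: "('k, 'a) nalg \<Rightarrow> 'a set \<Rightarrow> bool" where
  "T_ideal A I \<longleftrightarrow> alg_ideal A I \<and> (\<forall>\<phi>. alg_endo A \<phi> \<longrightarrow> \<phi> ` I \<subseteq> I)"

definition T_ideal_gen :: "('k, 'a) nalg \<Rightarrow> 'a set \<Rightarrow> 'a set" where
  "T_ideal_gen A S = \<Inter> {I. T_ideal A I \<and> S \<subseteq> I}"

definition alg_coset :: "('k, 'a) nalg \<Rightarrow> 'a set \<Rightarrow> 'a \<Rightarrow> 'a set" where
  "alg_coset A I a = aadd A a ` I"

text \<open>For an ideal \<open>I\<close> each of the unions below is a single coset.\<close>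

definition alg_quot :: "('k, 'a) nalg \<Rightarrow> 'a set \<Rightarrow> ('k, 'a set) nalg" where
  "alg_quot A I =
     \<lparr>acarrier = alg_coset A I ` acarrier A,
      aadd = (\<lambda>C D. \<Union>a\<in>C. \<Union>b\<in>D. alg_coset A I (aadd A a b)),
      azero = alg_coset A I (azero A),
      ascale = (\<lambda>c C. \<Union>a\<in>C. alg_coset A I (ascale A c a)),
      amult = (\<lambda>C D. \<Union>a\<in>C. \<Union>b\<in>D. alg_coset A I (amult A a b))\<rparr>"


section \<open>The algebra \<open>G\<^sub>d\<close>\<close>

datatype var = Yv nat | Zv nat

type_synonym mono = "var \<Rightarrow>\<^sub>0 nat"
type_synonym 'k yzpoly = "mono \<Rightarrow>\<^sub>0 'k"

text \<open>
  A pair \<open>(v, p)\<close> stands for \<open>\<Sum>i. v i \<cdot> x\<^sub>i\<close> plus the polynomial \<open>p\<close> in the commuting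
  variables \<open>y\<^sub>i, z\<^sub>i\<close>.
\<close>

type_synonym 'k gelem = "(nat \<Rightarrow>\<^sub>0 'k) \<times> 'k yzpoly"

definition y_var :: "nat \<Rightarrow> 'k::comm_ring_1 yzpoly" where
  "y_var i = Poly_Mapping.single (Poly_Mapping.single (Yv i) 1) 1"

definition z_var :: "nat \<Rightarrow> 'k::comm_ring_1 yzpoly" where
  "z_var i = Poly_Mapping.single (Poly_Mapping.single (Zv i) 1) 1"

definition pconst :: "'k::comm_ring_1 \<Rightarrow> 'k yzpoly" where
  "pconst c = Poly_Mapping.single 0 c"

definition x_gen :: "nat \<Rightarrow> 'k::comm_ring_1 gelem" where
  "x_gen i = (Poly_Mapping.single i 1, 0)"

definition of_yz :: "'k::comm_ring_1 yzpoly \<Rightarrow> 'k gelem" where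
  "of_yz p = (0, p)"

definition ydeg :: "nat \<Rightarrow> mono \<Rightarrow> nat" where
  "ydeg d m = (\<Sum>i=1..d. Poly_Mapping.lookup m (Yv i))"

definition zdeg :: "nat \<Rightarrow> mono \<Rightarrow> nat" where
  "zdeg d m = (\<Sum>i=1..d. Poly_Mapping.lookup m (Zv i))"

definition gscale :: "'k::comm_ring_1 \<Rightarrow> 'k gelem \<Rightarrow> 'k gelem" where
  "gscale c f = (Poly_Mapping.map ((*) c) (fst f), Poly_Mapping.map ((*) c) (snd f))"

definition ylin :: "(nat \<Rightarrow>\<^sub>0 'k::comm_ring_1) \<Rightarrow> 'k yzpoly" where
  "ylin v = (\<Sum>i\<in>Poly_Mapping.keys v. pconst (Poly_Mapping.lookup v i) * y_var i)"

definition zlin :: "(nat \<Rightarrow>\<^sub>0 'k::comm_ring_1) \<Rightarrow> 'k yzpoly" where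
  "zlin v = (\<Sum>i\<in>Poly_Mapping.keys v. pconst (Poly_Mapping.lookup v i) * z_var i)"

text \<open>
  In a product of basis elements \<open>x\<^sub>i\<close> acts as \<open>y\<^sub>i\<close> when it is the left factor and as \<open>z\<^sub>i\<close>
  when it is the right factor, and monomials in \<open>y, z\<close> multiply as in the polynomial ring; \<open>gmult\<close>
  is the bilinear extension of these rules (see \<open>gmult_basis\<close>).
\<close>

definition gmult :: "'k::comm_ring_1 gelem \<Rightarrow> 'k gelem \<Rightarrow> 'k gelem" where
  "gmult f g = of_yz ((ylin (fst f) + snd f) * (zlin (fst g) + snd g))"

definition Galg :: "nat \<Rightarrow> ('k::comm_ring_1, 'k gelem) nalg" where
  "Galg d =
     \<lparr>acarrier = {(v, p). Poly_Mapping.keys v \<subseteq> {1..d} \<and>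
        (\<forall>m\<in>Poly_Mapping.keys p.
           Poly_Mapping.keys m \<subseteq> Yv ` {1..d} \<union> Zv ` {1..d} \<and> ydeg d m \<ge> 1 \<and> zdeg d m \<ge> 1)},
      aadd = (+),
      azero = 0,
      ascale = gscale,
      amult = gmult\<rparr>"

lemma gmult_basis:
  "gmult (x_gen i) (x_gen j) = of_yz (y_var i * z_var j)"
  "gmult (x_gen i) (of_yz p) = of_yz (y_var i * p)"
  "gmult (of_yz p) (x_gen j) = of_yz (p * z_var j)"
  "gmult (of_yz p) (of_yz q) = of_yz (p * q)"
  by (simp_all add: gmult_def x_gen_def of_yz_def ylin_def zlin_def pconst_def
      single_one)

lemma gmult_bicommutative:
  "gmult (gmult f g) h = gmult (gmult f h) g"
  "gmult f (gmult g h) = gmult g (gmult f h)"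
  by (simp_all add: gmult_def of_yz_def ylin_def zlin_def mult_ac)

definition G_hom :: "nat \<Rightarrow> nat \<Rightarrow> 'k::comm_ring_1 gelem set" where
  "G_hom d n = {(v, p) \<in> acarrier (Galg d).
     (v \<noteq> 0 \<longrightarrow> n = 1) \<and> (\<forall>m\<in>Poly_Mapping.keys p. ydeg d m + zdeg d m = n)}"

text \<open>
  The automorphisms by which \<open>GL\<^sub>d(K)\<close> acts. Matrices are indexed from 0, generators from 1.
\<close>

definition GL_action :: "nat \<Rightarrow> 'k::field mat \<Rightarrow> ('k gelem \<Rightarrow> 'k gelem) \<Rightarrow> bool" where
  "GL_action d g \<phi> \<longleftrightarrow>
     g \<in> carrier_mat d d \<and> invertible_mat g \<and> alg_auto (Galg d) \<phi> \<and>
     (\<forall>j\<in>{1..d}. \<phi> (x_gen j) = (\<Sum>i=1..d. gscale (g $$ (i - 1, j - 1)) (x_gen i)))"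


section \<open>The relatively free algebra \<open>G\<^sub>d(V\<^sub>\<beta>)\<close>\<close>

definition V_ideal :: "nat \<Rightarrow> 'k::field \<Rightarrow> 'k \<Rightarrow> 'k gelem set" where
  "V_ideal d \<beta>1 \<beta>2 =
     T_ideal_gen (Galg d)
       {of_yz ((pconst \<beta>1 * y_var 1 + pconst \<beta>2 * z_var 1) * (y_var 1 * z_var 2 - y_var 2 * z_var 1))}"

definition GV :: "nat \<Rightarrow> 'k::field \<Rightarrow> 'k \<Rightarrow> ('k, 'k gelem set) nalg" where
  "GV d \<beta>1 \<beta>2 = alg_quot (Galg d) (V_ideal d \<beta>1 \<beta>2)"

definition GV_image :: "nat \<Rightarrow> 'k::field \<Rightarrow> 'k \<Rightarrow> 'k gelem \<Rightarrow> 'k gelem set" where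
  "GV_image d \<beta>1 \<beta>2 f = alg_coset (Galg d) (V_ideal d \<beta>1 \<beta>2) f"

definition GV_hom :: "nat \<Rightarrow> 'k::field \<Rightarrow> 'k \<Rightarrow> nat \<Rightarrow> 'k gelem set set" where
  "GV_hom d \<beta>1 \<beta>2 n = GV_image d \<beta>1 \<beta>2 ` G_hom d n"

definition consequences ::
  "nat \<Rightarrow> 'k::field \<Rightarrow> 'k \<Rightarrow> nat \<Rightarrow> 'k gelem \<Rightarrow> 'k gelem set set" where
  "consequences d \<beta>1 \<beta>2 m f =
     T_ideal_gen (GV d \<beta>1 \<beta>2) {GV_image d \<beta>1 \<beta>2 f} \<inter> GV_hom d \<beta>1 \<beta>2 m"

text \<open>
  An automorphism \<open>\<phi>\<close> of \<open>Galg d\<close> maps the T-ideal onto itself, so the induced map on the quotient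
  sends a coset \<open>C\<close> to its image \<open>\<phi> ` C\<close>.
\<close>

definition GL_submodule_gen ::
  "nat \<Rightarrow> 'k::field \<Rightarrow> 'k \<Rightarrow> 'k gelem set set \<Rightarrow> 'k gelem set set" where
  "GL_submodule_gen d \<beta>1 \<beta>2 S =
     \<Inter> {W. alg_subspace (GV d \<beta>1 \<beta>2) W \<and>
           (\<forall>g \<phi>. GL_action d g \<phi> \<longrightarrow> (\<forall>C\<in>W. \<phi> ` C \<in> W)) \<and> S \<subseteq> W}"

text \<open>
  The consequences of degree \<open>n + 1\<close> of \<open>f\<close>, homogeneous of degree \<open>n\<close>, are equivalent to the
  polynomials in \<open>L\<close>.
\<close>

definition consequences_equiv ::
  "nat \<Rightarrow> 'k::field \<Rightarrow> 'k \<Rightarrow> nat \<Rightarrow> 'k gelem \<Rightarrow> 'k gelem set \<Rightarrow> bool" where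
  "consequences_equiv d \<beta>1 \<beta>2 n f L \<longleftrightarrow>
     consequences d \<beta>1 \<beta>2 (n + 1) f = GL_submodule_gen d \<beta>1 \<beta>2 (GV_image d \<beta>1 \<beta>2 ` L)"


section \<open>Highest weight vectors\<close>

definition w_row :: "nat \<Rightarrow> nat \<Rightarrow> 'k::comm_ring_1 gelem" where
  "w_row n j = of_yz (y_var 1 ^ j * z_var 1 ^ (n - j))"

definition w_two :: "nat \<Rightarrow> nat \<Rightarrow> nat \<Rightarrow> 'k::comm_ring_1 gelem" where
  "w_two l1 l2 j = of_yz (y_var 1 ^ j * (y_var 1 * z_var 2 - y_var 2 * z_var 1) ^ l2 * z_var 1 ^ (l1 - l2 - j))"

end

theory Submission
  imports Defs "HOL-Computational_Algebra.Polynomial" "Jordan_Normal_Form.Gauss_Jordan_Elimination"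
begin

text \<open>
  For \<open>\<beta>\<^sub>1 = \<beta>\<^sub>2\<close> the T-ideal \<open>V\<close> contains, in degree 4 and above, every product of a monomial with
  \<open>y\<^sub>i z\<^sub>j - y\<^sub>j z\<^sub>i\<close>, identifies the \<open>y\<close>-degrees 1 and 3 in degree 4, and identifies all \<open>y\<close>-degrees
  from degree 5 on. So a monomial modulo \<open>V\<close> is determined by its multiset of indices and, up to
  degree 4, a little information on its \<open>y\<close>-degree. T-ideals of the quotient correspond to T-ideals
  of \<open>G\<^sub>d\<close> above \<open>V\<close>, because endomorphisms of the quotient lift by freeness. The upper bounds
  come from just three T-ideals: the whole algebra, its square, and the kernel of the identification
  \<open>y\<^sub>i = z\<^sub>i\<close> in the square. A \<open>GL\<^sub>d\<close>-submodule is closed under the derivations \<open>x\<^sub>i \<mapsto> x\<^sub>j\<close>, being closed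
  under the transvections \<open>x\<^sub>i \<mapsto> x\<^sub>i + t x\<^sub>j\<close> for all \<open>t\<close> in an infinite field; this polarizes the
  listed highest weight vectors to all monomials needed.
\<close>

section \<open>Linear extension and evaluation\<close>

text \<open>All relations come from one trilinear expression, a(bc - cb) + (bc - cb)a. A generator
  acts as y_i from the left and as z_i from the right, but an element p of the square acts as p from
  both sides. Putting such elements into the slots turns y_i + z_i into 2p and y_i z_j - y_j z_i
  into p(y_i - z_i) up to sign; the divisions by 2, and by 3 in the linearization, use
  characteristic 0. The equality \<beta>1 = \<beta>2 shows in degree 4: (y + z)yz(y - z) = y^3 z - y
  z^3 has no term y^2 z^2. The equalities are proved by a squeeze: the listed polynomials lie in
  every T-ideal containing V and f, and the degree n + 1 part of some T-ideal containing V and f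
  lies in every GL-stable subspace containing V and the list. Both are membership statements in G_d,
  so it is enough to produce elements. The lower bounds multiply f by generators and substitute into
  it, notably x_1 x_1 for a generator.\<close>

lemma poly_mapping_sum_single:
  "(\<Sum>m\<in>Poly_Mapping.keys p. Poly_Mapping.single m (Poly_Mapping.lookup p m)) = p"
  by (rule poly_mapping_eqI)
    (auto simp: lookup_sum lookup_single when_def in_keys_iff sum.delta' if_distrib cong: if_cong)

lemma poly_mapping_add_induct [case_names zero single add]:
  fixes P :: "('m \<Rightarrow>\<^sub>0 'k::comm_monoid_add) \<Rightarrow> bool"
  assumes "P 0" and "\<And>m c. P (Poly_Mapping.single m c)" and "\<And>p q. P p \<Longrightarrow> P q \<Longrightarrow> P (p + q)"
  shows "P p"
proof -
  have "P (\<Sum>m\<in>S. Poly_Mapping.single m (Poly_Mapping.lookup p m))" if "finite S" for S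
    using that by (induction S) (auto intro: assms)
  then show ?thesis
    using poly_mapping_sum_single[of p] by (metis finite_keys)
qed

text \<open>The scalars enter through a ring homomorphism \<open>\<iota>\<close> because the targets
  are K-algebras in three ways: by \<open>pconst\<close> in the polynomials in y and z, by
  \<open>Poly_Mapping.single 0\<close> in coefficient vectors, by \<open>[:pconst c:]\<close> in
  polynomials in t.\<close>

definition lext :: "('k::comm_ring_1 \<Rightarrow> 'b::comm_ring_1) \<Rightarrow> ('m \<Rightarrow> 'b) \<Rightarrow> ('m \<Rightarrow>\<^sub>0 'k) \<Rightarrow> 'b" where
  "lext \<iota> h p = (\<Sum>m\<in>Poly_Mapping.keys p. \<iota> (Poly_Mapping.lookup p m) * h m)"

context comm_ring_hom
begin

lemma lext_superset:
  "finite S \<Longrightarrow> Poly_Mapping.keys p \<subseteq> S \<Longrightarrow> lext hom h p = (\<Sum>m\<in>S. hom (Poly_Mapping.lookup p m) * h m)"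
  unfolding lext_def by (rule sum.mono_neutral_left) (auto simp: in_keys_iff)

lemma lext_zero [simp]: "lext hom h 0 = 0"
  by (simp add: lext_def)

lemma lext_single [simp]: "lext hom h (Poly_Mapping.single m c) = hom c * h m"
  by (simp add: lext_def)

lemma lext_add: "lext hom h (p + q) = lext hom h p + lext hom h q"
proof -
  let ?S = "Poly_Mapping.keys p \<union> Poly_Mapping.keys q"
  have "lext hom h (p + q) = (\<Sum>m\<in>?S. hom (Poly_Mapping.lookup (p + q) m) * h m)"
    by (rule lext_superset) (auto simp: keys_add)
  also have "\<dots> = (\<Sum>m\<in>?S. hom (Poly_Mapping.lookup p m) * h m)
      + (\<Sum>m\<in>?S. hom (Poly_Mapping.lookup q m) * h m)"
    by (simp add: lookup_add hom_add algebra_simps sum.distrib)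
  also have "\<dots> = lext hom h p + lext hom h q"
    by (simp add: lext_superset[of ?S])
  finally show ?thesis .
qed

lemma lext_mult:
  assumes "\<And>m n. h (m + n) = h m * h n"
  shows "lext hom h (p * q) = lext hom h p * lext hom h q"
proof (induction p rule: poly_mapping_add_induct)
  case (single m c)
  show ?case
    by (induction q rule: poly_mapping_add_induct)
      (simp_all add: mult_single lext_add assms hom_mult algebra_simps)
qed (simp_all add: lext_add algebra_simps)

end

definition mono_eval :: "('x \<Rightarrow> 'b::comm_ring_1) \<Rightarrow> ('x \<Rightarrow>\<^sub>0 nat) \<Rightarrow> 'b" where
  "mono_eval \<sigma> m = (\<Prod>x\<in>Poly_Mapping.keys m. \<sigma> x ^ Poly_Mapping.lookup m x)"

lemma mono_eval_superset:
  "finite S \<Longrightarrow> Poly_Mapping.keys m \<subseteq> S \<Longrightarrow> mono_eval \<sigma> m = (\<Prod>x\<in>S. \<sigma> x ^ Poly_Mapping.lookup m x)"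
  unfolding mono_eval_def by (rule prod.mono_neutral_left) (auto simp: in_keys_iff)

lemma mono_eval_zero [simp]: "mono_eval \<sigma> 0 = 1"
  by (simp add: mono_eval_def)

lemma mono_eval_single [simp]: "mono_eval \<sigma> (Poly_Mapping.single x k) = \<sigma> x ^ k"
  by (simp add: mono_eval_def)

lemma mono_eval_add: "mono_eval \<sigma> (m + n) = mono_eval \<sigma> m * mono_eval \<sigma> n"
proof -
  let ?S = "Poly_Mapping.keys m \<union> Poly_Mapping.keys n"
  have "mono_eval \<sigma> (m + n) = (\<Prod>x\<in>?S. \<sigma> x ^ Poly_Mapping.lookup (m + n) x)"
    by (rule mono_eval_superset) (auto simp: keys_add)
  also have "\<dots> = mono_eval \<sigma> m * mono_eval \<sigma> n"
    by (simp add: lookup_add power_add prod.distrib mono_eval_superset[of ?S])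
  finally show ?thesis .
qed

definition peval :: "('k::comm_ring_1 \<Rightarrow> 'b::comm_ring_1) \<Rightarrow> (var \<Rightarrow> 'b) \<Rightarrow> 'k yzpoly \<Rightarrow> 'b" where
  "peval \<iota> \<sigma> = lext \<iota> (mono_eval \<sigma>)"

lemma comm_ring_hom_peval:
  assumes "comm_ring_hom \<iota>"
  shows "comm_ring_hom (peval \<iota> \<sigma>)"
proof -
  interpret comm_ring_hom \<iota> by fact
  have "peval \<iota> \<sigma> (Poly_Mapping.single 0 1) = 1"
    by (simp add: peval_def del: single_one)
  then show ?thesis
    by unfold_locales (simp_all add: peval_def lext_add lext_mult mono_eval_add)
qed

lemma peval_vars [simp]:
  assumes "comm_ring_hom \<iota>"
  shows "peval \<iota> \<sigma> (pconst c) = \<iota> c" "peval \<iota> \<sigma> (y_var i) = \<sigma> (Yv i)" "peval \<iota> \<sigma> (z_var i) = \<sigma> (Zv i)"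
proof -
  interpret comm_ring_hom \<iota> by fact
  show "peval \<iota> \<sigma> (pconst c) = \<iota> c" "peval \<iota> \<sigma> (y_var i) = \<sigma> (Yv i)" "peval \<iota> \<sigma> (z_var i) = \<sigma> (Zv i)"
    by (simp_all add: peval_def pconst_def y_var_def z_var_def)
qed

lemma comm_ring_hom_pconst: "comm_ring_hom (pconst :: 'k::comm_ring_1 \<Rightarrow> _)"
  by unfold_locales (simp_all add: pconst_def single_add mult_single)

interpretation pconst: comm_ring_hom "pconst :: 'k::comm_ring_1 \<Rightarrow> 'k yzpoly"
  by (rule comm_ring_hom_pconst)

abbreviation subst :: "(var \<Rightarrow> 'k yzpoly) \<Rightarrow> 'k::comm_ring_1 yzpoly \<Rightarrow> 'k yzpoly" where
  "subst \<equiv> peval pconst"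

interpretation subst: comm_ring_hom "subst \<sigma>"
  by (rule comm_ring_hom_peval) (rule comm_ring_hom_pconst)

lemma subst_vars [simp]:
  "subst \<sigma> (pconst c) = pconst c" "subst \<sigma> (y_var i) = \<sigma> (Yv i)" "subst \<sigma> (z_var i) = \<sigma> (Zv i)"
  by (simp_all add: comm_ring_hom_pconst)

section \<open>Monomials\<close>

definition Ymon :: "nat list \<Rightarrow> 'k::comm_ring_1 yzpoly" where
  "Ymon is = prod_list (map y_var is)"

definition Zmon :: "nat list \<Rightarrow> 'k::comm_ring_1 yzpoly" where
  "Zmon js = prod_list (map z_var js)"

text \<open>Monomials are written by lists of indices rather than exponent vectors, since exchanging
  two indices, moving one from the y-side to the z-side and replacing one by another are then list
  operations.\<close>

definition mexp :: "nat list \<Rightarrow> nat list \<Rightarrow> mono" where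
  "mexp is js = sum_list (map (\<lambda>i. Poly_Mapping.single (Yv i) 1) is)
    + sum_list (map (\<lambda>j. Poly_Mapping.single (Zv j) 1) js)"

lemma Ymon_simps [simp]: "Ymon [] = 1" "Ymon (i # is) = y_var i * Ymon is" "Ymon (is @ is') = Ymon is * Ymon is'"
  by (simp_all add: Ymon_def)

lemma Zmon_simps [simp]: "Zmon [] = 1" "Zmon (i # is) = z_var i * Zmon is" "Zmon (is @ is') = Zmon is * Zmon is'"
  by (simp_all add: Zmon_def)

lemma Ymon_replicate [simp]: "Ymon (replicate n i) = y_var i ^ n"
  by (induction n) auto

lemma Zmon_replicate [simp]: "Zmon (replicate n i) = z_var i ^ n"
  by (induction n) auto

lemma Ymon_mset: "mset is = mset is' \<Longrightarrow> Ymon is = Ymon is'"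
  unfolding Ymon_def by (metis mset_map prod_mset_prod_list)

lemma Zmon_mset: "mset is = mset is' \<Longrightarrow> Zmon is = Zmon is'"
  unfolding Zmon_def by (metis mset_map prod_mset_prod_list)

lemma single_mexp:
  "Poly_Mapping.single (mexp is js) c = pconst c * (Ymon is * Zmon js)"
proof -
  have "Poly_Mapping.single (sum_list (map (\<lambda>i. Poly_Mapping.single (Yv i) 1) is)) 1 = (Ymon is :: 'a yzpoly)"
  proof (induction "is")
    case (Cons i l)
    then show ?case by (simp add: y_var_def mult_single flip: Cons)
  qed simp
  moreover have "Poly_Mapping.single (sum_list (map (\<lambda>i. Poly_Mapping.single (Zv i) 1) js)) 1 = (Zmon js :: 'a yzpoly)"
  proof (induction js)
    case (Cons i l)
    then show ?case by (simp add: z_var_def mult_single flip: Cons)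
  qed simp
  ultimately show ?thesis
    by (simp add: pconst_def mexp_def mult_single flip: \<open>_ = Ymon is\<close> \<open>_ = Zmon js\<close>)
qed

lemma mexp_append: "mexp (is @ is') (js @ js') = mexp is js + mexp is' js'"
  by (simp add: mexp_def algebra_simps)

lemma lookup_mexp: "Poly_Mapping.lookup (mexp is js) (Yv i) = count (mset is) i"
    "Poly_Mapping.lookup (mexp is js) (Zv i) = count (mset js) i"
proof -
  have "Poly_Mapping.lookup (sum_list (map (\<lambda>i. Poly_Mapping.single (Yv i) 1) is)) (Yv i) = count (mset is) i"
    "Poly_Mapping.lookup (sum_list (map (\<lambda>i. Poly_Mapping.single (Yv i) 1) is)) (Zv i) = 0"
    for "is" i by (induction "is") (auto simp: lookup_add lookup_single when_def)
  moreover have "Poly_Mapping.lookup (sum_list (map (\<lambda>i. Poly_Mapping.single (Zv i) 1) is)) (Zv i) = count (mset is) i"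
    "Poly_Mapping.lookup (sum_list (map (\<lambda>i. Poly_Mapping.single (Zv i) 1) is)) (Yv i) = 0"
    for "is" i by (induction "is") (auto simp: lookup_add lookup_single when_def)
  ultimately show "Poly_Mapping.lookup (mexp is js) (Yv i) = count (mset is) i"
    "Poly_Mapping.lookup (mexp is js) (Zv i) = count (mset js) i"
    by (simp_all add: mexp_def lookup_add del: One_nat_def)
qed

definition dmonos :: "nat \<Rightarrow> mono set" where
  "dmonos d = {m. Poly_Mapping.keys m \<subseteq> Yv ` {1..d} \<union> Zv ` {1..d}}"

lemma dmonos_add: "m \<in> dmonos d \<Longrightarrow> n \<in> dmonos d \<Longrightarrow> m + n \<in> dmonos d"
  unfolding dmonos_def using keys_add[of m n] by blast

lemma ydeg_add: "ydeg d (m + n) = ydeg d m + ydeg d n"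
  and zdeg_add: "zdeg d (m + n) = zdeg d m + zdeg d n"
  by (simp_all add: ydeg_def zdeg_def lookup_add sum.distrib)

lemma sum_count_length:
  "finite S \<Longrightarrow> set is \<subseteq> S \<Longrightarrow> (\<Sum>i\<in>S. count (mset is) i) = length is"
  by (subst sum.mono_neutral_right[of S "set is"])
    (auto simp: count_eq_zero_iff size_multiset_overloaded_eq simp flip: size_mset)

lemma mexp_degs:
  "set is \<subseteq> {1..d} \<Longrightarrow> ydeg d (mexp is js) = length is"
  "set js \<subseteq> {1..d} \<Longrightarrow> zdeg d (mexp is js) = length js"
  by (simp_all add: ydeg_def zdeg_def lookup_mexp sum_count_length)

lemma mexp_dmonos:
  assumes "set is \<subseteq> {1..d}" "set js \<subseteq> {1..d}"
  shows "mexp is js \<in> dmonos d"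
proof -
  have "x \<in> Yv ` {1..d} \<union> Zv ` {1..d}" if "x \<in> Poly_Mapping.keys (mexp is js)" for x
  proof (cases x)
    case (Yv i)
    then have "i \<in> set is" using that by (simp add: in_keys_iff lookup_mexp)
    then show ?thesis using assms Yv by blast
  next
    case (Zv i)
    then have "i \<in> set js" using that by (simp add: in_keys_iff lookup_mexp)
    then show ?thesis using assms Zv by blast
  qed
  then show ?thesis unfolding dmonos_def by blast
qed

lemma dmonos_mexp:
  assumes "m \<in> dmonos d"
  obtains "is" js where "set is \<subseteq> {1..d}" "set js \<subseteq> {1..d}" "m = mexp is js"
proof -
  have "\<exists>is js. set is \<subseteq> {1..d} \<and> set js \<subseteq> {1..d} \<and> (\<Sum>x\<in>S. Poly_Mapping.single x (h x)) = mexp is js"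
    if "finite S" "S \<subseteq> Yv ` {1..d} \<union> Zv ` {1..d}" for S and h :: "var \<Rightarrow> nat"
    using that
  proof (induction S)
    case empty
    then show ?case by (intro exI[of _ "[]"]) (simp add: mexp_def)
  next
    case (insert x S)
    then obtain "is" js where *: "set is \<subseteq> {1..d}" "set js \<subseteq> {1..d}"
      "(\<Sum>x\<in>S. Poly_Mapping.single x (h x)) = mexp is js" by auto
    have "\<exists>is' js'. set is' \<subseteq> {1..d} \<and> set js' \<subseteq> {1..d} \<and> Poly_Mapping.single x (h x) = mexp is' js'"
    proof (cases x)
      case (Yv i)
      have "Poly_Mapping.single (Yv i) k = mexp (replicate k i) []" for k
      proof (induction k)
        case (Suc k)
        then show ?case using single_add[of "Yv i" 1 k] by (simp add: mexp_def)
      qed (simp add: mexp_def)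
      then show ?thesis using insert.prems Yv
        by (intro exI[of _ "replicate (h x) i"] exI[of _ "[]"]) auto
    next
      case (Zv i)
      have "Poly_Mapping.single (Zv i) k = mexp [] (replicate k i)" for k
      proof (induction k)
        case (Suc k)
        then show ?case using single_add[of "Zv i" 1 k] by (simp add: mexp_def)
      qed (simp add: mexp_def)
      then show ?thesis using insert.prems Zv
        by (intro exI[of _ "replicate (h x) i"] exI[of _ "[]"]) auto
    qed
    then obtain is' js' where "set is' \<subseteq> {1..d}" "set js' \<subseteq> {1..d}" "Poly_Mapping.single x (h x) = mexp is' js'"
      by blast
    then show ?case using insert.hyps *
      by (intro exI[of _ "is' @ is"] exI[of _ "js' @ js"]) (simp add: mexp_append)
  qed
  from this[of "Poly_Mapping.keys m" "Poly_Mapping.lookup m"] assms show ?thesis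
    using that by (auto simp: dmonos_def poly_mapping_sum_single)
qed

section \<open>Supports\<close>

definition psupp :: "'m set \<Rightarrow> ('m \<Rightarrow>\<^sub>0 'k::zero) set" where
  "psupp S = {p. Poly_Mapping.keys p \<subseteq> S}"

lemma psupp_zero [simp]: "0 \<in> psupp S"
  by (simp add: psupp_def)

lemma psupp_add: "p \<in> psupp S \<Longrightarrow> q \<in> psupp S \<Longrightarrow> p + q \<in> psupp S"
  unfolding psupp_def using keys_add[of p q] by blast

lemma psupp_mult:
  assumes "p \<in> psupp S" "q \<in> psupp T" "\<And>a b. a \<in> S \<Longrightarrow> b \<in> T \<Longrightarrow> a + b \<in> R"
  shows "p * q \<in> psupp R"
  using assms keys_mult[of p q] unfolding psupp_def by blast

lemma psupp_single_mult:
  fixes p :: "'m::comm_monoid_add \<Rightarrow>\<^sub>0 'k::comm_ring_1"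
  assumes "p \<in> psupp S"
  shows "Poly_Mapping.single 0 c * p \<in> psupp S"
  by (rule psupp_mult[of _ "{0}" _ S]) (use assms in \<open>auto simp: psupp_def\<close>)

lemma psupp_pconst_mult: "p \<in> psupp S \<Longrightarrow> pconst c * p \<in> psupp S"
  unfolding pconst_def by (rule psupp_single_mult)

lemma psupp_sum: "(\<And>x. x \<in> X \<Longrightarrow> f x \<in> psupp S) \<Longrightarrow> sum f X \<in> psupp S"
  by (induction X rule: infinite_finite_induct) (auto intro: psupp_add)

section \<open>Subspaces of the polynomial ring and spanning by monomials\<close>

definition lin_closed :: "'k::comm_ring_1 yzpoly set \<Rightarrow> bool" where
  "lin_closed W \<longleftrightarrow> 0 \<in> W \<and> (\<forall>p\<in>W. \<forall>q\<in>W. p + q \<in> W) \<and> (\<forall>c. \<forall>p\<in>W. pconst c * p \<in> W)"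

lemma lin_closedD:
  assumes "lin_closed W"
  shows "0 \<in> W" "p \<in> W \<Longrightarrow> q \<in> W \<Longrightarrow> p + q \<in> W" "p \<in> W \<Longrightarrow> pconst c * p \<in> W"
    "p \<in> W \<Longrightarrow> - p \<in> W" "p \<in> W \<Longrightarrow> q \<in> W \<Longrightarrow> p - q \<in> W"
proof -
  show *: "0 \<in> W" "p \<in> W \<Longrightarrow> q \<in> W \<Longrightarrow> p + q \<in> W" "p \<in> W \<Longrightarrow> pconst c * p \<in> W" for p q c
    using assms by (auto simp: lin_closed_def)
  have "- p = pconst (-1) * p" for p :: "'a yzpoly"
    by (simp add: pconst.hom_uminus)
  then show m: "p \<in> W \<Longrightarrow> - p \<in> W" for p using *(3) by metis
  show "p \<in> W \<Longrightarrow> q \<in> W \<Longrightarrow> p - q \<in> W"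
    using *(2)[of p "- q"] m by simp
qed

lemma lin_closed_sum: "lin_closed W \<Longrightarrow> (\<And>x. x \<in> X \<Longrightarrow> f x \<in> W) \<Longrightarrow> sum f X \<in> W"
  by (induction X rule: infinite_finite_induct) (auto intro: lin_closedD)

lemma lin_closed_cancel:
  fixes W :: "'k::field yzpoly set"
  assumes "lin_closed W" "pconst c * p \<in> W" "c \<noteq> 0"
  shows "p \<in> W"
proof -
  have "pconst (inverse c) * (pconst c * p) = p"
    using assms(3) by (simp add: mult.assoc[symmetric] flip: pconst.hom_mult)
  then show ?thesis using lin_closedD(3)[OF assms(1,2)] by metis
qed

lemma psupp_span:
  assumes "lin_closed W" "p \<in> psupp S" "S \<subseteq> dmonos d"
    and "\<And>is js. mexp is js \<in> S \<Longrightarrow> set is \<subseteq> {1..d} \<Longrightarrow> set js \<subseteq> {1..d} \<Longrightarrow> Ymon is * Zmon js \<in> W"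
  shows "p \<in> W"
proof -
  have "Poly_Mapping.single m (Poly_Mapping.lookup p m) \<in> W" if "m \<in> Poly_Mapping.keys p" for m
  proof -
    have m: "m \<in> S" using that assms(2) by (auto simp: psupp_def)
    then obtain "is" js where "set is \<subseteq> {1..d}" "set js \<subseteq> {1..d}" "m = mexp is js"
      using assms(3) dmonos_mexp by blast
    then show ?thesis using assms(1,4) m by (auto simp: single_mexp intro: lin_closedD)
  qed
  then have "(\<Sum>m\<in>Poly_Mapping.keys p. Poly_Mapping.single m (Poly_Mapping.lookup p m)) \<in> W"
    by (intro lin_closed_sum assms)
  then show ?thesis by (simp add: poly_mapping_sum_single)
qed

definition ymonos :: "nat \<Rightarrow> mono set" where
  "ymonos d = {m \<in> dmonos d. ydeg d m \<ge> 1}"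

definition zmonos :: "nat \<Rightarrow> mono set" where
  "zmonos d = {m \<in> dmonos d. zdeg d m \<ge> 1}"

definition hmonos :: "nat \<Rightarrow> nat \<Rightarrow> mono set" where
  "hmonos d n = {m \<in> ymonos d \<inter> zmonos d. ydeg d m + zdeg d m = n}"

lemma hmonos_mexp:
  "set is \<subseteq> {1..d} \<Longrightarrow> set js \<subseteq> {1..d} \<Longrightarrow>
    mexp is js \<in> hmonos d n \<longleftrightarrow> is \<noteq> [] \<and> js \<noteq> [] \<and> length is + length js = n"
  by (cases "is"; cases js) (auto simp: hmonos_def ymonos_def zmonos_def mexp_dmonos mexp_degs)

lemma yzmonos_mexp:
  "set is \<subseteq> {1..d} \<Longrightarrow> set js \<subseteq> {1..d} \<Longrightarrow>
    mexp is js \<in> ymonos d \<inter> zmonos d \<longleftrightarrow> is \<noteq> [] \<and> js \<noteq> []"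
  using hmonos_mexp[of "is" d js "length is + length js"]
  by (auto simp: hmonos_def mexp_degs)

lemma ymonos_add: "m \<in> ymonos d \<Longrightarrow> n \<in> dmonos d \<Longrightarrow> m + n \<in> ymonos d"
  and zmonos_add: "m \<in> dmonos d \<Longrightarrow> n \<in> zmonos d \<Longrightarrow> m + n \<in> zmonos d"
  by (auto simp: ymonos_def zmonos_def dmonos_add ydeg_add zdeg_add)

lemma yzmonos_add: "m \<in> ymonos d \<Longrightarrow> n \<in> zmonos d \<Longrightarrow> m + n \<in> ymonos d \<inter> zmonos d"
  using ymonos_add[of m d n] zmonos_add[of m d n] by (auto simp: ymonos_def zmonos_def)

lemma vars_psupp:
  assumes "i \<in> {1..d}"
  shows "y_var i \<in> psupp (ymonos d)" "z_var i \<in> psupp (zmonos d)"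
  using assms mexp_degs(1)[of "[i]" d "[]"] mexp_degs(2)[of "[i]" d "[]"]
    mexp_dmonos[of "[i]" d "[]"] mexp_dmonos[of "[]" d "[i]"]
  by (auto simp: psupp_def y_var_def z_var_def ymonos_def zmonos_def mexp_def)

section \<open>Freeness of \<open>G\<^sub>d\<close>\<close>

text \<open>An element enters a product only through \<open>lact\<close> or \<open>ract\<close>.
  These differ in the linear part alone, hence coincide on the square of the algebra.\<close>

definition lact :: "'k::comm_ring_1 gelem \<Rightarrow> 'k yzpoly" where
  "lact f = ylin (fst f) + snd f"

definition ract :: "'k::comm_ring_1 gelem \<Rightarrow> 'k yzpoly" where
  "ract f = zlin (fst f) + snd f"

lemma gmult_eq: "gmult f g = of_yz (lact f * ract g)"
  by (simp add: gmult_def lact_def ract_def)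

text \<open>Finitely supported functions on \<open>nat\<close> form a convolution ring, in which
  scaling is multiplication by a constant; both components thus become ring products.\<close>

lemma gscale_eq: "gscale c f = (Poly_Mapping.single 0 c * fst f, pconst c * snd f)"
  by (simp add: gscale_def mult_map_scale_conv_mult pconst_def)

lemma ylin_eq: "ylin v = lext pconst y_var v" and zlin_eq: "zlin v = lext pconst z_var v"
  by (simp_all add: ylin_def zlin_def lext_def)

lemma lext_pconst_scale:
  fixes v :: "nat \<Rightarrow>\<^sub>0 'k::comm_ring_1"
  shows "lext pconst h (Poly_Mapping.single 0 c * v) = pconst c * lext pconst h v"
  by (induction v rule: poly_mapping_add_induct)
    (simp_all add: mult_single pconst.lext_add pconst.hom_mult algebra_simps)

lemma lact_simps [simp]:
  "lact (f + g) = lact f + lact g" "lact (gscale c f) = pconst c * lact f" "lact (x_gen i) = y_var i"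
  "lact (of_yz p) = p" "lact 0 = 0"
  by (simp_all add: lact_def ylin_eq pconst.lext_add gscale_eq lext_pconst_scale x_gen_def of_yz_def distrib_left add_ac)

lemma ract_simps [simp]:
  "ract (f + g) = ract f + ract g" "ract (gscale c f) = pconst c * ract f" "ract (x_gen i) = z_var i"
  "ract (of_yz p) = p" "ract 0 = 0"
  by (simp_all add: ract_def zlin_eq pconst.lext_add gscale_eq lext_pconst_scale x_gen_def of_yz_def distrib_left add_ac)

lemma of_yz_simps:
  "of_yz p + of_yz q = of_yz (p + q)" "of_yz p - of_yz q = of_yz (p - q)" "- of_yz p = of_yz (- p)"
  "gscale c (of_yz p) = of_yz (pconst c * p)"
  by (simp_all add: of_yz_def gscale_eq)

lemma of_yz_eq_iff [simp]: "of_yz p = of_yz q \<longleftrightarrow> p = q"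
  by (simp add: of_yz_def)

lemma of_yz_zero [simp]: "of_yz 0 = 0"
  by (simp add: of_yz_def zero_prod_def)

lemma gmult_simps:
  "gmult (f + f') g = gmult f g + gmult f' g" "gmult f (g + g') = gmult f g + gmult f g'"
  "gmult (gscale c f) g = gscale c (gmult f g)" "gmult f (gscale c g) = gscale c (gmult f g)"
  by (simp_all add: gmult_eq of_yz_simps algebra_simps)

lemma gscale_minus_one: "gscale (-1) f = - f"
  by (cases f) (simp add: gscale_eq pconst.hom_uminus single_uminus)

lemma Galg_simps [simp]:
  "aadd (Galg d) = (+)" "azero (Galg d) = 0" "ascale (Galg d) = gscale" "amult (Galg d) = gmult"
  by (simp_all add: Galg_def)

definition mixed :: "nat \<Rightarrow> 'k::comm_ring_1 yzpoly set" where
  "mixed d = psupp (ymonos d \<inter> zmonos d)"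

lemma carrier_iff: "f \<in> acarrier (Galg d) \<longleftrightarrow> fst f \<in> psupp {1..d} \<and> snd f \<in> mixed d"
  unfolding Galg_def psupp_def mixed_def ymonos_def zmonos_def dmonos_def
  by (cases f) auto

lemma carrier_add: "f \<in> acarrier (Galg d) \<Longrightarrow> g \<in> acarrier (Galg d) \<Longrightarrow> f + g \<in> acarrier (Galg d)"
  by (simp add: carrier_iff mixed_def psupp_add)

lemma carrier_scale: "f \<in> acarrier (Galg d) \<Longrightarrow> gscale c f \<in> acarrier (Galg d)"
  by (simp add: carrier_iff mixed_def gscale_eq psupp_single_mult psupp_pconst_mult)

lemma carrier_zero [simp]: "0 \<in> acarrier (Galg d)"
  by (simp add: carrier_iff mixed_def)

lemma carrier_uminus: "f \<in> acarrier (Galg d) \<Longrightarrow> - f \<in> acarrier (Galg d)"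
  using carrier_scale[of f d "-1"] by (simp add: gscale_minus_one)

lemma carrier_diff: "f \<in> acarrier (Galg d) \<Longrightarrow> g \<in> acarrier (Galg d) \<Longrightarrow> f - g \<in> acarrier (Galg d)"
  using carrier_add[of f d "- g"] carrier_uminus by fastforce

lemma carrier_of_yz [simp]: "of_yz p \<in> acarrier (Galg d) \<longleftrightarrow> p \<in> mixed d"
  by (simp add: carrier_iff of_yz_def)

lemma carrier_x_gen: "i \<in> {1..d} \<Longrightarrow> x_gen i \<in> acarrier (Galg d)"
  by (simp add: carrier_iff x_gen_def mixed_def) (simp add: psupp_def)

lemma lact_psupp: "f \<in> acarrier (Galg d) \<Longrightarrow> lact f \<in> psupp (ymonos d)"
  and ract_psupp: "f \<in> acarrier (Galg d) \<Longrightarrow> ract f \<in> psupp (zmonos d)"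
  unfolding lact_def ract_def ylin_def zlin_def
  by (intro psupp_add psupp_sum psupp_pconst_mult vars_psupp; force simp: carrier_iff psupp_def mixed_def)+

lemma mixed_mult: "p \<in> psupp (ymonos d) \<Longrightarrow> q \<in> psupp (zmonos d) \<Longrightarrow> p * q \<in> mixed d"
  unfolding mixed_def by (rule psupp_mult) (auto dest: yzmonos_add)

lemma carrier_mult: "f \<in> acarrier (Galg d) \<Longrightarrow> g \<in> acarrier (Galg d) \<Longrightarrow> gmult f g \<in> acarrier (Galg d)"
  by (simp add: gmult_eq mixed_mult lact_psupp ract_psupp)

lemma YZ_mixed:
  assumes "set is \<subseteq> {1..d}" "set js \<subseteq> {1..d}" "is \<noteq> []" "js \<noteq> []"
  shows "Ymon is * Zmon js \<in> mixed d"
  using single_mexp[of "is" js 1] yzmonos_mexp[OF assms(1,2)] assms(3,4)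
  by (auto simp: mixed_def psupp_def simp flip: single_mexp[of "is" js 1, simplified])

text \<open>Every monomial with a y and a z arises from some x_i x_j by left multiplications, which
  add a y, and right multiplications, which add a z.\<close>

lemma YZ_generated [consumes 4, case_names base left right]:
  assumes "set is \<subseteq> {1..d}" "set js \<subseteq> {1..d}" "is \<noteq> []" "js \<noteq> []"
    and "\<And>i j. i \<in> {1..d} \<Longrightarrow> j \<in> {1..d} \<Longrightarrow> P [i] [j]"
    and "\<And>i is js. i \<in> {1..d} \<Longrightarrow> set is \<subseteq> {1..d} \<Longrightarrow> set js \<subseteq> {1..d} \<Longrightarrow>
      is \<noteq> [] \<Longrightarrow> js \<noteq> [] \<Longrightarrow> P is js \<Longrightarrow> P (i # is) js"
    and "\<And>j is js. j \<in> {1..d} \<Longrightarrow> set is \<subseteq> {1..d} \<Longrightarrow> set js \<subseteq> {1..d} \<Longrightarrow>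
      is \<noteq> [] \<Longrightarrow> js \<noteq> [] \<Longrightarrow> P is js \<Longrightarrow> P is (j # js)"
  shows "P is js"
proof -
  have "P [i] js" if "i \<in> {1..d}" for i
    using assms(4,2)
  proof (induction js rule: list_nonempty_induct)
    case (cons x xs)
    then show ?case using that by (intro assms(7)) auto
  qed (use that assms(5) in auto)
  with assms(3,1) show ?thesis
  proof (induction "is" rule: list_nonempty_induct)
    case (cons x xs)
    then show ?case using assms(2,4) by (intro assms(6)) auto
  qed auto
qed

text \<open>Induction over the algebra generated by the x_i. The closure hypotheses carry membership
  in the carrier because \<open>T\<close> is typically the set where two maps agree, and these may
  be homomorphisms only there.\<close>

lemma Galg_generated:
  assumes zero: "0 \<in> T"
    and add: "\<And>f g. f \<in> acarrier (Galg d) \<Longrightarrow> g \<in> acarrier (Galg d) \<Longrightarrow> f \<in> T \<Longrightarrow> g \<in> T \<Longrightarrow> f + g \<in> T"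
    and scale: "\<And>c f. f \<in> acarrier (Galg d) \<Longrightarrow> f \<in> T \<Longrightarrow> gscale c f \<in> T"
    and mult: "\<And>f g. f \<in> acarrier (Galg d) \<Longrightarrow> g \<in> acarrier (Galg d) \<Longrightarrow> f \<in> T \<Longrightarrow> g \<in> T \<Longrightarrow> gmult f g \<in> T"
    and gen: "\<And>i. i \<in> {1..d} \<Longrightarrow> x_gen i \<in> T"
    and f: "f \<in> acarrier (Galg d)"
  shows "f \<in> T"
proof -
  let ?A = "acarrier (Galg d)"
  have YZ: "of_yz (Ymon is * Zmon js) \<in> T"
    if "set is \<subseteq> {1..d}" "set js \<subseteq> {1..d}" "is \<noteq> []" "js \<noteq> []" for "is" js
    using that
  proof (induction rule: YZ_generated)
    case (base i j)
    then show ?case using mult[OF carrier_x_gen carrier_x_gen gen gen, of i j] by (simp add: gmult_eq)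
  next
    case (left i "is" js)
    then show ?case using mult[OF carrier_x_gen _ gen, of i "of_yz (Ymon is * Zmon js)"]
      by (simp add: gmult_eq YZ_mixed mult_ac)
  next
    case (right j "is" js)
    then show ?case using mult[OF _ carrier_x_gen _ gen, of "of_yz (Ymon is * Zmon js)" j]
      by (simp add: gmult_eq YZ_mixed mult_ac)
  qed
  let ?W = "{p \<in> mixed d. of_yz p \<in> T}"
  have "lin_closed ?W"
    using add scale unfolding lin_closed_def
    by (auto simp: mixed_def psupp_add psupp_pconst_mult zero simp flip: of_yz_simps)
  moreover have "snd f \<in> psupp (ymonos d \<inter> zmonos d)"
    using f by (simp add: carrier_iff mixed_def)
  ultimately have "snd f \<in> ?W"
  proof (rule psupp_span[where d = d])
    fix "is" js assume "mexp is js \<in> ymonos d \<inter> zmonos d" "set is \<subseteq> {1..d}" "set js \<subseteq> {1..d}"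
    then show "Ymon is * Zmon js \<in> ?W"
      using YZ[of "is" js] YZ_mixed[of "is" d js] yzmonos_mexp[of "is" d js] by simp
  qed (auto simp: ymonos_def)
  then have p: "of_yz (snd f) \<in> T" "of_yz (snd f) \<in> ?A" by auto
  have x: "(Poly_Mapping.single i c, 0) = gscale c (x_gen i)" for i and c :: 'a
    by (simp add: gscale_eq x_gen_def mult_single)
  have "(\<Sum>i\<in>S. (Poly_Mapping.single i (Poly_Mapping.lookup (fst f) i), 0)) \<in> T \<inter> ?A"
    if "finite S" "S \<subseteq> {1..d}" for S
    using that by (induction S) (auto simp: zero x intro!: add scale gen carrier_x_gen carrier_scale carrier_add)
  from this[of "Poly_Mapping.keys (fst f)"] f
  have v: "(\<Sum>i\<in>Poly_Mapping.keys (fst f). (Poly_Mapping.single i (Poly_Mapping.lookup (fst f) i), 0 :: 'a yzpoly)) \<in> T \<inter> ?A"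
    by (auto simp: carrier_iff psupp_def)
  have "(\<Sum>i\<in>S. (h i, 0 :: 'a yzpoly)) = (sum h S, 0)" if "finite S" for S and h :: "nat \<Rightarrow> nat \<Rightarrow>\<^sub>0 'a"
    using that by (induction S) (auto simp: zero_prod_def)
  then have "(fst f, 0) \<in> T \<inter> ?A" using v by (simp add: poly_mapping_sum_single)
  then have "(fst f, 0) + of_yz (snd f) \<in> T" using p add by blast
  then show ?thesis by (simp add: of_yz_def)
qed

section \<open>Substitution endomorphisms\<close>

definition usub :: "(nat \<Rightarrow> 'k::comm_ring_1 gelem) \<Rightarrow> var \<Rightarrow> 'k yzpoly" where
  "usub u x = (case x of Yv i \<Rightarrow> lact (u i) | Zv i \<Rightarrow> ract (u i))"

lemma usub_simps [simp]: "usub u (Yv i) = lact (u i)" "usub u (Zv i) = ract (u i)"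
  by (simp_all add: usub_def)

text \<open>Inside a mixed monomial x_i has acted from the left or from the right, so its image u i
  replaces y_i by \<open>lact (u i)\<close> and z_i by \<open>ract (u i)\<close>. The linear part of
  the argument keeps both components of u i.\<close>

definition gsubst :: "(nat \<Rightarrow> 'k::comm_ring_1 gelem) \<Rightarrow> 'k gelem \<Rightarrow> 'k gelem" where
  "gsubst u f = (lext (Poly_Mapping.single 0) (\<lambda>i. fst (u i)) (fst f),
     lext pconst (\<lambda>i. snd (u i)) (fst f) + subst (usub u) (snd f))"

interpretation single0: comm_ring_hom "Poly_Mapping.single (0::'m::comm_monoid_add) :: 'k::comm_ring_1 \<Rightarrow> _"
  by unfold_locales (simp_all add: single_add mult_single)

lemma gsubst_of_yz [simp]: "gsubst u (of_yz p) = of_yz (subst (usub u) p)"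
  by (simp add: gsubst_def of_yz_def)

lemma gsubst_x_gen [simp]: "gsubst u (x_gen i) = u i"
  by (simp add: gsubst_def x_gen_def)

lemma gsubst_add: "gsubst u (f + g) = gsubst u f + gsubst u g"
  by (simp add: gsubst_def single0.lext_add pconst.lext_add subst.hom_add)

lemma gsubst_scale: "gsubst u (gscale c f) = gscale c (gsubst u f)"
proof -
  have "lext (Poly_Mapping.single 0) h (Poly_Mapping.single 0 c * v) = Poly_Mapping.single 0 c * lext (Poly_Mapping.single 0) h v"
    for v :: "nat \<Rightarrow>\<^sub>0 'a" and h :: "nat \<Rightarrow> nat \<Rightarrow>\<^sub>0 'a"
  proof (induction v rule: poly_mapping_add_induct)
    case (single m a)
    show ?case by (simp add: mult_single flip: mult.assoc)
  qed (simp_all add: single0.lext_add distrib_left)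
  then show ?thesis
    by (simp add: gsubst_def gscale_eq lext_pconst_scale subst.hom_mult distrib_left)
qed

text \<open>With its mirror image for \<open>ract\<close>, this reduces multiplicativity of
  \<open>gsubst\<close> to that of \<open>subst\<close>.\<close>

lemma lact_gsubst: "lact (gsubst u f) = subst (usub u) (lact f)"
proof -
  have "ylin (lext (Poly_Mapping.single 0) (\<lambda>i. fst (u i)) v) + lext pconst (\<lambda>i. snd (u i)) v = subst (usub u) (ylin v)" for v
    by (induction v rule: poly_mapping_add_induct)
      (simp_all add: ylin_eq single0.lext_add pconst.lext_add subst.hom_add subst.hom_mult lext_pconst_scale lact_def algebra_simps)
  then show ?thesis by (simp add: lact_def gsubst_def subst.hom_add flip: add.assoc)
qed

lemma ract_gsubst: "ract (gsubst u f) = subst (usub u) (ract f)"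
proof -
  have "zlin (lext (Poly_Mapping.single 0) (\<lambda>i. fst (u i)) v) + lext pconst (\<lambda>i. snd (u i)) v = subst (usub u) (zlin v)" for v
    by (induction v rule: poly_mapping_add_induct)
      (simp_all add: zlin_eq single0.lext_add pconst.lext_add subst.hom_add subst.hom_mult lext_pconst_scale ract_def algebra_simps)
  then show ?thesis by (simp add: ract_def gsubst_def subst.hom_add flip: add.assoc)
qed

lemma gsubst_mult: "gsubst u (gmult f g) = gmult (gsubst u f) (gsubst u g)"
  by (simp add: gmult_eq lact_gsubst ract_gsubst subst.hom_mult)

lemma gsubst_zero [simp]: "gsubst u 0 = 0"
  by (simp add: gsubst_def zero_prod_def)

lemma gsubst_carrier:
  assumes "\<And>i. i \<in> {1..d} \<Longrightarrow> u i \<in> acarrier (Galg d)" "f \<in> acarrier (Galg d)"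
  shows "gsubst u f \<in> acarrier (Galg d)"
  using assms(2)
  by (rule Galg_generated[of "gsubst u -` acarrier (Galg d)" d f, simplified, rotated -1])
    (auto simp: gsubst_add gsubst_scale gsubst_mult carrier_add carrier_scale carrier_mult assms(1))

lemma alg_endo_gsubst:
  assumes "\<And>i. i \<in> {1..d} \<Longrightarrow> u i \<in> acarrier (Galg d)"
  shows "alg_endo (Galg d) (gsubst u)"
  unfolding alg_endo_def using gsubst_carrier[OF assms]
  by (simp add: gsubst_add gsubst_scale gsubst_mult)

lemma alg_endo_zero:
  assumes "alg_endo (Galg d) \<phi>" shows "\<phi> 0 = 0"
proof -
  have "\<phi> (0 + 0) = \<phi> 0 + \<phi> 0"
    using assms carrier_zero[of d] unfolding alg_endo_def Galg_simps by metis
  then show ?thesis by simp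
qed

section \<open>Quotients\<close>

lemma alg_idealD:
  assumes "alg_ideal (Galg d) I"
  shows "I \<subseteq> acarrier (Galg d)" "0 \<in> I" "f \<in> I \<Longrightarrow> g \<in> I \<Longrightarrow> f + g \<in> I" "f \<in> I \<Longrightarrow> gscale c f \<in> I"
    "f \<in> I \<Longrightarrow> - f \<in> I" "f \<in> I \<Longrightarrow> g \<in> I \<Longrightarrow> f - g \<in> I"
    "a \<in> acarrier (Galg d) \<Longrightarrow> f \<in> I \<Longrightarrow> gmult a f \<in> I"
    "a \<in> acarrier (Galg d) \<Longrightarrow> f \<in> I \<Longrightarrow> gmult f a \<in> I"
proof -
  show *: "I \<subseteq> acarrier (Galg d)" "0 \<in> I" "f \<in> I \<Longrightarrow> g \<in> I \<Longrightarrow> f + g \<in> I" "f \<in> I \<Longrightarrow> gscale c f \<in> I"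
    "a \<in> acarrier (Galg d) \<Longrightarrow> f \<in> I \<Longrightarrow> gmult a f \<in> I"
    "a \<in> acarrier (Galg d) \<Longrightarrow> f \<in> I \<Longrightarrow> gmult f a \<in> I" for f g a c
    using assms by (auto simp: alg_ideal_def alg_subspace_def)
  show m: "f \<in> I \<Longrightarrow> - f \<in> I" for f using *(4)[of f "-1"] by (simp add: gscale_minus_one)
  show "f \<in> I \<Longrightarrow> g \<in> I \<Longrightarrow> f - g \<in> I" using *(3)[of f "- g"] m by simp
qed

lemma T_idealD:
  assumes "T_ideal A I"
  shows "alg_ideal A I" "alg_endo A \<phi> \<Longrightarrow> f \<in> I \<Longrightarrow> \<phi> f \<in> I"
  using assms by (auto simp: T_ideal_def)

text \<open>The T-ideal \<open>I0\<close> makes the intersected family nonempty; an empty family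
  would intersect to \<open>UNIV\<close>.\<close>

lemma T_ideal_gen_T_ideal:
  assumes "T_ideal A I0" "S \<subseteq> I0"
  shows "T_ideal A (T_ideal_gen A S)"
proof -
  let ?F = "{I. T_ideal A I \<and> S \<subseteq> I}"
  have "alg_subspace A (\<Inter>?F)"
    unfolding alg_subspace_def
  proof (intro conjI)
    show "\<Inter>?F \<subseteq> acarrier A" using assms by (auto simp: T_ideal_def alg_ideal_def alg_subspace_def)
  qed (auto simp: T_ideal_def alg_ideal_def alg_subspace_def)
  moreover have "alg_ideal A I" if "I \<in> ?F" for I using that by (auto simp: T_ideal_def)
  ultimately have "alg_ideal A (\<Inter>?F)"
    unfolding alg_ideal_def by blast
  then show ?thesis unfolding T_ideal_gen_def T_ideal_def[of A "\<Inter>?F"]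
    by (auto simp: T_ideal_def image_subset_iff)
qed

lemma T_ideal_carrier: "T_ideal (Galg d) (acarrier (Galg d))"
  unfolding T_ideal_def alg_ideal_def alg_subspace_def
  by (auto simp: carrier_add carrier_scale carrier_mult alg_endo_def)

locale galg_quot =
  fixes d :: nat and I :: "'k::comm_ring_1 gelem set"
  assumes T: "T_ideal (Galg d) I"
begin

abbreviation "G \<equiv> acarrier (Galg d)"
abbreviation "Q \<equiv> alg_quot (Galg d) I"
abbreviation "cs \<equiv> alg_coset (Galg d) I"

lemmas ideal = T_idealD(1)[OF T]
lemmas idealD = alg_idealD[OF ideal]

lemma mem_cs: "x \<in> cs a \<longleftrightarrow> x - a \<in> I"
  unfolding alg_coset_def by (force simp: image_iff algebra_simps)

lemma cs_eq_iff: "cs a = cs b \<longleftrightarrow> a - b \<in> I"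
proof
  assume "cs a = cs b"
  moreover have "a \<in> cs a" by (simp add: mem_cs idealD)
  ultimately show "a - b \<in> I" by (simp add: mem_cs)
next
  assume *: "a - b \<in> I"
  show "cs a = cs b"
  proof (rule Set.set_eqI)
    fix x
    have "x - b = (x - a) + (a - b)" "x - a = (x - b) - (a - b)" by simp_all
    then show "x \<in> cs a \<longleftrightarrow> x \<in> cs b" using * idealD(3,6) by (metis mem_cs)
  qed
qed

lemma cs_self: "a \<in> cs a" by (simp add: mem_cs idealD)

lemma cs_carrier: "a \<in> G \<Longrightarrow> x \<in> cs a \<Longrightarrow> x \<in> G"
  using carrier_add[of a d "x - a"] idealD(1) by (auto simp: mem_cs)

text \<open>Turns the unions in \<open>alg_quot\<close> into the coset of a representative: all
  united cosets equal \<open>cs b\<close>, and there is at least one.\<close>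

lemma Union_cs:
  assumes "\<And>x. x \<in> cs a \<Longrightarrow> h x - b \<in> I"
  shows "(\<Union>x\<in>cs a. cs (h x)) = cs b"
  using assms cs_self by (metis (no_types, lifting) SUP_eq_const cs_eq_iff empty_iff)

lemma quot_carrier: "acarrier Q = cs ` G" "azero Q = cs 0"
  by (simp_all add: alg_quot_def)

lemma quot_add: "aadd Q (cs a) (cs b) = cs (a + b)"
proof -
  have "(\<Union>y\<in>cs b. cs (x + y)) = cs (a + b)" if "x \<in> cs a" for x
  proof (rule Union_cs)
    fix y assume "y \<in> cs b"
    moreover have "x + y - (a + b) = (x - a) + (y - b)" by simp
    ultimately show "x + y - (a + b) \<in> I" using that idealD(3) by (metis mem_cs)
  qed
  then have "(\<Union>x\<in>cs a. \<Union>y\<in>cs b. cs (x + y)) = (\<Union>x\<in>cs a. cs (a + b))" by simp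
  then show ?thesis using cs_self[of a] by (auto simp: alg_quot_def)
qed

lemma quot_scale: "ascale Q c (cs a) = cs (gscale c a)"
proof -
  have "(\<Union>x\<in>cs a. cs (gscale c x)) = cs (gscale c a)"
  proof (rule Union_cs)
    fix x assume "x \<in> cs a"
    moreover have "gscale c x - gscale c a = gscale c (x - a)" by (simp add: gscale_eq algebra_simps)
    ultimately show "gscale c x - gscale c a \<in> I" using idealD(4) by (metis mem_cs)
  qed
  then show ?thesis by (simp add: alg_quot_def)
qed

lemma quot_mult:
  assumes "a \<in> G" "b \<in> G"
  shows "amult Q (cs a) (cs b) = cs (gmult a b)"
proof -
  have "(\<Union>y\<in>cs b. cs (gmult x y)) = cs (gmult a b)" if "x \<in> cs a" for x
  proof (rule Union_cs)
    fix y assume "y \<in> cs b"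
    then have "gmult (x - a) y \<in> I" "gmult a (y - b) \<in> I"
      using that assms idealD(7,8) cs_carrier by (auto simp: mem_cs)
    moreover have "gmult x y - gmult a b = gmult (x - a) y + gmult a (y - b)"
      using gmult_simps(1)[of "x - a" a y] gmult_simps(2)[of a "y - b" b] by simp
    ultimately show "gmult x y - gmult a b \<in> I" using idealD(3) by metis
  qed
  then have "(\<Union>x\<in>cs a. \<Union>y\<in>cs b. cs (gmult x y)) = (\<Union>x\<in>cs a. cs (gmult a b))" by simp
  then show ?thesis using cs_self[of a] by (auto simp: alg_quot_def)
qed

lemma induced_endo:
  assumes "alg_endo (Galg d) \<phi>"
  obtains \<psi> where "alg_endo Q \<psi>" "\<And>a. a \<in> G \<Longrightarrow> \<psi> (cs a) = cs (\<phi> a)"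
proof -
  define \<psi> where "\<psi> C = (\<Union>a\<in>C. cs (\<phi> a))" for C
  have e: "\<phi> a \<in> G" "\<phi> (a + b) = \<phi> a + \<phi> b" "\<phi> (gscale c a) = gscale c (\<phi> a)" "\<phi> (gmult a b) = gmult (\<phi> a) (\<phi> b)"
    if "a \<in> G" "b \<in> G" for a b c using assms that unfolding alg_endo_def by auto
  have \<psi>: "\<psi> (cs a) = cs (\<phi> a)" if "a \<in> G" for a
    unfolding \<psi>_def
  proof (rule Union_cs)
    fix x assume x: "x \<in> cs a"
    then have "\<phi> x = \<phi> (x - a) + \<phi> a"
      using e(2)[of "x - a" a] that idealD(1) by (auto simp: mem_cs)
    moreover have "\<phi> (x - a) \<in> I" using x T_idealD(2)[OF T assms] by (simp add: mem_cs)
    ultimately show "\<phi> x - \<phi> a \<in> I" by simp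
  qed
  have "alg_endo Q \<psi>"
    unfolding alg_endo_def
    by (auto simp: quot_carrier quot_add quot_scale quot_mult \<psi> e carrier_add carrier_mult carrier_scale)
  then show ?thesis using \<psi> that by blast
qed

lemma T_ideal_preimage:
  assumes "T_ideal Q K"
  shows "T_ideal (Galg d) {a \<in> G. cs a \<in> K}"
proof -
  have K: "cs 0 \<in> K" "\<And>a b. cs a \<in> K \<Longrightarrow> cs b \<in> K \<Longrightarrow> cs (a + b) \<in> K"
    "\<And>c a. cs a \<in> K \<Longrightarrow> cs (gscale c a) \<in> K"
    "\<And>a b. a \<in> G \<Longrightarrow> b \<in> G \<Longrightarrow> cs a \<in> K \<Longrightarrow> cs (gmult b a) \<in> K \<and> cs (gmult a b) \<in> K"
    using T_idealD(1)[OF assms] unfolding alg_ideal_def alg_subspace_def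
    by (auto simp: quot_carrier simp flip: quot_add quot_scale quot_mult)
  have "cs (\<phi> a) \<in> K" if "alg_endo (Galg d) \<phi>" "a \<in> G" "cs a \<in> K" for \<phi> a
    using induced_endo[OF that(1)] T_idealD(2)[OF assms _ that(3)] that(2) by metis
  then show ?thesis
    unfolding T_ideal_def alg_ideal_def alg_subspace_def
    using K by (auto simp: carrier_add carrier_mult carrier_scale alg_endo_def)
qed

lemma lift_endo:
  assumes "alg_endo Q \<psi>"
  obtains \<phi> where "alg_endo (Galg d) \<phi>" "\<And>a. a \<in> G \<Longrightarrow> \<psi> (cs a) = cs (\<phi> a)"
proof -
  have e: "\<psi> (cs a) \<in> cs ` G" "\<psi> (cs (a + b)) = aadd Q (\<psi> (cs a)) (\<psi> (cs b))"
    "\<psi> (cs (gscale c a)) = ascale Q c (\<psi> (cs a))" "\<psi> (cs (gmult a b)) = amult Q (\<psi> (cs a)) (\<psi> (cs b))"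
    if "a \<in> G" "b \<in> G" for a b c
    using assms that unfolding alg_endo_def
    by (auto simp: quot_carrier simp flip: quot_add quot_scale quot_mult)
  have "\<forall>i\<in>{1..d}. \<exists>u\<in>G. \<psi> (cs (x_gen i)) = cs u"
    using e(1)[OF carrier_x_gen carrier_x_gen] by blast
  then obtain u where u: "\<And>i. i \<in> {1..d} \<Longrightarrow> u i \<in> G \<and> \<psi> (cs (x_gen i)) = cs (u i)"
    by metis
  have \<phi>: "alg_endo (Galg d) (gsubst u)" using u by (intro alg_endo_gsubst) auto
  have "\<psi> (cs a) = cs (gsubst u a)" if "a \<in> G" for a
  proof -
    let ?T = "{a. \<psi> (cs a) = cs (gsubst u a)}"
    have g: "gsubst u a \<in> G" if "a \<in> G" for a using gsubst_carrier[of d u a] u that by blast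
    \<comment> \<open>\<open>alg_endo\<close> does not list preservation of zero; it follows by
      writing 0 as a multiple by the scalar 0, since scaling any representative by 0 gives
      0.\<close>
    have "gscale 0 0 = (0 :: 'k gelem)" by (simp add: gscale_eq zero_prod_def)
    have "\<psi> (cs 0) = cs 0"
    proof -
      obtain b where "\<psi> (cs 0) = cs b" using e(1)[of 0 0] by auto
      then have "cs b = cs (gscale 0 b)" using e(3)[of 0 0 0] \<open>gscale 0 0 = (0 :: 'k gelem)\<close>
        by (simp add: quot_scale)
      moreover have "gscale 0 b = 0" by (simp add: gscale_eq zero_prod_def)
      ultimately show ?thesis using \<open>\<psi> (cs 0) = cs b\<close> by simp
    qed
    then have "a \<in> ?T" using that
      by (intro Galg_generated[of ?T d a])
        (auto simp: e gsubst_add gsubst_scale gsubst_mult quot_add quot_scale quot_mult g u)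
    then show ?thesis by simp
  qed
  with \<phi> show ?thesis using that by blast
qed

text \<open>An endomorphism of the quotient is lifted by \<open>lift_endo\<close> before the closure
  of \<open>J\<close> applies. The image then bounds from above the T-ideal generated by any of its
  elements.\<close>

lemma T_ideal_image:
  assumes J: "T_ideal (Galg d) J"
  shows "T_ideal Q (cs ` J)"
proof -
  note JD = alg_idealD[OF T_idealD(1)[OF J]]
  have JG: "a \<in> G" if "a \<in> J" for a using that JD(1) by blast
  have "\<psi> (cs a) \<in> cs ` J" if "alg_endo Q \<psi>" "a \<in> J" for \<psi> a
    using lift_endo[OF that(1)] T_idealD(2)[OF J _ that(2)] JG[OF that(2)] by (metis imageI)
  moreover have "alg_ideal Q (cs ` J)"
    unfolding alg_ideal_def alg_subspace_def
    by (auto simp: quot_carrier quot_add quot_scale quot_mult JG JD(2-4,7,8))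
  ultimately show ?thesis unfolding T_ideal_def by blast
qed

text \<open>The group acts on the quotient by images of cosets as sets, so the image must be a whole
  coset. For this the endomorphism has to map \<open>I\<close> onto itself; that \<open>I\<close>
  lies in its image uses the inverse endomorphism, which preserves the T-ideal too.\<close>

lemma cs_image_endo_inverse:
  assumes "alg_endo (Galg d) \<phi>" "alg_endo (Galg d) \<phi>'"
    and "\<And>a. a \<in> G \<Longrightarrow> \<phi> (\<phi>' a) = a" "a \<in> G"
  shows "\<phi> ` cs a = cs (\<phi> a)"
proof -
  have add: "\<phi> (x + y) = \<phi> x + \<phi> y" if "x \<in> G" "y \<in> G" for x y
    using assms(1) that unfolding alg_endo_def by auto
  have "\<phi> (a + x) = \<phi> a + \<phi> x" if "x \<in> I" for x using add that assms idealD(1) by blast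
  then have "\<phi> ` cs a = (+) (\<phi> a) ` (\<phi> ` I)"
    unfolding alg_coset_def Galg_simps image_image by (intro image_cong) auto
  moreover have "\<phi> ` I = I"
  proof
    show "\<phi> ` I \<subseteq> I" using T_idealD(2)[OF T assms(1)] by blast
    show "I \<subseteq> \<phi> ` I"
    proof
      fix x assume "x \<in> I"
      then show "x \<in> \<phi> ` I"
        using T_idealD(2)[OF T assms(2), of x] assms(3)[of x] idealD(1) by (metis imageI subsetD)
    qed
  qed
  ultimately show ?thesis
    by (simp add: alg_coset_def)
qed

end

lemma alg_auto_inverse:
  assumes "alg_auto (Galg d) \<phi>"
  obtains \<phi>' where "alg_endo (Galg d) \<phi>'" "\<And>a. a \<in> acarrier (Galg d) \<Longrightarrow> \<phi> (\<phi>' a) = a"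
proof -
  let ?G = "acarrier (Galg d) :: 'a gelem set"
  have e: "\<phi> a \<in> ?G" "\<phi> (a + b) = \<phi> a + \<phi> b" "\<phi> (gscale c a) = gscale c (\<phi> a)" "\<phi> (gmult a b) = gmult (\<phi> a) (\<phi> b)"
    if "a \<in> ?G" "b \<in> ?G" for a b c using assms that unfolding alg_endo_def alg_auto_def by auto
  have bij: "bij_betw \<phi> ?G ?G" using assms by (simp add: alg_auto_def)
  define \<phi>' where "\<phi>' = inv_into ?G \<phi>"
  have i: "\<phi>' a \<in> ?G" "\<phi> (\<phi>' a) = a" if "a \<in> ?G" for a
    using bij that unfolding \<phi>'_def by (auto simp: bij_betw_def f_inv_into_f intro!: inv_into_into)
  have inj: "x = \<phi>' a" if "x \<in> ?G" "\<phi> x = a" for x a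
    using bij that unfolding \<phi>'_def by (auto simp: bij_betw_def)
  have "alg_endo (Galg d) \<phi>'"
    unfolding alg_endo_def Galg_simps
    by (auto simp: i e carrier_add carrier_scale carrier_mult intro!: inj[symmetric])
  then show ?thesis using that i by blast
qed

section \<open>Reduction of consequences to statements in \<open>G\<^sub>d\<close>\<close>

definition GL_space :: "nat \<Rightarrow> 'k::field gelem set \<Rightarrow> bool" where
  "GL_space d W \<longleftrightarrow> alg_subspace (Galg d) W \<and> (\<forall>g \<phi>. GL_action d g \<phi> \<longrightarrow> \<phi> ` W \<subseteq> W)"

lemma G_hom_iff: "f \<in> G_hom d n \<longleftrightarrow>
    f \<in> acarrier (Galg d) \<and> (fst f \<noteq> 0 \<longrightarrow> n = 1) \<and> snd f \<in> psupp (hmonos d n)"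
  by (cases f) (auto simp: G_hom_def carrier_iff hmonos_def psupp_def mixed_def)

lemma G_hom_of_yz: "of_yz p \<in> G_hom d n \<longleftrightarrow> p \<in> psupp (hmonos d n)"
  unfolding G_hom_iff carrier_of_yz mixed_def by (auto simp: of_yz_def psupp_def hmonos_def)

lemma G_homE:
  assumes "f \<in> G_hom d n" "n \<ge> 2"
  obtains p where "f = of_yz p" "p \<in> psupp (hmonos d n)"
  using assms by (cases f) (auto simp: G_hom_iff of_yz_def)

lemma G_hom_add: "f \<in> G_hom d n \<Longrightarrow> g \<in> G_hom d n \<Longrightarrow> f + g \<in> G_hom d n"
  by (auto simp: G_hom_iff carrier_add psupp_add)

lemma G_hom_scale: "f \<in> G_hom d n \<Longrightarrow> gscale c f \<in> G_hom d n"
  using carrier_scale[of f d c] by (auto simp: G_hom_iff gscale_eq psupp_pconst_mult)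

lemma G_hom_zero: "0 \<in> G_hom d n"
  by (auto simp: G_hom_iff)

text \<open>Degree alone, without requiring a y and a z: the variables y_i and z_i, through which
  x_i acts, must have degree 1.\<close>

definition degmonos :: "nat \<Rightarrow> nat \<Rightarrow> mono set" where
  "degmonos d n = {m. ydeg d m + zdeg d m = n}"

lemma psupp_degmonos_mult:
  "p \<in> psupp (degmonos d m) \<Longrightarrow> q \<in> psupp (degmonos d n) \<Longrightarrow> p * q \<in> psupp (degmonos d (m + n))"
  by (erule psupp_mult) (auto simp: degmonos_def ydeg_add zdeg_add)

lemma G_hom_degmonos:
  assumes "f \<in> G_hom d n"
  shows "lact f \<in> psupp (degmonos d n)" "ract f \<in> psupp (degmonos d n)"
proof -
  have v: "y_var i \<in> psupp (degmonos d 1)" "z_var i \<in> psupp (degmonos d 1)" if "i \<in> {1..d}" for i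
    using that mexp_degs[of "[i]" d "[]"] mexp_degs[of "[]" d "[i]"]
    by (auto simp: psupp_def y_var_def z_var_def degmonos_def mexp_def)
  have "ylin (fst f) \<in> psupp (degmonos d n)" "zlin (fst f) \<in> psupp (degmonos d n)"
  proof (atomize (full), cases "fst f = 0")
    case False
    then have "n = 1" "Poly_Mapping.keys (fst f) \<subseteq> {1..d}"
      using assms by (auto simp: G_hom_iff carrier_iff psupp_def)
    then show "ylin (fst f) \<in> psupp (degmonos d n) \<and> zlin (fst f) \<in> psupp (degmonos d n)"
      unfolding ylin_def zlin_def using v by (blast intro: psupp_sum psupp_pconst_mult)
  qed (simp add: ylin_def zlin_def)
  moreover have "snd f \<in> psupp (degmonos d n)"
    using assms by (auto simp: G_hom_iff psupp_def hmonos_def degmonos_def)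
  ultimately show "lact f \<in> psupp (degmonos d n)" "ract f \<in> psupp (degmonos d n)"
    by (auto simp: lact_def ract_def psupp_add)
qed

lemma G_hom_mult:
  assumes "f \<in> G_hom d m" "g \<in> G_hom d n"
  shows "gmult f g \<in> G_hom d (m + n)"
proof -
  have "lact f * ract g \<in> psupp (degmonos d (m + n))" "lact f * ract g \<in> mixed d"
    using psupp_degmonos_mult[OF G_hom_degmonos(1)[OF assms(1)] G_hom_degmonos(2)[OF assms(2)]] assms
    by (auto intro: mixed_mult lact_psupp ract_psupp simp: G_hom_iff)
  then show ?thesis unfolding gmult_eq G_hom_of_yz mixed_def
    by (auto simp: psupp_def hmonos_def degmonos_def)
qed

lemma endo_G_hom:
  assumes "alg_endo (Galg d) \<phi>" "\<And>i. i \<in> {1..d} \<Longrightarrow> \<phi> (x_gen i) \<in> G_hom d 1" "n \<ge> 2" "f \<in> G_hom d n"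
  shows "\<phi> f \<in> G_hom d n"
proof -
  have e: "\<phi> (a + b) = \<phi> a + \<phi> b" "\<phi> (gscale c a) = gscale c (\<phi> a)" "\<phi> (gmult a b) = gmult (\<phi> a) (\<phi> b)"
    if "a \<in> acarrier (Galg d)" "b \<in> acarrier (Galg d)" for a b c using assms(1) that unfolding alg_endo_def by auto
  have YZ: "\<phi> (of_yz (Ymon is * Zmon js)) \<in> G_hom d (length is + length js)"
    if "set is \<subseteq> {1..d}" "set js \<subseteq> {1..d}" "is \<noteq> []" "js \<noteq> []" for "is" js
    using that
  proof (induction rule: YZ_generated)
    case (base i j)
    then show ?case using e(3)[OF carrier_x_gen carrier_x_gen, of i j]
        G_hom_mult[OF assms(2,2), of i j] by (simp add: gmult_eq[of "x_gen i"])
  next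
    case (left i "is" js)
    then show ?case using e(3)[OF carrier_x_gen, of i "of_yz (Ymon is * Zmon js)"]
        G_hom_mult[OF assms(2) left(6), of i] by (simp add: gmult_eq[of "x_gen i"] YZ_mixed mult_ac)
  next
    case (right j "is" js)
    then show ?case using e(3)[OF _ carrier_x_gen, of "of_yz (Ymon is * Zmon js)" j]
        G_hom_mult[OF right(6) assms(2), of j] by (simp add: gmult_eq[of _ "x_gen j"] YZ_mixed mult_ac)
  qed
  obtain p where p: "f = of_yz p" "p \<in> psupp (hmonos d n)" using G_homE[OF assms(4,3)] .
  let ?W = "{p \<in> mixed d. \<phi> (of_yz p) \<in> G_hom d n}"
  have "lin_closed ?W"
    unfolding lin_closed_def using alg_endo_zero[OF assms(1)]
    by (auto simp: mixed_def psupp_add psupp_pconst_mult e(1) e(2)[OF _ carrier_zero] G_hom_zero G_hom_add G_hom_scale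
        simp flip: of_yz_simps)
  then have "p \<in> ?W" using p(2)
  proof (rule psupp_span[where d = d])
    fix "is" js assume "mexp is js \<in> hmonos d n" "set is \<subseteq> {1..d}" "set js \<subseteq> {1..d}"
    then show "Ymon is * Zmon js \<in> ?W"
      using YZ[of "is" js] YZ_mixed[of "is" d js] hmonos_mexp[of "is" d js n] by auto
  qed (auto simp: hmonos_def ymonos_def)
  then show ?thesis using p by simp
qed

lemma GL_action_G_hom:
  assumes "GL_action d g \<phi>" "n \<ge> 2" "f \<in> G_hom d n"
  shows "\<phi> f \<in> G_hom d n"
proof (rule endo_G_hom[OF _ _ assms(2,3)])
  show "alg_endo (Galg d) \<phi>" using assms(1) by (simp add: GL_action_def alg_auto_def)
  fix j assume "j \<in> {1..d}"
  moreover have "x_gen i \<in> G_hom d 1" if "i \<in> {1..d}" for i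
    unfolding G_hom_iff using carrier_x_gen[OF that] by (simp add: x_gen_def)
  then have "(\<Sum>i\<in>X. gscale (h i) (x_gen i)) \<in> G_hom d 1" if "X \<subseteq> {1..d}" for X and h :: "nat \<Rightarrow> 'a"
    using that by (induction X rule: infinite_finite_induct) (auto simp: G_hom_zero intro!: G_hom_add G_hom_scale)
  ultimately show "\<phi> (x_gen j) \<in> G_hom d 1" using assms(1) by (simp add: GL_action_def)
qed

abbreviation D2 :: "nat \<Rightarrow> nat \<Rightarrow> 'k::comm_ring_1 yzpoly" where
  "D2 i j \<equiv> y_var i * z_var j - y_var j * z_var i"

text \<open>The generator is the defining identity evaluated at x = x_1, y = x_2, so it is built
  within the carrier by products, differences and scalings.\<close>

lemma V_gen_carrier:
  assumes "d \<ge> 2"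
  shows "of_yz ((pconst \<beta>1 * y_var 1 + pconst \<beta>2 * z_var 1) * D2 1 2) \<in> acarrier (Galg d)"
proof -
  let ?t = "gmult (x_gen 1) (x_gen 2) - gmult (x_gen 2) (x_gen 1) :: 'a gelem"
  have x: "x_gen 1 \<in> acarrier (Galg d)" "x_gen 2 \<in> acarrier (Galg d)"
    using assms by (auto intro!: carrier_x_gen)
  then have "gscale \<beta>1 (gmult (x_gen 1) ?t) + gscale \<beta>2 (gmult ?t (x_gen 1)) \<in> acarrier (Galg d)"
    by (intro carrier_add carrier_scale carrier_mult carrier_diff)
  then show ?thesis
    by (simp add: gmult_eq of_yz_simps algebra_simps)
qed

lemma T_ideal_V_ideal:
  assumes "d \<ge> 2"
  shows "T_ideal (Galg d) (V_ideal d \<beta>1 \<beta>2)"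
  unfolding V_ideal_def
  by (rule T_ideal_gen_T_ideal[OF T_ideal_carrier]) (use V_gen_carrier[OF assms] in auto)

locale gv =
  fixes d :: nat and \<beta>1 \<beta>2 :: "'k::field"
  assumes d2: "d \<ge> 2"
begin

abbreviation "V \<equiv> V_ideal d \<beta>1 \<beta>2"

sublocale galg_quot d V
  by unfold_locales (rule T_ideal_V_ideal[OF d2])

lemma GV_simps: "GV d \<beta>1 \<beta>2 = Q" "GV_image d \<beta>1 \<beta>2 = cs" "GV_hom d \<beta>1 \<beta>2 n = cs ` G_hom d n"
  by (auto simp: GV_def GV_image_def GV_hom_def)

text \<open>A consequence has one representative in \<open>J\<close> and another that is
  homogeneous; they differ by an element of V, which lies in \<open>J\<close>, so the homogeneous
  one is in \<open>J\<close> as well.\<close>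

lemma consequences_subset:
  assumes J: "T_ideal (Galg d) J" "V \<subseteq> J" "f \<in> J"
  shows "consequences d \<beta>1 \<beta>2 m f \<subseteq> cs ` (J \<inter> G_hom d m)"
proof
  fix C assume "C \<in> consequences d \<beta>1 \<beta>2 m f"
  then have "C \<in> cs ` J" "C \<in> cs ` G_hom d m"
    using T_ideal_image[OF J(1)] J(3) unfolding consequences_def GV_simps T_ideal_gen_def by auto
  then obtain a b where ab: "a \<in> J" "b \<in> G_hom d m" "C = cs a" "C = cs b" by auto
  then have "a - b \<in> J" using J(2) cs_eq_iff by blast
  then have "a - (a - b) \<in> J" using alg_idealD(6)[OF T_idealD(1)[OF J(1)]] ab(1) by blast
  then have "b \<in> J \<inter> G_hom d m" using ab(2) by simp
  then show "C \<in> cs ` (J \<inter> G_hom d m)" unfolding ab(4) by (rule imageI)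
qed

lemma zero_in_consequences: "cs 0 \<in> consequences d \<beta>1 \<beta>2 m f"
  unfolding consequences_def GV_simps T_ideal_gen_def
  using G_hom_zero by (auto simp: T_ideal_def alg_ideal_def alg_subspace_def quot_carrier(2))

lemma GL_action_cs:
  assumes "GL_action d g \<phi>" "a \<in> G"
  shows "\<phi> ` cs a = cs (\<phi> a)" "\<phi> a \<in> G"
proof -
  have "alg_auto (Galg d) \<phi>" using assms(1) by (simp add: GL_action_def)
  then obtain \<phi>' where "alg_endo (Galg d) \<phi>'" "\<And>a. a \<in> G \<Longrightarrow> \<phi> (\<phi>' a) = a" "alg_endo (Galg d) \<phi>"
    using alg_auto_inverse by (metis alg_auto_def)
  then show "\<phi> ` cs a = cs (\<phi> a)" "\<phi> a \<in> G"
    using cs_image_endo_inverse assms(2) by (auto simp: alg_endo_def)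
qed

text \<open>The squeeze. \<open>lower\<close>, applied to the preimage of the T-ideal generated in
  the quotient, shows that the list consists of consequences; \<open>upper\<close>, applied to the
  preimage of a submodule, catches the degree n + 1 part of \<open>J\<close>. So \<open>J\<close>
  may be larger than the T-ideal generated by V and f, provided that this part is no larger.\<close>

lemma consequences_equivI:
  assumes f: "f \<in> G" and L: "L \<subseteq> G_hom d (n + 1)" and n: "n \<ge> 1"
    and lower: "\<And>I. T_ideal (Galg d) I \<Longrightarrow> V \<subseteq> I \<Longrightarrow> f \<in> I \<Longrightarrow> L \<subseteq> I"
    and J: "T_ideal (Galg d) J" "V \<subseteq> J" "f \<in> J"
    and upper: "\<And>W. GL_space d W \<Longrightarrow> V \<subseteq> W \<Longrightarrow> L \<subseteq> W \<Longrightarrow> J \<inter> G_hom d (n + 1) \<subseteq> W"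
  shows "consequences_equiv d \<beta>1 \<beta>2 n f L"
  unfolding consequences_equiv_def
proof
  let ?K = "T_ideal_gen Q {cs f}" and ?C = "consequences d \<beta>1 \<beta>2 (n + 1) f"
  have K: "T_ideal Q ?K"
    using T_ideal_gen_T_ideal[OF T_ideal_image[OF T_ideal_carrier], of "{cs f}"] f by simp
  have fK: "cs f \<in> ?K" by (auto simp: T_ideal_gen_def)
  have C: "?C = ?K \<inter> cs ` G_hom d (n + 1)" by (simp add: consequences_def GV_simps)
  let ?P = "{a \<in> G. cs a \<in> ?K}"
  have P: "T_ideal (Galg d) ?P" by (rule T_ideal_preimage[OF K])
  have VP: "V \<subseteq> ?P"
  proof
    fix a assume "a \<in> V"
    then have "cs a = cs 0" "a \<in> G" using cs_eq_iff[of a 0] idealD(1) by auto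
    then show "a \<in> ?P" using K by (simp add: T_ideal_def alg_ideal_def alg_subspace_def quot_carrier(2))
  qed
  have "L \<subseteq> ?P" using lower[OF P VP] f fK by blast
  then have "cs ` L \<subseteq> ?C" using L C by blast
  moreover have "alg_subspace Q ?C"
    using K unfolding C T_ideal_def alg_ideal_def alg_subspace_def
    by (auto simp: quot_carrier(2) quot_add quot_scale simp del: add_Pair
        intro!: imageI G_hom_zero G_hom_add G_hom_scale)
  moreover have "\<phi> ` C' \<in> ?C" if g: "GL_action d g \<phi>" and C': "C' \<in> ?C" for g \<phi> C'
  proof -
    obtain a where a: "a \<in> G_hom d (n + 1)" "C' = cs a" "cs a \<in> ?K" using C' C by auto
    then have aG: "a \<in> G" by (simp add: G_hom_iff)
    have "alg_endo (Galg d) \<phi>" using g by (simp add: GL_action_def alg_auto_def)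
    then have "\<phi> a \<in> ?P" using T_idealD(2)[OF P] a(3) aG by blast
    then show ?thesis
      using GL_action_cs[OF g aG] GL_action_G_hom[OF g _ a(1)] n a(2) C by auto
  qed
  ultimately show "GL_submodule_gen d \<beta>1 \<beta>2 (GV_image d \<beta>1 \<beta>2 ` L) \<subseteq> ?C"
    unfolding GL_submodule_gen_def GV_simps by blast
next
  show "consequences d \<beta>1 \<beta>2 (n + 1) f \<subseteq> GL_submodule_gen d \<beta>1 \<beta>2 (GV_image d \<beta>1 \<beta>2 ` L)"
    unfolding GL_submodule_gen_def GV_simps
  proof (intro Inter_greatest subsetI)
    fix W C assume "W \<in> {W. alg_subspace Q W \<and> (\<forall>g \<phi>. GL_action d g \<phi> \<longrightarrow> (\<forall>C\<in>W. \<phi> ` C \<in> W)) \<and> cs ` L \<subseteq> W}"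
      and C: "C \<in> consequences d \<beta>1 \<beta>2 (n + 1) f"
    then have W: "alg_subspace Q W" "\<And>g \<phi> C. GL_action d g \<phi> \<Longrightarrow> C \<in> W \<Longrightarrow> \<phi> ` C \<in> W" "cs ` L \<subseteq> W"
      by blast+
    let ?W = "{a \<in> G. cs a \<in> W}"
    have "alg_subspace (Galg d) ?W"
      using W(1) unfolding alg_subspace_def
      by (auto simp: quot_carrier carrier_add carrier_scale simp flip: quot_add quot_scale)
    then have "GL_space d ?W"
      unfolding GL_space_def using GL_action_cs W(2) by fastforce
    moreover have "V \<subseteq> ?W"
    proof
      fix a assume "a \<in> V"
      then have "cs a = cs 0" "a \<in> G" using cs_eq_iff[of a 0] idealD(1) by auto
      then show "a \<in> ?W" using W(1) by (simp add: alg_subspace_def quot_carrier(2))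
    qed
    moreover have "L \<subseteq> ?W" using W(3) L by (auto simp: G_hom_iff)
    ultimately have "J \<inter> G_hom d (n + 1) \<subseteq> ?W" by (rule upper)
    then show "C \<in> W" using consequences_subset[OF J, of "n + 1"] C by blast
  qed
qed

end

section \<open>Polarization\<close>

text \<open>Uniqueness in the universal property of the polynomial ring; \<open>hom_ext\<close>
  turns it into a way to compare two homomorphisms on constants and variables.\<close>

lemma hom_eq_peval:
  assumes "comm_ring_hom h"
  shows "h p = peval (\<lambda>c. h (pconst c)) (\<lambda>x. h (Poly_Mapping.single (Poly_Mapping.single x 1) 1)) p"
proof -
  interpret comm_ring_hom h by fact
  let ?\<iota> = "\<lambda>c. h (pconst c)" and ?\<sigma> = "\<lambda>x. h (Poly_Mapping.single (Poly_Mapping.single x 1) 1)"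
  interpret \<iota>: comm_ring_hom ?\<iota>
    by unfold_locales (simp_all add: pconst.hom_add pconst.hom_mult hom_add hom_mult)
  have x: "h (Poly_Mapping.single (Poly_Mapping.single x k) 1) = ?\<sigma> x ^ k" for x k
  proof (induction k)
    case (Suc k)
    have "Poly_Mapping.single (Poly_Mapping.single x (Suc k)) 1
        = (Poly_Mapping.single (Poly_Mapping.single x 1) 1 :: 'a yzpoly) * Poly_Mapping.single (Poly_Mapping.single x k) 1"
      by (simp add: mult_single flip: single_add)
    then show ?case using Suc by (simp add: hom_mult)
  qed simp
  have m: "h (Poly_Mapping.single m 1) = mono_eval ?\<sigma> m" for m
  proof (induction m rule: poly_mapping_add_induct)
    case (add m n)
    have "Poly_Mapping.single (m + n) 1 = (Poly_Mapping.single m 1 :: 'a yzpoly) * Poly_Mapping.single n 1"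
      by (simp add: mult_single)
    then show ?case using add by (simp add: hom_mult mono_eval_add)
  next
    case (single y k)
    show ?case unfolding mono_eval_single by (rule x)
  qed simp
  show ?thesis
    unfolding peval_def
  proof (induction p rule: poly_mapping_add_induct)
    case (single n c)
    have "h (Poly_Mapping.single n c) = h (pconst c * Poly_Mapping.single n 1)"
      by (simp add: pconst_def mult_single)
    also have "\<dots> = h (pconst c) * mono_eval ?\<sigma> n" unfolding hom_mult m[of n] ..
    finally show ?case by (simp only: \<iota>.lext_single)
  qed (simp_all add: hom_add \<iota>.lext_add)
qed

lemma hom_ext:
  assumes "comm_ring_hom h" "comm_ring_hom h'" "\<And>c. h (pconst c) = h' (pconst c)"
    "\<And>i. h (y_var i) = h' (y_var i)" "\<And>i. h (z_var i) = h' (z_var i)"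
  shows "h p = h' p"
proof -
  have "h (Poly_Mapping.single (Poly_Mapping.single x 1) 1) = h' (Poly_Mapping.single (Poly_Mapping.single x 1) 1)" for x
    using assms(4,5) by (cases x) (auto simp: y_var_def z_var_def)
  then show ?thesis unfolding hom_eq_peval[OF assms(1), of p] hom_eq_peval[OF assms(2), of p] by (simp add: assms(3))
qed

lemma comm_ring_hom_comp: "comm_ring_hom f \<Longrightarrow> comm_ring_hom g \<Longrightarrow> comm_ring_hom (\<lambda>x. f (g x))"
proof -
  assume "comm_ring_hom f" "comm_ring_hom g"
  then interpret f: comm_ring_hom f + g: comm_ring_hom g .
  show ?thesis by unfold_locales (simp_all add: f.hom_add f.hom_mult g.hom_add g.hom_mult)
qed

section \<open>Transvections and the derivations obtained from them\<close>

definition tsub :: "nat \<Rightarrow> nat \<Rightarrow> var \<Rightarrow> 'k::comm_ring_1 yzpoly poly" where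
  "tsub i j x = (case x of
      Yv k \<Rightarrow> if k = i then [:y_var i, y_var j:] else [:y_var k:]
    | Zv k \<Rightarrow> if k = i then [:z_var i, z_var j:] else [:z_var k:])"

text \<open>The polynomial variable of \<open>texp i j p\<close> is the parameter \<open>t\<close> of the transvection
  \<open>x\<^sub>i \<mapsto> x\<^sub>i + t x\<^sub>j\<close>.\<close>

definition texp :: "nat \<Rightarrow> nat \<Rightarrow> 'k::comm_ring_1 yzpoly \<Rightarrow> 'k yzpoly poly" where
  "texp i j = peval (\<lambda>c. [:pconst c:]) (tsub i j)"

lemma comm_ring_hom_pCons: "comm_ring_hom (\<lambda>c. [:pconst c:])"
  by unfold_locales (simp_all add: pconst.hom_add pconst.hom_mult one_pCons)

interpretation texp: comm_ring_hom "texp i j"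
  unfolding texp_def by (rule comm_ring_hom_peval[OF comm_ring_hom_pCons])

lemma comm_ring_hom_poly: "comm_ring_hom (\<lambda>F. poly F a)"
  by unfold_locales simp_all

definition transv :: "nat \<Rightarrow> nat \<Rightarrow> 'k::comm_ring_1 \<Rightarrow> nat \<Rightarrow> 'k gelem" where
  "transv i j c k = (if k = i then x_gen i + gscale c (x_gen j) else x_gen k)"

lemma poly_texp: "poly (texp i j p) (pconst c) = subst (usub (transv i j c)) p"
  by (rule hom_ext[OF comm_ring_hom_comp[OF comm_ring_hom_poly texp.comm_ring_hom_axioms] subst.comm_ring_hom_axioms])
    (auto simp: texp_def comm_ring_hom_pCons tsub_def transv_def mult.commute)

lemma coeff_texp_0: "coeff (texp i j p) 0 = p"
proof -
  have "poly (texp i j p) 0 = (\<lambda>p. p) p"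
    by (rule hom_ext[OF comm_ring_hom_comp[OF comm_ring_hom_poly texp.comm_ring_hom_axioms]])
      (unfold_locales, auto simp: texp_def comm_ring_hom_pCons tsub_def)
  then show ?thesis by (simp add: poly_0_coeff_0)
qed

text \<open>The derivation sending x_i to x_j and killing the other generators, read off as the
  coefficient of t. The Leibniz rule is then the product rule for coefficients, the constant
  coefficient being p itself.\<close>

definition polar :: "nat \<Rightarrow> nat \<Rightarrow> 'k::comm_ring_1 yzpoly \<Rightarrow> 'k yzpoly" where
  "polar i j p = coeff (texp i j p) 1"

lemma polar_mult: "polar i j (p * q) = polar i j p * q + p * polar i j q"
  by (simp add: polar_def texp.hom_mult coeff_mult coeff_texp_0)

lemma polar_simps [simp]:
  "polar i j (p + q) = polar i j p + polar i j q" "polar i j (p - q) = polar i j p - polar i j q"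
  "polar i j (pconst c) = 0" "polar i j (y_var i) = y_var j" "polar i j (z_var i) = z_var j"
  "k \<noteq> i \<Longrightarrow> polar i j (y_var k) = 0" "k \<noteq> i \<Longrightarrow> polar i j (z_var k) = 0"
  "polar i j 1 = 0" "polar i j 0 = 0"
  by (simp_all add: polar_def texp.hom_add texp.hom_minus)
    (simp_all add: texp_def comm_ring_hom_pCons tsub_def)

lemma polar_numeral [simp]: "polar i j (numeral k) = 0"
  using polar_simps(3)[of i j "numeral k"] by (simp add: pconst_def)

lemma polar_pconst_mult [simp]: "polar i j (pconst c * p) = pconst c * polar i j p"
  by (simp add: polar_mult)

lemma polar_sum: "polar i j (sum f A) = (\<Sum>a\<in>A. polar i j (f a))"
  by (induction A rule: infinite_finite_induct) simp_all

lemma polar_power: "polar i j (p ^ n) = of_nat n * p ^ (n - 1) * polar i j p"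
proof (induction n)
  case (Suc n)
  then show ?case by (cases n) (simp_all add: polar_mult algebra_simps)
qed simp

lemma polar_Ymon: "i \<notin> set is \<Longrightarrow> polar i j (Ymon is) = 0"
  and polar_Zmon: "i \<notin> set is \<Longrightarrow> polar i j (Zmon is) = 0"
  by (induction "is") (auto simp: polar_mult)

text \<open>With F(c) the sum of the c^k a k, the combination F(2c) - 2^N F(c) removes the top term
  and multiplies a k by 2^k - 2^N, which is nonzero in characteristic 0. Induction on the number of
  terms takes the place of a Vandermonde determinant.\<close>

lemma lin_closed_extract_seq:
  fixes W :: "'k::field_char_0 yzpoly set"
  assumes W: "lin_closed W" and "\<And>c. (\<Sum>k<N. pconst (c ^ k) * a k) \<in> W" and "k < N"
  shows "a k \<in> W"
  using assms(2,3)
proof (induction N arbitrary: a k)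
  case (Suc N)
  let ?F = "\<lambda>c. \<Sum>k<Suc N. pconst (c ^ k) * a k"
  have "(\<Sum>k<N. pconst (c ^ k) * (pconst (2 ^ k - 2 ^ N) * a k)) \<in> W" for c
  proof -
    have "pconst ((2 * c) ^ k) * a k - pconst (2 ^ N) * (pconst (c ^ k) * a k)
        = pconst (c ^ k) * (pconst (2 ^ k - 2 ^ N) * a k)" for k
      unfolding power_mult_distrib pconst.hom_mult pconst.hom_minus by (simp only: algebra_simps)
    then have "?F (2 * c) - pconst (2 ^ N) * ?F c
        = (\<Sum>k<Suc N. pconst (c ^ k) * (pconst (2 ^ k - 2 ^ N) * a k))"
      by (simp only: sum_distrib_left sum_subtractf[symmetric])
    also have "\<dots> = (\<Sum>k<N. pconst (c ^ k) * (pconst (2 ^ k - 2 ^ N) * a k))"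
      by simp
    finally have "?F (2 * c) - pconst (2 ^ N) * ?F c
        = (\<Sum>k<N. pconst (c ^ k) * (pconst (2 ^ k - 2 ^ N) * a k))" .
    moreover have "?F (2 * c) - pconst (2 ^ N) * ?F c \<in> W"
      by (intro lin_closedD(3,5)[OF W] Suc.prems(1))
    ultimately show ?thesis by (simp only:)
  qed
  moreover have "(2 :: 'k) ^ k \<noteq> 2 ^ N" if "k < N" for k
  proof -
    have "of_nat (2 ^ k) \<noteq> (of_nat (2 ^ N) :: 'k)" using that by (simp del: of_nat_power)
    then show ?thesis by simp
  qed
  ultimately have *: "a k \<in> W" if "k < N" for k
    using Suc.IH[of "\<lambda>k. pconst (2 ^ k - 2 ^ N) * a k", OF _ that] that
    by (auto intro!: lin_closed_cancel[OF W, of "2 ^ k - 2 ^ N"])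
  have "?F 1 - (\<Sum>k<N. a k) \<in> W"
    by (intro lin_closedD(5)[OF W] Suc.prems(1) lin_closed_sum[OF W] *) auto
  then have "a N \<in> W" by simp
  then show ?case using * Suc.prems(2) by (cases "k = N") auto
qed simp

lemma lin_closed_extract:
  fixes W :: "'k::field_char_0 yzpoly set"
  assumes W: "lin_closed W" and F: "\<And>c. poly F (pconst c) \<in> W"
  shows "coeff F k \<in> W"
proof (cases "k < Suc (degree F)")
  case True
  have "(\<Sum>k<Suc (degree F). pconst (c ^ k) * coeff F k) \<in> W" for c
    using F[of c] by (simp add: poly_altdef pconst.hom_power mult.commute lessThan_Suc_atMost)
  from lin_closed_extract_seq[OF W this True] show ?thesis .
next
  case False
  then show ?thesis using lin_closedD(1)[OF W] by (simp add: coeff_eq_0)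
qed

lemma gscale_add_left: "gscale (a + b) f = gscale a f + gscale b f"
  by (simp add: gscale_eq single_add pconst.hom_add algebra_simps)

text \<open>Columns hold the images of the generators and matrix indices start at 0, so c sits in
  row j - 1 and column i - 1. The inverse is the transvection with -c.\<close>

lemma GL_action_transv:
  fixes c :: "'k::field"
  assumes ij: "i \<in> {1..d}" "j \<in> {1..d}" "i \<noteq> j"
  shows "GL_action d (addrow_mat d c (j - 1) (i - 1)) (gsubst (transv i j c))"
proof -
  have u: "transv i j c k \<in> acarrier (Galg d)" if "k \<in> {1..d}" for c :: 'k and k
    using that ij by (auto simp: transv_def intro!: carrier_add carrier_scale carrier_x_gen)
  have inv: "gsubst (transv i j c) (gsubst (transv i j (- c)) f) = f" if "f \<in> acarrier (Galg d)" for c :: 'k and f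
  proof -
    have "gscale c (x_gen j) + gscale (- c) (x_gen j) = (0 :: 'k gelem)"
      using gscale_add_left[of c "- c" "x_gen j"] by (simp add: gscale_eq zero_prod_def)
    then have tr: "gsubst (transv i j c) (transv i j (- c) k) = x_gen k" for k
      using ij(3) by (auto simp: transv_def gsubst_add gsubst_scale add.assoc)
    have "f \<in> {f. gsubst (transv i j c) (gsubst (transv i j (- c)) f) = f}"
      by (rule Galg_generated[OF _ _ _ _ _ that]) (auto simp: tr gsubst_add gsubst_scale gsubst_mult)
    then show ?thesis by simp
  qed
  have G: "gsubst (transv i j c) f \<in> acarrier (Galg d)" if "f \<in> acarrier (Galg d)" for c :: 'k and f
    using gsubst_carrier[of d "transv i j c" f] u that by blast
  have "bij_betw (gsubst (transv i j c)) (acarrier (Galg d)) (acarrier (Galg d))"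
    using inv[of _ c] inv[of _ "- c"] G by (intro bij_betw_byWitness[of _ "gsubst (transv i j (- c))"]) auto
  then have "alg_auto (Galg d) (gsubst (transv i j c))"
    unfolding alg_auto_def using alg_endo_gsubst[of d "transv i j c"] u by blast
  moreover have "invertible_mat (addrow_mat d c (j - 1) (i - 1))"
  proof -
    have l: "j - 1 < d" "i - 1 < d" "j - 1 \<noteq> i - 1" using ij by auto
    show ?thesis
      unfolding invertible_mat_def inverts_mat_def
      using addrow_mat_inv[OF l, of c] addrow_mat_inv[OF l, of "- c"]
      by (auto intro!: exI[of _ "addrow_mat d (- c) (j - 1) (i - 1)"])
  qed
  moreover have "transv i j c k = (\<Sum>l = 1..d. gscale (addrow_mat d c (j - 1) (i - 1) $$ (l - 1, k - 1)) (x_gen l))"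
    if "k \<in> {1..d}" for k
  proof -
    have z: "gscale 0 f = 0" "gscale 1 f = f" for f :: "'k gelem"
      by (cases f; simp add: gscale_eq zero_prod_def)+
    have "(\<Sum>l = 1..d. gscale (addrow_mat d c (j - 1) (i - 1) $$ (l - 1, k - 1)) (x_gen l))
      = (\<Sum>l = 1..d. (if l = j then gscale (if k = i then c else 0) (x_gen j) else 0)
          + (if l = k then x_gen k else 0))"
      using that ij by (intro sum.cong) (auto simp: gscale_add_left z)
    also have "\<dots> = gscale (if k = i then c else 0) (x_gen j) + x_gen k"
      using that ij by (simp add: sum.distrib)
    finally show ?thesis by (auto simp: transv_def z)
  qed
  ultimately show ?thesis unfolding GL_action_def by simp
qed

section \<open>Closure of GL-stable subspaces under derivations\<close>

definition pol :: "'k::comm_ring_1 gelem set \<Rightarrow> 'k yzpoly set" where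
  "pol W = {p. of_yz p \<in> W}"

lemma lin_closed_pol: "alg_subspace (Galg d) W \<Longrightarrow> lin_closed (pol W)"
  unfolding alg_subspace_def lin_closed_def pol_def by (simp flip: of_yz_simps)

lemma polar_closed:
  fixes W :: "'k::field_char_0 gelem set"
  assumes W: "GL_space d W" and "p \<in> pol W" "i \<in> {1..d}" "j \<in> {1..d}" "i \<noteq> j"
  shows "polar i j p \<in> pol W"
  unfolding polar_def
proof (rule lin_closed_extract)
  show "lin_closed (pol W)" using W lin_closed_pol unfolding GL_space_def by blast
  fix c
  have "gsubst (transv i j c) ` W \<subseteq> W"
    using W GL_action_transv[OF assms(3-5), of c] unfolding GL_space_def by blast
  then have "gsubst (transv i j c) (of_yz p) \<in> W" using assms(2) unfolding pol_def by blast
  then show "poly (texp i j p) (pconst c) \<in> pol W" by (simp add: poly_texp pol_def)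
qed

section \<open>Monomials modulo the relations \<open>y\<^sub>i z\<^sub>j = y\<^sub>j z\<^sub>i\<close>\<close>

text \<open>The relations are tied to one degree n because they have different sources: the T-ideal
  supplies them from degree 4 on, in degrees 2 and 3 a submodule gets them from its listed vectors.
  The cofactor may be pure in y or in z.\<close>

definition swap_rel :: "nat \<Rightarrow> nat \<Rightarrow> 'k::comm_ring_1 yzpoly set \<Rightarrow> bool" where
  "swap_rel d n W \<longleftrightarrow> (\<forall>as bs i j. set as \<subseteq> {1..d} \<longrightarrow> set bs \<subseteq> {1..d} \<longrightarrow> i \<in> {1..d} \<longrightarrow> j \<in> {1..d} \<longrightarrow>
     length as + length bs + 2 = n \<longrightarrow> Ymon as * Zmon bs * D2 i j \<in> W)"

text \<open>\<open>as\<close> collects the y-letters already matched. The first letter i of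
  \<open>is\<close> is cancelled if it is also a y-letter of the second monomial; otherwise it is
  one of its z-letters, and a single relation \<open>D2 i' i\<close> exchanges it with the first
  y-letter i'.\<close>

lemma YZ_swap_aux:
  assumes W: "lin_closed W" "swap_rel d n W"
  shows "length is = length is' \<Longrightarrow> mset (is @ js) = mset (is' @ js') \<Longrightarrow>
    set (is @ js) \<subseteq> {1..d} \<Longrightarrow> set as \<subseteq> {1..d} \<Longrightarrow>
    length as + length is + length js = n \<Longrightarrow>
    Ymon as * (Ymon is * Zmon js - Ymon is' * Zmon js') \<in> W"
proof (induction "is" arbitrary: is' js js' as)
  case Nil
  then show ?case using lin_closedD(1)[OF W(1)] by (simp add: Zmon_mset[of js js'])
next
  case (Cons i is1)
  have set': "set (is' @ js') \<subseteq> {1..d}" using Cons.prems(2,3) by (metis set_mset_mset)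
  show ?case
  proof (cases "i \<in> set is'")
    case True
    then have "mset is' = add_mset i (mset (remove1 i is'))" by simp
    then obtain is2 where m: "mset is' = add_mset i (mset is2)" by blast
    have y: "Ymon is' = y_var i * Ymon is2"
      using Ymon_mset[of is' "i # is2"] m by simp
    have "Suc (length is1) = length is'" using Cons.prems(1) by simp
    also have "\<dots> = Suc (length is2)" using arg_cong[OF m, of size] by simp
    finally have "Ymon (i # as) * (Ymon is1 * Zmon js - Ymon is2 * Zmon js') \<in> W"
      using Cons.prems(2-) by (intro Cons.IH) (auto simp: m)
    then show ?thesis by (simp add: y algebra_simps)
  next
    case False
    have "i \<in> set (is' @ js')" using Cons.prems(2) by (metis append_Cons list.set_intros(1) set_mset_mset)
    then have i: "i \<in> set js'" using False by simp
    obtain i' is1' where is': "is' = i' # is1'" using Cons.prems(1) by (cases is') auto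
    from i have "mset js' = add_mset i (mset (remove1 i js'))" by simp
    then obtain js2 where mj: "mset js' = add_mset i (mset js2)" by blast
    have z: "Zmon js' = z_var i * Zmon js2"
      using Zmon_mset[of js' "i # js2"] mj by simp
    have ms: "mset (is1 @ js) = mset (is1' @ i' # js2)"
      using Cons.prems(2) by (simp add: is' mj)
    have 1: "Ymon (i # as) * (Ymon is1 * Zmon js - Ymon is1' * Zmon (i' # js2)) \<in> W"
      using Cons.prems ms by (intro Cons.IH) (auto simp: is')
    have len: "length is1 + length js = length is1' + Suc (length js2)"
      using arg_cong[OF ms, of size] by simp
    have sub: "set js2 \<subseteq> {1..d}" using set' arg_cong[OF mj, of set_mset] by auto
    have 2: "Ymon (as @ is1') * Zmon js2 * D2 i' i \<in> W"
      using W(2) Cons.prems(3,4,5) set' sub len i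
      unfolding swap_rel_def by (auto simp del: Ymon_simps simp: is')
    have eq: "Ymon as * (Ymon (i # is1) * Zmon js - Ymon is' * Zmon js')
      = Ymon (i # as) * (Ymon is1 * Zmon js - Ymon is1' * Zmon (i' # js2)) - Ymon (as @ is1') * Zmon js2 * D2 i' i"
      by (simp add: is' z algebra_simps)
    show ?thesis unfolding eq by (rule lin_closedD(5)[OF W(1) 1 2])
  qed
qed

text \<open>A normal form: modulo the swap relations only the y-degree a and the multiset of
  \<open>ls\<close> matter, so relations between y-degrees can be stated with one common
  list.\<close>

definition YZ :: "nat \<Rightarrow> nat list \<Rightarrow> 'k::comm_ring_1 yzpoly" where
  "YZ a ls = Ymon (take a ls) * Zmon (drop a ls)"

lemma YZ_cong:
  assumes W: "lin_closed W" "swap_rel d n W"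
    and "mset (is @ js) = mset ls" "length ls = n" "length is = a" "set ls \<subseteq> {1..d}"
  shows "Ymon is * Zmon js - YZ a ls \<in> W"
proof -
  have "length is + length js = n" using arg_cong[OF assms(3), of size] assms(4) by simp
  moreover have "set (is @ js) = set ls" using assms(3) by (metis set_mset_mset)
  ultimately show ?thesis
    using YZ_swap_aux[OF W, of "is" "take a ls" js "drop a ls" "[]"] assms by (simp add: YZ_def)
qed

text \<open>Modulo the swap relations, polarizing \<open>x\<^sub>1 \<mapsto> x\<^sub>j\<close> replaces one of the \<open>m + 1\<close> indices
  \<open>1\<close> by \<open>j\<close>, at whatever position, and hence multiplies by \<open>m + 1\<close>.\<close>

lemma polar_YZ:
  assumes W: "lin_closed W" "swap_rel d n W"
    and ks: "set ks \<subseteq> {2..d}" and n: "length ks + Suc m = n" and a: "a \<le> n" and j: "j \<in> {2..d}"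
  shows "polar 1 j (YZ a (replicate (Suc m) 1 @ ks))
    - pconst (of_nat (Suc m)) * YZ a (replicate m 1 @ j # ks) \<in> W"
proof -
  \<comment> \<open>Of the m + 1 leading ones, p are y-letters and q are z-letters. The derivation
    produces p copies of \<open>?A\<close> and q copies of \<open>?B\<close>, all congruent to
    \<open>?T\<close>.\<close>
  define p where "p = min a (Suc m)"
  define q where "q = Suc m - p"
  define is0 js0 where "is0 = take (a - Suc m) ks" and "js0 = drop (a - Suc m) ks"
  have ks': "ks = is0 @ js0" by (simp add: is0_def js0_def)
  have la: "p + length is0 = a" using a n by (auto simp: p_def is0_def)
  have pq: "p + q = Suc m" by (simp add: p_def q_def)
  have "take a (replicate (Suc m) (1::nat) @ ks) = replicate p 1 @ is0"
    "drop a (replicate (Suc m) (1::nat) @ ks) = replicate q 1 @ js0"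
    unfolding take_append drop_append take_replicate drop_replicate is0_def js0_def p_def q_def
    by (auto simp: min_def)
  then have YZ1: "YZ a (replicate (Suc m) 1 @ ks) = y_var 1 ^ p * Ymon is0 * (z_var 1 ^ q * Zmon js0)"
    by (simp only: YZ_def Ymon_simps Zmon_simps Ymon_replicate Zmon_replicate)
  have n1: "1 \<notin> set is0" "1 \<notin> set js0" using ks by (auto simp: ks')
  let ?T = "YZ a (replicate m 1 @ j # ks) :: 'a yzpoly"
  let ?A = "Ymon (replicate (p - 1) 1 @ j # is0) * Zmon (replicate q 1 @ js0) :: 'a yzpoly"
  let ?B = "Ymon (replicate p 1 @ is0) * Zmon (replicate (q - 1) 1 @ j # js0) :: 'a yzpoly"
  have ls: "length (replicate m 1 @ j # ks) = n" "set (replicate m 1 @ j # ks) \<subseteq> {1..d}"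
    using n ks j by (auto split: if_splits)
  have A: "?A - ?T \<in> W" if "p > 0"
  proof (rule YZ_cong[OF W _ ls(1) _ ls(2)])
    show "mset ((replicate (p - 1) 1 @ j # is0) @ replicate q 1 @ js0) = mset (replicate m 1 @ j # ks)"
      using pq that by (intro multiset_eqI) (auto simp: ks')
  qed (use la that in auto)
  have B: "?B - ?T \<in> W" if "q > 0"
  proof (rule YZ_cong[OF W _ ls(1) _ ls(2)])
    show "mset ((replicate p 1 @ is0) @ replicate (q - 1) 1 @ j # js0) = mset (replicate m 1 @ j # ks)"
      using pq that by (intro multiset_eqI) (auto simp: ks')
  qed (use la that in auto)
  \<comment> \<open>For p = 0 the truncated p - 1 makes \<open>?A\<close> one letter too long, but
    its coefficient is 0; likewise for q.\<close>
  have A': "pconst (of_nat p) * (?A - ?T) \<in> W"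
    using A lin_closedD(1,3)[OF W(1)] by (cases "p = 0") auto
  have B': "pconst (of_nat q) * (?B - ?T) \<in> W"
    using B lin_closedD(1,3)[OF W(1)] by (cases "q = 0") auto
  have pc: "of_nat k = (pconst (of_nat k) :: 'a yzpoly)" for k by (simp add: pconst_def)
  have "polar 1 j (YZ a (replicate (Suc m) 1 @ ks)) = pconst (of_nat p) * ?A + pconst (of_nat q) * ?B"
    unfolding YZ1 by (simp add: polar_mult polar_power polar_Ymon polar_Zmon n1 pc algebra_simps del: One_nat_def)
  moreover have "pconst (of_nat (Suc m)) = pconst (of_nat p) + (pconst (of_nat q) :: 'a yzpoly)"
    unfolding pq[symmetric] by (simp add: pconst.hom_add)
  ultimately have "polar 1 j (YZ a (replicate (Suc m) 1 @ ks)) - pconst (of_nat (Suc m)) * ?T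
     = pconst (of_nat p) * (?A - ?T) + pconst (of_nat q) * (?B - ?T)"
    by (simp only: algebra_simps)
  then show ?thesis using lin_closedD(2)[OF W(1) A' B'] by simp
qed

text \<open>The factor m + 1 of \<open>polar_YZ\<close> is the same for every y-degree a, so a whole
  combination over a survives the replacement of ones by other letters, one at a time; the factor is
  invertible in characteristic 0.\<close>

lemma polarize:
  fixes W :: "'k::field_char_0 yzpoly set"
  assumes W: "lin_closed W" "swap_rel d n W"
    and pol: "\<And>p j. p \<in> W \<Longrightarrow> j \<in> {2..d} \<Longrightarrow> polar 1 j p \<in> W"
    and A: "A \<subseteq> {..n}"
    and start: "(\<Sum>a\<in>A. pconst (\<gamma> a) * YZ a (replicate n 1)) \<in> W"
    and ls: "length ls = n" "set ls \<subseteq> {1..d}"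
  shows "(\<Sum>a\<in>A. pconst (\<gamma> a) * YZ a ls) \<in> W"
proof -
  let ?F = "\<lambda>ls. \<Sum>a\<in>A. pconst (\<gamma> a) * YZ a ls :: 'k yzpoly"
  have *: "?F (replicate (n - length ks) 1 @ ks) \<in> W" if "set ks \<subseteq> {2..d}" "length ks \<le> n" for ks
    using that
  proof (induction ks)
    case Nil
    then show ?case using start by simp
  next
    case (Cons j ks)
    define m where "m = n - Suc (length ks)"
    have m: "n - length ks = Suc m" "n - length (j # ks) = m" "length ks + Suc m = n"
      using Cons.prems by (auto simp: m_def)
    have F: "?F (replicate (Suc m) 1 @ ks) \<in> W" using Cons m by simp
    have "(\<Sum>a\<in>A. pconst (\<gamma> a) * (polar 1 j (YZ a (replicate (Suc m) 1 @ ks))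
        - pconst (of_nat (Suc m)) * YZ a (replicate m 1 @ j # ks))) \<in> W"
      using Cons.prems A m
      by (intro lin_closed_sum[OF W(1)] lin_closedD(3)[OF W(1)] polar_YZ[OF W]) auto
    also have "(\<Sum>a\<in>A. pconst (\<gamma> a) * (polar 1 j (YZ a (replicate (Suc m) 1 @ ks))
        - pconst (of_nat (Suc m)) * YZ a (replicate m 1 @ j # ks)))
      = polar 1 j (?F (replicate (Suc m) 1 @ ks)) - pconst (of_nat (Suc m)) * ?F (replicate m 1 @ j # ks)"
      unfolding polar_sum polar_pconst_mult sum_distrib_left sum_subtractf[symmetric]
      by (intro sum.cong refl) (simp only: algebra_simps)
    finally have D: "polar 1 j (?F (replicate (Suc m) 1 @ ks)) - pconst (of_nat (Suc m)) * ?F (replicate m 1 @ j # ks) \<in> W" .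
    have P: "polar 1 j (?F (replicate (Suc m) 1 @ ks)) \<in> W" using pol[OF F] Cons.prems by simp
    have "pconst (of_nat (Suc m)) * ?F (replicate m 1 @ j # ks) \<in> W"
      using lin_closedD(5)[OF W(1) P D] by (simp only: diff_diff_eq2 add_diff_cancel_left')
    then have "?F (replicate m 1 @ j # ks) \<in> W"
      by (rule lin_closed_cancel[OF W(1) _ of_nat_neq_0])
    then show ?case using m by simp
  qed
  \<comment> \<open>The ones of \<open>ls\<close> may be moved to the front, since this does not
    change the multiset.\<close>
  define ks where "ks = filter (\<lambda>i. i \<noteq> 1) ls"
  have ks: "set ks \<subseteq> {2..d}" "length ks \<le> n" using ls by (auto simp: ks_def)
  have ms: "mset ls = replicate_mset (count (mset ls) 1) 1 + mset ks"
    by (rule multiset_eqI) (auto simp: ks_def)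
  have "n = count (mset ls) 1 + length ks" using arg_cong[OF ms, of size] ls(1) by simp
  then have ms': "mset (replicate (n - length ks) 1 @ ks) = mset ls" using ms by simp
  have "(\<Sum>a\<in>A. pconst (\<gamma> a) * (YZ a (replicate (n - length ks) 1 @ ks) - YZ a ls)) \<in> W"
  proof (intro lin_closed_sum[OF W(1)] lin_closedD(3)[OF W(1)])
    fix a assume "a \<in> A"
    then have "a \<le> n" using A by auto
    then show "YZ a (replicate (n - length ks) 1 @ ks) - YZ a ls \<in> W"
      using ms' ks(2) unfolding YZ_def[of a "_ @ _"]
      by (intro YZ_cong[OF W _ ls(1) _ ls(2)]) (simp_all only: append_take_drop_id, simp)
  qed
  then have "?F (replicate (n - length ks) 1 @ ks) - ?F ls \<in> W"
    by (simp add: sum_subtractf right_diff_distrib)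
  from lin_closedD(5)[OF W(1) *[OF ks] this] show ?thesis by simp
qed

lemma polarize_one:
  fixes W :: "'k::field_char_0 yzpoly set"
  assumes W: "lin_closed W" "swap_rel d n W"
    and pol: "\<And>p j. p \<in> W \<Longrightarrow> j \<in> {2..d} \<Longrightarrow> polar 1 j p \<in> W"
    and "a \<le> n" "YZ a (replicate n 1) \<in> W" "length ls = n" "set ls \<subseteq> {1..d}"
  shows "YZ a ls \<in> W"
  using polarize[OF W pol, of "{a}" "\<lambda>_. 1" ls] assms(4-) by simp

lemma polarize_diff:
  fixes W :: "'k::field_char_0 yzpoly set"
  assumes W: "lin_closed W" "swap_rel d n W"
    and pol: "\<And>p j. p \<in> W \<Longrightarrow> j \<in> {2..d} \<Longrightarrow> polar 1 j p \<in> W"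
    and "a \<le> n" "b \<le> n" "a \<noteq> b" "YZ a (replicate n 1) - YZ b (replicate n 1) \<in> W" "length ls = n" "set ls \<subseteq> {1..d}"
  shows "YZ a ls - YZ b ls \<in> W"
  using polarize[OF W pol, of "{a, b}" "\<lambda>x. if x = a then 1 else -1" ls] assms(4-)
  by (simp add: pconst.hom_uminus)

lemma YZ_length: "Ymon is * Zmon js = YZ (length is) (is @ js)"
  by (simp add: YZ_def)

lemma hmonos_subset:
  assumes "lin_closed W" "\<And>a ls. 1 \<le> a \<Longrightarrow> a < n \<Longrightarrow> length ls = n \<Longrightarrow> set ls \<subseteq> {1..d} \<Longrightarrow> YZ a ls \<in> W"
  shows "psupp (hmonos d n) \<subseteq> W"
proof
  fix p :: "'a yzpoly" assume p: "p \<in> psupp (hmonos d n)"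
  from assms(1) p show "p \<in> W"
  proof (rule psupp_span[where d = d])
    fix "is" js assume *: "mexp is js \<in> hmonos d n" "set is \<subseteq> {1..d}" "set js \<subseteq> {1..d}"
    then have "is \<noteq> []" "js \<noteq> []" "length is + length js = n" by (simp_all add: hmonos_mexp)
    then show "Ymon is * Zmon js \<in> W" unfolding YZ_length using *
      by (intro assms(2)) (auto simp: Suc_le_eq)
  qed (auto simp: hmonos_def ymonos_def)
qed

section \<open>Identifying \<open>y\<^sub>i\<close> with \<open>z\<^sub>i\<close>\<close>

definition tau :: "'k::comm_ring_1 yzpoly \<Rightarrow> 'k yzpoly" where
  "tau = subst (case_var y_var y_var)"

interpretation tau: comm_ring_hom tau
  unfolding tau_def by (rule subst.comm_ring_hom_axioms)

lemma tau_vars [simp]: "tau (pconst c) = pconst c" "tau (y_var i) = y_var i" "tau (z_var i) = y_var i"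
  by (simp_all add: tau_def)

lemma tau_YZ: "tau (Ymon is * Zmon js) = Ymon (is @ js)"
proof -
  have "tau (Ymon is) = Ymon is" "tau (Zmon is) = Ymon is" for "is"
    by (induction "is") (simp_all add: tau.hom_mult)
  note * = this
  show ?thesis by (simp add: tau.hom_mult *)
qed

text \<open>Choosing one preimage for each monomial in the image of \<open>tau\<close> gives a linear section
  \<open>\<Psi>\<close>, and \<open>p - \<Psi> (tau p)\<close> is a combination of differences of monomials with equal image.\<close>

lemma tau_kernel:
  assumes W: "lin_closed W" "swap_rel d n W"
    and H: "\<And>a ls. 1 \<le> a \<Longrightarrow> a < n \<Longrightarrow> length ls = n \<Longrightarrow> set ls \<subseteq> {1..d} \<Longrightarrow> YZ a ls - YZ 1 ls \<in> W"
    and p: "p \<in> psupp (hmonos d n)" "tau p = 0"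
  shows "p \<in> W"
proof -
  define R where "R t m \<longleftrightarrow> (\<exists>is js. m = mexp is js \<and> set is \<subseteq> {1..d} \<and> set js \<subseteq> {1..d} \<and> is \<noteq> [] \<and> js \<noteq> []
      \<and> length is + length js = n \<and> t = mexp (is @ js) [])" for t m
  \<comment> \<open>The choice is meaningful only for t with a preimage, and only such t occur in
    the image of the degree n part.\<close>
  define \<Psi> :: "'a yzpoly \<Rightarrow> 'a yzpoly" where "\<Psi> = lext pconst (\<lambda>t. Poly_Mapping.single (SOME m. R t m) 1)"
  have \<Psi>_scale: "\<Psi> (pconst c * q) = pconst c * \<Psi> q" for c q
    unfolding \<Psi>_def
  proof (induction q rule: poly_mapping_add_induct)
    case (single m a)
    have "pconst c * Poly_Mapping.single m a = Poly_Mapping.single m (c * a)"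
      by (simp add: pconst_def mult_single)
    then show ?case by (simp add: pconst.hom_mult mult_ac)
  qed (simp_all add: pconst.lext_add distrib_left)
  have "lin_closed {p. p - \<Psi> (tau p) \<in> W}"
    unfolding lin_closed_def
  proof (intro conjI ballI allI; clarify)
    show "0 - \<Psi> (tau 0) \<in> W" using lin_closedD(1)[OF W(1)] by (simp add: \<Psi>_def)
  next
    fix q r assume "q - \<Psi> (tau q) \<in> W" "r - \<Psi> (tau r) \<in> W"
    then have "(q - \<Psi> (tau q)) + (r - \<Psi> (tau r)) \<in> W" by (rule lin_closedD(2)[OF W(1)])
    then show "q + r - \<Psi> (tau (q + r)) \<in> W"
      by (simp add: tau.hom_add \<Psi>_def pconst.lext_add algebra_simps)
  next
    fix c q assume "q - \<Psi> (tau q) \<in> W"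
    then have "pconst c * (q - \<Psi> (tau q)) \<in> W" by (rule lin_closedD(3)[OF W(1)])
    then show "pconst c * q - \<Psi> (tau (pconst c * q)) \<in> W"
      by (simp add: tau.hom_mult \<Psi>_scale right_diff_distrib)
  qed
  from this p(1) have "p \<in> {p. p - \<Psi> (tau p) \<in> W}"
  proof (rule psupp_span[where d = d])
    fix "is" js assume *: "mexp is js \<in> hmonos d n" "set is \<subseteq> {1..d}" "set js \<subseteq> {1..d}"
    then have **: "is \<noteq> []" "js \<noteq> []" "length is + length js = n" by (simp_all add: hmonos_mexp)
    let ?t = "mexp (is @ js) []"
    have "R ?t (mexp is js)" unfolding R_def using * ** by blast
    then have "R ?t (SOME m. R ?t m)" by (rule someI)
    then obtain is' js' where r: "(SOME m. R ?t m) = mexp is' js'" "set is' \<subseteq> {1..d}" "set js' \<subseteq> {1..d}"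
      "is' \<noteq> []" "js' \<noteq> []" "length is' + length js' = n" "?t = mexp (is' @ js') []"
      unfolding R_def by blast
    have ms: "mset (is @ js) = mset (is' @ js')"
      using r(7) lookup_mexp(1) by (metis multiset_eqI)
    have ts: "tau (Ymon is * Zmon js) = Poly_Mapping.single ?t 1"
      unfolding tau_YZ single_mexp by simp
    have \<Psi>: "\<Psi> (tau (Ymon is * Zmon js)) = Ymon is' * Zmon js'"
      unfolding ts \<Psi>_def pconst.lext_single r(1) by (simp add: single_mexp)
    let ?l = "is @ js" and ?l' = "is' @ js'"
    have l: "length ?l = n" "set ?l \<subseteq> {1..d}" "length ?l' = n" "set ?l' \<subseteq> {1..d}"
      using * ** r by auto
    have len: "1 \<le> length is" "length is < n" "1 \<le> length is'" "length is' < n"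
      using ** r(4-6) by (cases "is"; cases js; cases is'; cases js'; simp)+
    \<comment> \<open>Two monomials over the same t may differ in y-degree; \<open>H\<close> brings
      both to y-degree 1, where equal multisets suffice.\<close>
    have 1: "Ymon is * Zmon js - YZ 1 ?l \<in> W" "Ymon is' * Zmon js' - YZ 1 ?l' \<in> W"
      unfolding YZ_length by (rule H[OF len(1,2) l(1,2)], rule H[OF len(3,4) l(3,4)])
    have 2: "YZ 1 ?l - YZ 1 ?l' \<in> W"
      unfolding YZ_def[of 1 ?l] using ms len(1)
      by (intro YZ_cong[OF W _ l(3) _ l(4)]) (simp_all only: append_take_drop_id, simp)
    have "Ymon is * Zmon js - Ymon is' * Zmon js' \<in> W"
      using lin_closedD(5)[OF W(1) lin_closedD(2)[OF W(1) 1(1) 2] 1(2)] by simp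
    then show "Ymon is * Zmon js \<in> {p. p - \<Psi> (tau p) \<in> W}" by (simp add: \<Psi>)
  qed (auto simp: hmonos_def ymonos_def)
  then show ?thesis using p(2) by (simp add: \<Psi>_def)
qed

lemma tau_lact: "tau (lact f) = tau (ract f)"
proof -
  have "tau (ylin v) = tau (zlin v)" for v :: "nat \<Rightarrow>\<^sub>0 'a"
    by (induction v rule: poly_mapping_add_induct)
      (simp_all add: ylin_eq zlin_eq pconst.lext_add tau.hom_add tau.hom_mult)
  then show ?thesis by (simp add: lact_def ract_def tau.hom_add)
qed

text \<open>\<open>tau\<close> erases the difference between \<open>lact\<close> and
  \<open>ract\<close>, so a substitution turns into one with equal images for y_i and z_i. This is
  why endomorphisms preserve \<open>tau_ideal\<close>.\<close>

lemma tau_subst_usub: "tau (subst (usub u) p) = subst (usub (\<lambda>i. of_yz (tau (lact (u i))))) (tau p)"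
  by (rule hom_ext[OF comm_ring_hom_comp[OF tau.comm_ring_hom_axioms subst.comm_ring_hom_axioms]
        comm_ring_hom_comp[OF subst.comm_ring_hom_axioms tau.comm_ring_hom_axioms]])
    (simp_all add: tau_lact)

text \<open>The uniqueness side of freeness: closure of a T-ideal under endomorphisms can be tested
  on substitutions.\<close>

lemma endo_eq_gsubst:
  assumes "alg_endo (Galg d) \<phi>" "f \<in> acarrier (Galg d)"
  shows "\<phi> f = gsubst (\<lambda>i. \<phi> (x_gen i)) f"
proof -
  have e: "\<phi> (a + b) = \<phi> a + \<phi> b" "\<phi> (gmult a b) = gmult (\<phi> a) (\<phi> b)"
    if "a \<in> acarrier (Galg d)" "b \<in> acarrier (Galg d)" for a b using assms(1) that unfolding alg_endo_def by auto
  have s: "\<phi> (gscale c a) = gscale c (\<phi> a)" if "a \<in> acarrier (Galg d)" for a c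
    using assms(1) that unfolding alg_endo_def by auto
  have "f \<in> {f. \<phi> f = gsubst (\<lambda>i. \<phi> (x_gen i)) f}"
    by (rule Galg_generated[OF _ _ _ _ _ assms(2)])
      (auto simp: gsubst_add gsubst_scale gsubst_mult e s alg_endo_zero[OF assms(1)])
  then show ?thesis by simp
qed

text \<open>This is the square of the algebra.\<close>

definition yz_ideal :: "nat \<Rightarrow> 'k::comm_ring_1 gelem set" where
  "yz_ideal d = of_yz ` mixed d"

definition tau_ideal :: "nat \<Rightarrow> 'k::comm_ring_1 gelem set" where
  "tau_ideal d = of_yz ` {p \<in> mixed d. tau p = 0}"

lemma T_ideal_yz_ideals: "T_ideal (Galg d) (yz_ideal d :: 'a::comm_ring_1 gelem set)"
  "T_ideal (Galg d) (tau_ideal d :: 'a gelem set)"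
proof -
  have m: "p \<in> mixed d \<Longrightarrow> q \<in> mixed d \<Longrightarrow> p + q \<in> mixed d" "p \<in> mixed d \<Longrightarrow> pconst c * p \<in> mixed d" "0 \<in> mixed d"
    for p q :: "'a yzpoly" and c by (simp_all add: mixed_def psupp_add psupp_pconst_mult)
  have a: "a \<in> acarrier (Galg d) \<Longrightarrow> p \<in> mixed d \<Longrightarrow> lact a * p \<in> mixed d \<and> p * ract a \<in> mixed d" for a and p :: "'a yzpoly"
    using carrier_mult[of a d "of_yz p"] carrier_mult[of "of_yz p" d a] by (simp add: gmult_eq)
  have e: "\<phi> (of_yz p) = of_yz (subst (usub (\<lambda>i. \<phi> (x_gen i))) p)" "subst (usub (\<lambda>i. \<phi> (x_gen i))) p \<in> mixed d"
    if "alg_endo (Galg d) \<phi>" "p \<in> mixed d" for \<phi> and p :: "'a yzpoly"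
  proof -
    show *: "\<phi> (of_yz p) = of_yz (subst (usub (\<lambda>i. \<phi> (x_gen i))) p)"
      using endo_eq_gsubst[OF that(1), of "of_yz p"] that(2) by simp
    have "\<phi> (of_yz p) \<in> acarrier (Galg d)" using that by (simp add: alg_endo_def)
    then show "subst (usub (\<lambda>i. \<phi> (x_gen i))) p \<in> mixed d" unfolding * by simp
  qed
  have z: "0 \<in> of_yz ` S" if "0 \<in> S" for S :: "'a yzpoly set" using that by (metis image_eqI of_yz_zero)
  show "T_ideal (Galg d) (yz_ideal d :: 'a gelem set)"
    unfolding T_ideal_def alg_ideal_def alg_subspace_def yz_ideal_def
    using a by (auto simp: m e of_yz_simps gmult_eq intro!: imageI z)
  show "T_ideal (Galg d) (tau_ideal d :: 'a gelem set)"
    unfolding T_ideal_def alg_ideal_def alg_subspace_def tau_ideal_def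
    using a by (auto simp: m e of_yz_simps gmult_eq tau.hom_add tau.hom_mult tau_subst_usub intro!: imageI z)
qed

text \<open>Setting y_i = z_i kills y_1 z_2 - y_2 z_1.\<close>

lemma V_subset_tau_ideal:
  assumes "d \<ge> 2"
  shows "V_ideal d \<beta>1 \<beta>2 \<subseteq> tau_ideal d"
proof -
  have "of_yz ((pconst \<beta>1 * y_var 1 + pconst \<beta>2 * z_var 1) * D2 1 2) \<in> tau_ideal d"
    unfolding tau_ideal_def using V_gen_carrier[OF assms, of \<beta>1 \<beta>2]
    by (auto simp: tau.hom_mult tau.hom_minus mult_ac intro!: imageI)
  then show ?thesis unfolding V_ideal_def T_ideal_gen_def using T_ideal_yz_ideals(2) by blast
qed

section \<open>The T-ideal of the variety\<close>

lemma lin_closed_pol_ideal: "T_ideal (Galg d) I \<Longrightarrow> lin_closed (pol I)"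
  using lin_closed_pol T_idealD(1) unfolding alg_ideal_def by blast

lemma pol_ideal_mult:
  assumes "T_ideal (Galg d) I" "p \<in> pol I" "i \<in> {1..d}"
  shows "y_var i * p \<in> pol I" "z_var i * p \<in> pol I"
  using alg_idealD(7,8)[OF T_idealD(1)[OF assms(1)] carrier_x_gen[OF assms(3)], of "of_yz p"] assms(2)
  by (simp_all add: pol_def gmult_eq mult.commute)

lemma pol_ideal_YZ_mult:
  assumes "T_ideal (Galg d) I" "p \<in> pol I" "set is \<subseteq> {1..d}" "set js \<subseteq> {1..d}"
  shows "Ymon is * Zmon js * p \<in> pol I"
proof -
  have z: "Zmon js * p \<in> pol I"
    using assms(4) by (induction js) (use assms(1,2) in \<open>auto simp: mult.assoc intro!: pol_ideal_mult\<close>)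
  have "Ymon is * (Zmon js * p) \<in> pol I"
    using assms(3) by (induction "is") (use assms(1) z in \<open>auto simp: mult.assoc intro!: pol_ideal_mult\<close>)
  then show ?thesis by (simp add: mult.assoc)
qed

lemma pol_ideal_subst:
  assumes "T_ideal (Galg d) I" "p \<in> pol I" "\<And>i. i \<in> {1..d} \<Longrightarrow> u i \<in> acarrier (Galg d)"
  shows "subst (usub u) p \<in> pol I"
  using T_idealD(2)[OF assms(1) alg_endo_gsubst[of d u], of "of_yz p"] assms(2,3) by (simp add: pol_def)

locale gv_eq =
  fixes d :: nat and \<beta> :: "'k::field_char_0"
  assumes d_ge: "d \<ge> 2" and \<beta>0: "\<beta> \<noteq> 0"
begin

sublocale gv d \<beta> \<beta>
  by unfold_locales (rule d_ge)

lemma one_two: "1 \<in> {1..d}" "2 \<in> {1..d}"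
  using d_ge by auto

lemmas pV = lin_closed_pol_ideal[OF T]
lemmas pVD = lin_closedD[OF pV]

text \<open>The polynomial of a(bc - cb) + (bc - cb)a: the defining identity with the common scalar
  divided out, where the x outside the commutator and the x inside it may differ.\<close>

definition tri :: "'k gelem \<Rightarrow> 'k gelem \<Rightarrow> 'k gelem \<Rightarrow> 'k yzpoly" where
  "tri a b c = (lact a + ract a) * (lact b * ract c - lact c * ract b)"

lemma tri_diag:
  assumes "u \<in> G" "w \<in> G"
  shows "tri u u w \<in> pol V"
proof -
  have "(pconst \<beta> * y_var 1 + pconst \<beta> * z_var 1) * D2 1 2 \<in> pol V"
    unfolding pol_def V_ideal_def T_ideal_gen_def by auto
  then have "subst (usub (\<lambda>i. if i = 1 then u else w))
      ((pconst \<beta> * y_var 1 + pconst \<beta> * z_var 1) * D2 1 2) \<in> pol V"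
    by (rule pol_ideal_subst[OF T]) (use assms in auto)
  also have "subst (usub (\<lambda>i. if i = 1 then u else w))
      ((pconst \<beta> * y_var 1 + pconst \<beta> * z_var 1) * D2 1 2) = pconst \<beta> * tri u u w"
    by (simp add: subst.hom_mult subst.hom_add subst.hom_minus tri_def algebra_simps)
  finally show ?thesis using lin_closed_cancel[OF pV] \<beta>0 by blast
qed

text \<open>Polarizing \<open>tri u u w\<close> makes \<open>tri\<close> alternating modulo the T-ideal, while the cyclic sum
  of \<open>tri\<close> vanishes identically; hence \<open>3 tri a b c\<close> lies in the T-ideal.\<close>

lemma tri_V:
  assumes "a \<in> G" "b \<in> G" "c \<in> G"
  shows "tri a b c \<in> pol V"
proof -
  have alt: "tri u v w + tri v u w \<in> pol V" if "u \<in> G" "v \<in> G" "w \<in> G" for u v w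
  proof -
    have "tri (u + v) (u + v) w - tri u u w - tri v v w \<in> pol V"
      by (intro pVD(5) tri_diag carrier_add that)
    moreover have "tri (u + v) (u + v) w - tri u u w - tri v v w = tri u v w + tri v u w"
      by (simp add: tri_def algebra_simps)
    ultimately show ?thesis by simp
  qed
  \<comment> \<open>As \<open>tri\<close> is skew in its last two arguments, the vanishing cyclic
    sum turns \<open>tri b a c - tri c a b\<close> into \<open>tri a b c\<close>; the remaining
    \<open>tri a b c - tri a c b\<close> is twice that.\<close>
  have "(tri a b c + tri b a c) - (tri a c b + tri c a b) \<in> pol V"
    by (intro pVD(5) alt assms)
  moreover have "(tri a b c + tri b a c) - (tri a c b + tri c a b) = pconst 3 * tri a b c"
    by (simp add: tri_def pconst_def algebra_simps)
  ultimately show ?thesis using lin_closed_cancel[OF pV, of 3] by simp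
qed

section \<open>Relations from generators and elements of the square in the three slots\<close>

lemma lin_tri_V:
  assumes "i \<in> {1..d}" "j \<in> {1..d}" "k \<in> {1..d}"
  shows "(y_var i + z_var i) * D2 j k \<in> pol V"
  using tri_V[OF carrier_x_gen carrier_x_gen carrier_x_gen, OF assms] by (simp add: tri_def)

text \<open>In the first slot \<open>of_yz p\<close> acts as p from both sides and contributes the
  factor 2p.\<close>

lemma mixed_D2_V:
  assumes "p \<in> mixed d" "j \<in> {1..d}" "k \<in> {1..d}"
  shows "p * D2 j k \<in> pol V"
proof -
  have "pconst 2 * (p * D2 j k) \<in> pol V"
    using tri_V[OF _ carrier_x_gen carrier_x_gen, OF _ assms(2,3), of "of_yz p"] assms(1)
    by (simp add: tri_def pconst_def algebra_simps)
  then show ?thesis using lin_closed_cancel[OF pV, of 2] by simp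
qed

text \<open>In the last slot p factors out of the commutator with x_j and leaves y_j - z_j.\<close>

lemma lin_diff_V:
  assumes "i \<in> {1..d}" "j \<in> {1..d}" "p \<in> mixed d"
  shows "(y_var i + z_var i) * (p * (y_var j - z_var j)) \<in> pol V"
  using tri_V[OF carrier_x_gen carrier_x_gen, OF assms(1,2), of "of_yz p"] assms(3)
  by (simp add: tri_def algebra_simps)

lemma mixed_diff_V:
  assumes "p \<in> mixed d" "q \<in> mixed d" "j \<in> {1..d}"
  shows "p * q * (y_var j - z_var j) \<in> pol V"
proof -
  have "pconst 2 * (p * q * (y_var j - z_var j)) \<in> pol V"
    using tri_V[OF _ carrier_x_gen, OF _ assms(3), of "of_yz p" "of_yz q"] assms(1,2)
    by (simp add: tri_def pconst_def algebra_simps)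
  then show ?thesis using lin_closed_cancel[OF pV, of 2] by simp
qed

text \<open>A cofactor with both a y and a z is covered by \<open>mixed_D2_V\<close>. A pure
  cofactor has at least two letters here, and the relation for y_a + z_a flips one of them, which
  makes it mixed.\<close>

lemma swap_rel_V:
  assumes "n \<ge> 4"
  shows "swap_rel d n (pol V)"
  unfolding swap_rel_def
proof (intro allI impI)
  fix as bs i j
  assume *: "set as \<subseteq> {1..d}" "set bs \<subseteq> {1..d}" "i \<in> {1..d}" "j \<in> {1..d}" "length as + length bs + 2 = n"
  have mix: "Ymon as * Zmon bs * D2 i j \<in> pol V" if "as \<noteq> []" "bs \<noteq> []" "set as \<subseteq> {1..d}" "set bs \<subseteq> {1..d}" for as bs
    using that * by (intro mixed_D2_V YZ_mixed) auto
  show "Ymon as * Zmon bs * D2 i j \<in> pol V"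
  proof (cases "as = []")
    case True
    then obtain a b bs' where bs: "bs = a # b # bs'" using *(5) assms
      by (cases bs; cases "tl bs") auto
    have "z_var b * ((y_var a + z_var a) * D2 i j) - Ymon [a] * Zmon [b] * D2 i j \<in> pol V"
      using * by (intro pVD(5) pol_ideal_mult[OF T] lin_tri_V mix) (auto simp: bs)
    then have "Ymon [] * Zmon bs' * (z_var b * ((y_var a + z_var a) * D2 i j) - Ymon [a] * Zmon [b] * D2 i j) \<in> pol V"
      using * by (intro pol_ideal_YZ_mult[OF T]) (auto simp: bs)
    then show ?thesis by (simp add: True bs algebra_simps)
  next
    case False
    show ?thesis
    proof (cases "bs = []")
      case True
      then obtain a b as' where as: "as = a # b # as'" using *(5) assms
        by (cases as; cases "tl as") auto
      have "y_var b * ((y_var a + z_var a) * D2 i j) - Ymon [b] * Zmon [a] * D2 i j \<in> pol V"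
        using * by (intro pVD(5) pol_ideal_mult[OF T] lin_tri_V mix) (auto simp: as)
      then have "Ymon as' * Zmon [] * (y_var b * ((y_var a + z_var a) * D2 i j) - Ymon [b] * Zmon [a] * D2 i j) \<in> pol V"
        using * by (intro pol_ideal_YZ_mult[OF T]) (auto simp: as)
      then show ?thesis by (simp add: True as algebra_simps)
    qed (use False mix * in blast)
  qed
qed

text \<open>A cofactor with two y and two z splits into two mixed monomials, so
  \<open>mixed_diff_V\<close> applies. With a single y there are at least three z, and
  \<open>lin_diff_V\<close> flips one of them into a y; likewise with a single z.\<close>

lemma YZ_diff_V:
  assumes "set is \<subseteq> {1..d}" "set js \<subseteq> {1..d}" "k \<in> {1..d}" "is \<noteq> []" "js \<noteq> []" "length is + length js \<ge> 4"
  shows "Ymon is * Zmon js * (y_var k - z_var k) \<in> pol V"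
proof -
  have two: "Ymon (i # is) * Zmon (j # js) * (y_var k - z_var k) \<in> pol V"
    if "is \<noteq> []" "js \<noteq> []" "set (i # is) \<subseteq> {1..d}" "set (j # js) \<subseteq> {1..d}" for i j "is" js
  proof -
    have "(Ymon [i] * Zmon [j]) * (Ymon is * Zmon js) * (y_var k - z_var k) \<in> pol V"
      using that assms(3) by (intro mixed_diff_V YZ_mixed) auto
    then show ?thesis by (simp add: algebra_simps)
  qed
  obtain i is' j js' where c: "is = i # is'" "js = j # js'" using assms(4,5) by (meson list.exhaust)
  consider "is' \<noteq> []" "js' \<noteq> []" | "is' = []" | "js' = []" by blast
  then show ?thesis
  proof cases
    case 1
    then show ?thesis using two assms(1,2) c by blast
  next
    case 2
    then obtain j1 js1 where js': "js' = j1 # js1" "js1 \<noteq> []" using assms(6) c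
      by (cases js'; cases "tl js'") auto
    have "(y_var j + z_var j) * (Ymon [i] * Zmon js' * (y_var k - z_var k))
        - Ymon (j # [i]) * Zmon (j1 # js1) * (y_var k - z_var k) \<in> pol V"
      using assms(1-3) c js' by (intro pVD(5) lin_diff_V YZ_mixed two) auto
    then show ?thesis by (simp add: c 2 js' algebra_simps)
  next
    case 3
    then obtain i1 is1 where is': "is' = i1 # is1" "is1 \<noteq> []" using assms(6) c
      by (cases is'; cases "tl is'") auto
    have "(y_var i + z_var i) * (Ymon is' * Zmon [j] * (y_var k - z_var k))
        - Ymon (i1 # is1) * Zmon (i # [j]) * (y_var k - z_var k) \<in> pol V"
      using assms(1-3) c is' by (intro pVD(5) lin_diff_V YZ_mixed two) auto
    then show ?thesis by (simp add: c 3 is' algebra_simps)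
  qed
qed

text \<open>Moving the boundary between y- and z-letters past one letter k changes the monomial by
  y_k - z_k times a mixed monomial of degree n - 1, which is at least 4.\<close>

lemma YZ_1_V:
  assumes "n \<ge> 5" "1 \<le> a" "a < n" "length ls = n" "set ls \<subseteq> {1..d}"
  shows "YZ a ls - YZ 1 ls \<in> pol V"
  using assms(2,3)
proof (induction a rule: dec_induct)
  case base
  then show ?case using pVD(1) by simp
next
  case (step a)
  have a: "a < length ls" using step assms(4) by simp
  have "Ymon (take a ls) * Zmon (drop (Suc a) ls) * (y_var (ls ! a) - z_var (ls ! a)) \<in> pol V"
  proof (rule YZ_diff_V)
    show "ls ! a \<in> {1..d}" using nth_mem[OF a] assms(5) by blast
  qed (use assms step a in \<open>auto dest!: in_set_takeD in_set_dropD\<close>)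
  moreover have eq: "YZ (Suc a) ls - YZ 1 ls = (YZ a ls - YZ 1 ls)
      + Ymon (take a ls) * Zmon (drop (Suc a) ls) * (y_var (ls ! a) - z_var (ls ! a))"
    using a by (simp add: YZ_def take_Suc_conv_app_nth Cons_nth_drop_Suc[OF a, symmetric] algebra_simps)
  ultimately show ?case unfolding eq using step by (intro pVD(2)) auto
qed

text \<open>(y_i + z_i)(y_j - z_j) equals y_i y_j - z_i z_j minus \<open>D2 i j\<close>: the mixed
  terms form a swap relation, so no monomial of y-degree 2 remains.\<close>

lemma YZ_3_1_V:
  assumes "length ls = 4" "set ls \<subseteq> {1..d}"
  shows "YZ 3 ls - YZ 1 ls \<in> pol V"
proof -
  obtain i j k l where ls: "ls = [i, j, k, l]"
    using assms(1) by (auto simp: numeral_eq_Suc length_Suc_conv)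
  have "(y_var i + z_var i) * (Ymon [k] * Zmon [l] * (y_var j - z_var j))
      + Ymon [k] * Zmon [l] * D2 i j + (Ymon [k] * Zmon [i, j, l] - YZ 1 ls) \<in> pol V"
    using assms
    by (intro pVD(2) lin_diff_V mixed_D2_V YZ_mixed YZ_cong[OF pV swap_rel_V]) (auto simp: ls)
  then show ?thesis by (simp add: ls YZ_def algebra_simps numeral_3_eq_3)
qed

end

section \<open>Submodules generated by the highest weight vectors\<close>

lemma YZ_replicate: "a \<le> n \<Longrightarrow> YZ a (replicate n 1) = y_var 1 ^ a * z_var 1 ^ (n - a)"
  by (simp add: YZ_def min_def)

locale gv_space = gv_eq +
  fixes W :: "'a gelem set"
  assumes GLW: "GL_space d W" and VW: "V \<subseteq> W"
begin

lemma pW: "lin_closed (pol W)"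
  using GLW lin_closed_pol unfolding GL_space_def by blast

lemmas pWD = lin_closedD[OF pW]

lemma pVW: "p \<in> pol V \<Longrightarrow> p \<in> pol W"
  using VW by (auto simp: pol_def)

lemmas polarW = polar_closed[OF GLW]

lemma polar1: "p \<in> pol W \<Longrightarrow> j \<in> {2..d} \<Longrightarrow> polar 1 j p \<in> pol W"
  using polarW[of p 1 j] by auto

lemma swap_rel_W: "n \<ge> 4 \<Longrightarrow> swap_rel d n (pol W)"
  using swap_rel_V pVW unfolding swap_rel_def by blast

text \<open>The derivations x_2 to x_j and then x_1 to x_i carry \<open>D2 1 2\<close> to
  \<open>D2 i j\<close>; a second index 1 is handled by skew symmetry.\<close>

lemma swap_rel_2:
  assumes "D2 1 2 \<in> pol W"
  shows "swap_rel d 2 (pol W)"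
proof -
  have 1: "D2 1 j \<in> pol W" if "j \<in> {1..d}" for j
  proof -
    consider "j = 1" | "j = 2" | "j \<noteq> 1" "j \<noteq> 2" by blast
    then show ?thesis
    proof cases
      case 3
      then show ?thesis using polarW[OF assms one_two(2) that] by (simp add: polar_mult)
    qed (use assms pWD(1) in auto)
  qed
  have "D2 i j \<in> pol W" if "i \<in> {1..d}" "j \<in> {1..d}" for i j
  proof -
    consider "i = 1" | "j = 1" | "i \<noteq> 1" "j \<noteq> 1" by blast
    then show ?thesis
    proof cases
      case 2
      then show ?thesis using pWD(4)[OF 1[OF that(1)]] by simp
    next
      case 3
      then show ?thesis using polarW[OF 1[OF that(2)] one_two(1) that(1)] by (simp add: polar_mult)
    qed (use 1 that in auto)
  qed
  then show ?thesis unfolding swap_rel_def by simp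
qed

text \<open>The cyclic sum of the products y_k \<open>D2 i j\<close> vanishes, so the diagonal ones
  y_i \<open>D2 i j\<close>, reached by derivations, yield all of them by linearization and division
  by 3. For z_k in place of y_k the relation for y_k + z_k in V is subtracted.\<close>

lemma swap_rel_3:
  assumes "y_var 1 * D2 1 2 \<in> pol W"
  shows "swap_rel d 3 (pol W)"
proof -
  have 1: "y_var 1 * D2 1 j \<in> pol W" if "j \<in> {1..d}" for j
  proof -
    consider "j = 1" | "j = 2" | "j \<noteq> 1" "j \<noteq> 2" by blast
    then show ?thesis
    proof cases
      case 3
      then show ?thesis using polarW[OF assms one_two(2) that] by (simp add: polar_mult)
    qed (use assms pWD(1) in auto)
  qed
  have E: "y_var i * D2 i j \<in> pol W" if "i \<in> {1..d}" "j \<in> {1..d}" for i j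
  proof -
    consider "i = 1" | "i \<noteq> 1" "j = 1" | "i = j" | "i \<noteq> 1" "j \<noteq> 1" "i \<noteq> j" by blast
    then show ?thesis
    proof cases
      case 2
      \<comment> \<open>Since j = 1 must not be moved, the start is y_1 \<open>D2 1 i\<close>; where
        the derivation hits the inner 1 it gives \<open>D2 i i\<close>, which is 0.\<close>
      then have "polar 1 i (y_var 1 * D2 1 i) \<in> pol W"
        using polarW[OF 1[OF that(1)] one_two(1) that(1)] by simp
      also have "polar 1 i (y_var 1 * D2 1 i) = - (y_var i * D2 i j)"
        using 2 by (simp add: polar_mult algebra_simps)
      finally show ?thesis using pWD(4)[of "- (y_var i * D2 i j)"] by simp
    next
      case 4
      \<comment> \<open>The factor 2 counts the orders in which the two ones are replaced.\<close>
      then have "polar 1 i (polar 1 i (y_var 1 * D2 1 j)) \<in> pol W"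
        using polarW[OF _ one_two(1) that(1)] 1[OF that(2)] by metis
      also have "polar 1 i (polar 1 i (y_var 1 * D2 1 j)) = pconst 2 * (y_var i * D2 i j)"
        using 4 by (simp add: polar_mult pconst_def algebra_simps)
      finally show ?thesis using lin_closed_cancel[OF pW, of 2] by simp
    qed (use 1 that pWD(1) in auto)
  qed
  have alt: "y_var k * D2 i j + y_var i * D2 k j \<in> pol W"
    if "i \<in> {1..d}" "j \<in> {1..d}" "k \<in> {1..d}" "i \<noteq> j" "k \<noteq> i" for i j k
  proof -
    have "polar i k (y_var i * D2 i j) \<in> pol W" using that by (intro polarW E) auto
    also have "polar i k (y_var i * D2 i j) = y_var k * D2 i j + y_var i * D2 k j"
      using that by (simp add: polar_mult)
    finally show ?thesis .
  qed
  have y: "y_var k * D2 i j \<in> pol W" if "i \<in> {1..d}" "j \<in> {1..d}" "k \<in> {1..d}" for i j k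
  proof -
    consider "i = j" | "k = i" | "k = j" | "i \<noteq> j" "k \<noteq> i" "k \<noteq> j" by blast
    then show ?thesis
    proof cases
      case 3
      then show ?thesis using pWD(4)[OF E[OF that(2,1)]] by (simp add: algebra_simps)
    next
      case 4
      \<comment> \<open>Two instances of \<open>alt\<close> with i and j exchanged; by the vanishing
        cyclic sum their difference is three times the wanted product.\<close>
      then have "(y_var k * D2 i j + y_var i * D2 k j) - (y_var k * D2 j i + y_var j * D2 k i) \<in> pol W"
        using that by (intro pWD(5) alt) auto
      also have "(y_var k * D2 i j + y_var i * D2 k j) - (y_var k * D2 j i + y_var j * D2 k i)
        = pconst 3 * (y_var k * D2 i j)" by (simp add: pconst_def algebra_simps)
      finally show ?thesis using lin_closed_cancel[OF pW, of 3] by simp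
    qed (use E that pWD(1) in auto)
  qed
  have z: "z_var k * D2 i j \<in> pol W" if "i \<in> {1..d}" "j \<in> {1..d}" "k \<in> {1..d}" for i j k
    using pWD(5)[OF pVW[OF lin_tri_V[OF that(3,1,2)]] y[OF that]] by (simp add: algebra_simps)
  show ?thesis
    unfolding swap_rel_def
  proof (intro allI impI)
    fix as bs i j
    assume *: "set as \<subseteq> {1..d}" "set bs \<subseteq> {1..d}" "i \<in> {1..d}" "j \<in> {1..d}" "length as + length bs + 2 = 3"
    then have "(\<exists>a. as = [a] \<and> bs = []) \<or> (\<exists>b. as = [] \<and> bs = [b])"
      by (cases as; cases bs) auto
    then show "Ymon as * Zmon bs * D2 i j \<in> pol W" using * y[of i j] z[of i j] by auto
  qed
qed

section \<open>Homogeneous components inside a GL-stable subspace\<close>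

lemma polarize_one_W:
  assumes "swap_rel d n (pol W)" "YZ a (replicate n 1) \<in> pol W" "a \<le> n" "length ls = n" "set ls \<subseteq> {1..d}"
  shows "YZ a ls \<in> pol W"
  by (rule polarize_one[OF pW assms(1) _ assms(3,2,4,5)]) (rule polar1)

lemma polarize_diff_W:
  assumes "swap_rel d n (pol W)" "YZ a (replicate n 1) - YZ b (replicate n 1) \<in> pol W"
    "a \<le> n" "b \<le> n" "a \<noteq> b" "length ls = n" "set ls \<subseteq> {1..d}"
  shows "YZ a ls - YZ b ls \<in> pol W"
  by (rule polarize_diff[OF pW assms(1) _ assms(3-5,2,6,7)]) (rule polar1)

lemma hom_subset_W:
  assumes "n \<ge> 2" "\<And>a ls. 1 \<le> a \<Longrightarrow> a < n \<Longrightarrow> length ls = n \<Longrightarrow> set ls \<subseteq> {1..d} \<Longrightarrow> YZ a ls \<in> pol W"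
  shows "G_hom d n \<subseteq> W"
proof
  fix f :: "'a gelem" assume "f \<in> G_hom d n"
  then obtain p where "f = of_yz p" "p \<in> psupp (hmonos d n)" using G_homE[OF _ assms(1)] by blast
  then show "f \<in> W" using hmonos_subset[OF pW, of n d] assms(2) by (auto simp: pol_def)
qed

lemma tau_hom_subset_W:
  assumes "swap_rel d n (pol W)" "\<And>a ls. 1 \<le> a \<Longrightarrow> a < n \<Longrightarrow> length ls = n \<Longrightarrow> set ls \<subseteq> {1..d} \<Longrightarrow> YZ a ls - YZ 1 ls \<in> pol W"
  shows "tau_ideal d \<inter> G_hom d n \<subseteq> W"
proof
  fix f :: "'a gelem" assume f: "f \<in> tau_ideal d \<inter> G_hom d n"
  then obtain p where p: "f = of_yz p" "tau p = 0" by (auto simp: tau_ideal_def)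
  then have h: "p \<in> psupp (hmonos d n)" using f by (simp add: G_hom_of_yz)
  have "p \<in> pol W"
    by (rule tau_kernel[OF pW assms(1) _ h p(2)]) (rule assms(2))
  then show "f \<in> W" unfolding p(1) pol_def by simp
qed

lemma hom2_subset:
  assumes "y_var 1 * z_var 1 \<in> pol W" "D2 1 2 \<in> pol W"
  shows "G_hom d 2 \<subseteq> W"
proof (rule hom_subset_W)
  fix a :: nat and ls assume *: "1 \<le> a" "a < 2" "length ls = 2" "set ls \<subseteq> {1..d}"
  then have "a = 1" by simp
  have "YZ 1 (replicate 2 1) \<in> pol W" by (subst YZ_replicate) (use assms(1) in auto)
  with swap_rel_2[OF assms(2)] show "YZ a ls \<in> pol W" unfolding \<open>a = 1\<close>
    by (rule polarize_one_W) (use * in auto)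
qed simp

lemma hom3_subset:
  assumes "y_var 1 ^ 2 * z_var 1 \<in> pol W" "y_var 1 * z_var 1 ^ 2 \<in> pol W" "y_var 1 * D2 1 2 \<in> pol W"
  shows "G_hom d 3 \<subseteq> W"
proof (rule hom_subset_W)
  fix a :: nat and ls assume *: "1 \<le> a" "a < 3" "length ls = 3" "set ls \<subseteq> {1..d}"
  then have "a = 1 \<or> a = 2" by auto
  then have "YZ a (replicate 3 1) \<in> pol W" by (subst YZ_replicate) (use assms(1,2) in auto)
  with swap_rel_3[OF assms(3)] show "YZ a ls \<in> pol W"
    by (rule polarize_one_W) (use * in auto)
qed simp

lemma tau_hom3_subset:
  assumes "y_var 1 ^ 2 * z_var 1 - y_var 1 * z_var 1 ^ 2 \<in> pol W" "y_var 1 * D2 1 2 \<in> pol W"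
  shows "tau_ideal d \<inter> G_hom d 3 \<subseteq> W"
proof (rule tau_hom_subset_W[OF swap_rel_3[OF assms(2)]])
  fix a :: nat and ls assume *: "1 \<le> a" "a < 3" "length ls = 3" "set ls \<subseteq> {1..d}"
  have "YZ 2 (replicate 3 1) - YZ 1 (replicate 3 1) \<in> pol W"
    by (subst YZ_replicate, simp, subst YZ_replicate, simp) (use assms in simp)
  with swap_rel_3[OF assms(2)] have "YZ 2 ls - YZ 1 ls \<in> pol W"
    by (rule polarize_diff_W) (use * in auto)
  moreover have "a = 1 \<or> a = 2" using * by auto
  ultimately show "YZ a ls - YZ 1 ls \<in> pol W" using pWD(1) by auto
qed

text \<open>Only y-degrees 2 and 3 are polarized; y-degree 1 agrees with 3 modulo V.\<close>

lemma hom4_subset: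
  assumes "y_var 1 ^ 3 * z_var 1 \<in> pol W" "y_var 1 ^ 2 * z_var 1 ^ 2 \<in> pol W"
  shows "G_hom d 4 \<subseteq> W"
proof (rule hom_subset_W)
  fix a :: nat and ls assume *: "1 \<le> a" "a < 4" "length ls = 4" "set ls \<subseteq> {1..d}"
  have 23: "YZ a ls \<in> pol W" if "a = 2 \<or> a = 3" for a
  proof (rule polarize_one_W[OF swap_rel_W])
    show "YZ a (replicate 4 1) \<in> pol W" by (subst YZ_replicate) (use that assms in auto)
  qed (use that * in auto)
  have "YZ 1 ls \<in> pol W" using pWD(5)[OF 23[of 3] pVW[OF YZ_3_1_V[OF *(3,4)]]] by simp
  moreover have "a = 1 \<or> a = 2 \<or> a = 3" using * by auto
  ultimately show "YZ a ls \<in> pol W" using 23 by auto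
qed simp

lemma tau_hom4_subset:
  assumes "y_var 1 ^ 3 * z_var 1 - y_var 1 ^ 2 * z_var 1 ^ 2 \<in> pol W"
  shows "tau_ideal d \<inter> G_hom d 4 \<subseteq> W"
proof (rule tau_hom_subset_W)
  fix a :: nat and ls assume *: "1 \<le> a" "a < 4" "length ls = 4" "set ls \<subseteq> {1..d}"
  have "YZ 3 (replicate 4 1) - YZ 2 (replicate 4 1) \<in> pol W"
    by (subst YZ_replicate, simp, subst YZ_replicate, simp) (use assms in simp)
  with swap_rel_W have 32: "YZ 3 ls - YZ 2 ls \<in> pol W"
    by (rule polarize_diff_W) (use * in auto)
  note 31 = pVW[OF YZ_3_1_V[OF *(3,4)]]
  have "YZ 2 ls - YZ 1 ls \<in> pol W" using pWD(5)[OF 31 32] by simp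
  moreover have "a = 1 \<or> a = 2 \<or> a = 3" using * by auto
  ultimately show "YZ a ls - YZ 1 ls \<in> pol W" using pWD(1) 31 by auto
qed (simp add: swap_rel_W)

text \<open>All y-degrees agree modulo V in these degrees, so V alone accounts for the kernel of
  \<open>tau\<close>.\<close>

lemma tau_hom_large_subset:
  assumes "n \<ge> 5"
  shows "tau_ideal d \<inter> G_hom d n \<subseteq> W"
  by (rule tau_hom_subset_W[OF swap_rel_W]) (use assms in \<open>auto intro!: pVW YZ_1_V simp del: One_nat_def\<close>)

lemma hom_large_subset:
  assumes "n \<ge> 5" "y_var 1 ^ (n - 1) * z_var 1 \<in> pol W"
  shows "G_hom d n \<subseteq> W"
proof (rule hom_subset_W)
  fix a :: nat and ls assume *: "1 \<le> a" "a < n" "length ls = n" "set ls \<subseteq> {1..d}"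
  have "YZ (n - 1) (replicate n 1) \<in> pol W" by (subst YZ_replicate) (use assms in auto)
  with swap_rel_W have 1: "YZ (n - 1) ls \<in> pol W"
    by (rule polarize_one_W) (use assms * in auto)
  have "YZ (n - 1) ls - YZ 1 ls \<in> pol W" "YZ a ls - YZ 1 ls \<in> pol W"
    using assms * by (auto intro!: pVW YZ_1_V simp del: One_nat_def)
  from pWD(2)[OF pWD(5)[OF 1 this(1)] this(2)] show "YZ a ls \<in> pol W" by simp
qed (use assms in simp)

end

section \<open>Consequences of the highest weight vectors\<close>

lemma G_hom_diff: "f \<in> G_hom d n \<Longrightarrow> g \<in> G_hom d n \<Longrightarrow> f - g \<in> G_hom d n"
  using G_hom_add[of f d n "gscale (-1) g"] G_hom_scale[of g d n "-1"] by (simp add: gscale_minus_one)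

lemma w_row_G_hom:
  assumes "d \<ge> 1" "1 \<le> j" "j < n"
  shows "w_row n j \<in> G_hom d n"
proof -
  have eq: "y_var 1 ^ j * z_var 1 ^ (n - j) = Poly_Mapping.single (mexp (replicate j 1) (replicate (n - j) 1)) 1"
    by (simp add: single_mexp del: One_nat_def)
  have "mexp (replicate j 1) (replicate (n - j) 1) \<in> hmonos d n"
    using assms by (subst hmonos_mexp) auto
  then show ?thesis unfolding w_row_def G_hom_of_yz eq by (simp add: psupp_def)
qed

lemma w_two_eq:
  "w_two 1 1 0 = of_yz (D2 1 2)" "w_two 2 1 1 = of_yz (y_var 1 * D2 1 2)"
  by (simp_all add: w_two_def)

lemma w_two_G_hom:
  assumes "d \<ge> 2"
  shows "(w_two 1 1 0 :: 'k::comm_ring_1 gelem) \<in> G_hom d 2" "(w_two 2 1 1 :: 'k gelem) \<in> G_hom d 3"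
proof -
  have x: "(x_gen i :: 'k gelem) \<in> G_hom d 1" if "i \<in> {1..d}" for i
    unfolding G_hom_iff using carrier_x_gen[OF that] by (simp add: x_gen_def)
  have "gmult (x_gen 1) (x_gen 2) - gmult (x_gen 2) (x_gen 1) \<in> (G_hom d (1 + 1) :: 'k gelem set)"
    using assms by (intro G_hom_diff G_hom_mult x) auto
  then show *: "(w_two 1 1 0 :: 'k gelem) \<in> G_hom d 2"
    unfolding w_two_eq by (simp add: gmult_eq of_yz_simps numeral_2_eq_2)
  have "gmult (x_gen 1) (w_two 1 1 0) \<in> (G_hom d (1 + 2) :: 'k gelem set)"
    using assms by (intro G_hom_mult x *) auto
  then show "(w_two 2 1 1 :: 'k gelem) \<in> G_hom d 3"
    unfolding w_two_eq by (simp add: gmult_eq del: One_nat_def)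
qed

lemma pconst_numeral [simp]: "pconst (numeral k) = numeral k"
  by (simp add: pconst_def)

context gv_eq
begin

lemma w_row_hom: "1 \<le> j \<Longrightarrow> j < n \<Longrightarrow> w_row n j \<in> G_hom d n"
  using w_row_G_hom[of d j n] d_ge by simp

lemma hom_G: "f \<in> G_hom d n \<Longrightarrow> f \<in> G"
  by (simp add: G_hom_iff)

lemma tau_ideal_iff: "of_yz p \<in> tau_ideal d \<longleftrightarrow> of_yz p \<in> G \<and> tau p = 0"
  by (auto simp: tau_ideal_def)

lemma yz_ideal_iff: "of_yz p \<in> yz_ideal d \<longleftrightarrow> of_yz p \<in> G"
  by (auto simp: yz_ideal_def)

lemma V_tau: "V \<subseteq> tau_ideal d" and V_yz: "V \<subseteq> yz_ideal d"
  using V_subset_tau_ideal[OF d_ge, of \<beta> \<beta>] by (auto simp: tau_ideal_def yz_ideal_def)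

lemmas T_tau = T_ideal_yz_ideals(2)[of d] and T_yz = T_ideal_yz_ideals(1)[of d]

lemma space: "GL_space d W \<Longrightarrow> V \<subseteq> W \<Longrightarrow> gv_space d \<beta> W"
  by unfold_locales

lemma consequences_i: "consequences_equiv d \<beta> \<beta> 1 (x_gen 1) {w_row 2 1, w_two 1 1 0}"
proof (rule consequences_equivI[OF _ _ _ _ T_ideal_carrier])
  show "x_gen 1 \<in> G" by (rule carrier_x_gen[OF one_two(1)])
  then show "x_gen 1 \<in> G" .
  show "{w_row 2 1, w_two 1 1 0} \<subseteq> G_hom d (1 + 1)"
    using w_row_hom[of 1 2] w_two_G_hom(1)[OF d_ge] by (simp del: One_nat_def)
next
  fix I :: "'k gelem set" assume I: "T_ideal (Galg d) I" "x_gen 1 \<in> I"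
  note ID = alg_idealD[OF T_idealD(1)[OF I(1)]]
  have x: "x_gen 1 \<in> G" "x_gen 2 \<in> G" by (rule carrier_x_gen[OF one_two(1)], rule carrier_x_gen[OF one_two(2)])
  have "gmult (x_gen 1) (x_gen 1) \<in> I" "gmult (x_gen 1) (x_gen 2) - gmult (x_gen 2) (x_gen 1) \<in> I"
    by (rule ID(7)[OF x(1) I(2)], rule ID(6)[OF ID(8)[OF x(2) I(2)] ID(7)[OF x(2) I(2)]])
  then show "{w_row 2 1, w_two 1 1 0} \<subseteq> I"
    unfolding w_row_def w_two_eq by (simp add: gmult_eq of_yz_simps)
next
  fix W assume W: "GL_space d W" "V \<subseteq> W" "{w_row 2 1, w_two 1 1 0} \<subseteq> W"
  interpret gv_space d \<beta> W by (rule space[OF W(1,2)])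
  have "G_hom d 2 \<subseteq> W"
    using hom2_subset W(3) unfolding w_two_eq w_row_def by (simp add: pol_def)
  then show "G \<inter> G_hom d (1 + 1) \<subseteq> W" by (simp add: le_infI2 del: One_nat_def)
qed (use idealD(1) in auto)

lemma consequences_ii: "consequences_equiv d \<beta> \<beta> 2 (w_row 2 1) {w_row 3 2, w_row 3 1, w_two 2 1 1}"
proof (rule consequences_equivI[OF _ _ _ _ T_yz V_yz])
  show f: "w_row 2 1 \<in> G" by (rule hom_G[OF w_row_hom]) auto
  then show "w_row 2 1 \<in> yz_ideal d" by (simp add: w_row_def yz_ideal_iff)
  show "{w_row 3 2, w_row 3 1, w_two 2 1 1} \<subseteq> G_hom d (2 + 1)"
    using w_row_hom[of 1 3] w_row_hom[of 2 3] w_two_G_hom(2)[OF d_ge] by (simp del: One_nat_def)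
next
  fix I :: "'k gelem set" assume I: "T_ideal (Galg d) I" "w_row 2 1 \<in> I"
  note PD = lin_closedD[OF lin_closed_pol_ideal[OF I(1)]]
  have p: "y_var 1 * z_var 1 \<in> pol I" using I(2) by (simp add: w_row_def pol_def)
  have "subst (usub (\<lambda>i. if i = 1 then x_gen 1 + x_gen 2 else x_gen i)) (y_var 1 * z_var 1) \<in> pol I"
    by (rule pol_ideal_subst[OF I(1) p]) (use one_two in \<open>auto intro!: carrier_add carrier_x_gen\<close>)
  then have p12: "(y_var 1 + y_var 2) * (z_var 1 + z_var 2) \<in> pol I" by (simp add: subst.hom_mult)
  have "subst (usub (\<lambda>i. x_gen 2)) (y_var 1 * z_var 1) \<in> pol I"
    by (rule pol_ideal_subst[OF I(1) p]) (use one_two in \<open>auto intro!: carrier_x_gen\<close>)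
  then have p22: "y_var 2 * z_var 2 \<in> pol I" by (simp add: subst.hom_mult)
  note y = pol_ideal_mult(1)[OF I(1)] and z = pol_ideal_mult(2)[OF I(1)]
  have a: "y_var 1 * (y_var 1 * z_var 1) \<in> pol I" "z_var 1 * (y_var 1 * z_var 1) \<in> pol I"
    using y[OF p one_two(1)] z[OF p one_two(1)] .
  \<comment> \<open>The linearization of y_1 z_1 is y_1 z_2 + y_2 z_1; multiplied by y_1 it differs
    from y_1 \<open>D2 1 2\<close> by 2 y_1 y_2 z_1, a multiple of y_1 z_1.\<close>
  have "y_var 1 * ((y_var 1 + y_var 2) * (z_var 1 + z_var 2) - y_var 1 * z_var 1 - y_var 2 * z_var 2)
      - pconst 2 * (y_var 2 * (y_var 1 * z_var 1)) \<in> pol I"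
    by (intro PD(3,5) y p p12 p22 one_two)
  also have "y_var 1 * ((y_var 1 + y_var 2) * (z_var 1 + z_var 2) - y_var 1 * z_var 1 - y_var 2 * z_var 2)
      - pconst 2 * (y_var 2 * (y_var 1 * z_var 1)) = y_var 1 * D2 1 2"
    by (simp add: algebra_simps)
  finally show "{w_row 3 2, w_row 3 1, w_two 2 1 1} \<subseteq> I"
    using a unfolding w_two_eq w_row_def by (simp add: pol_def power2_eq_square mult_ac)
next
  fix W assume W: "GL_space d W" "V \<subseteq> W" "{w_row 3 2, w_row 3 1, w_two 2 1 1} \<subseteq> W"
  interpret gv_space d \<beta> W by (rule space[OF W(1,2)])
  show "yz_ideal d \<inter> G_hom d (2 + 1) \<subseteq> W"
    using hom3_subset W(3) unfolding w_two_eq w_row_def by (simp add: pol_def le_infI2)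
qed auto

lemma consequences_iii: "consequences_equiv d \<beta> \<beta> 2 (w_two 1 1 0) {w_row 3 2 - w_row 3 1, w_two 2 1 1}"
proof (rule consequences_equivI[OF _ _ _ _ T_tau V_tau])
  show f: "w_two 1 1 0 \<in> G" by (rule hom_G[OF w_two_G_hom(1)[OF d_ge]])
  then show "w_two 1 1 0 \<in> tau_ideal d" unfolding w_two_eq
    by (simp add: tau_ideal_iff tau.hom_minus tau.hom_mult)
  show "{w_row 3 2 - w_row 3 1, w_two 2 1 1} \<subseteq> G_hom d (2 + 1)"
    by (simp add: G_hom_diff w_row_hom w_two_G_hom d_ge del: One_nat_def)
next
  fix I :: "'k gelem set" assume I: "T_ideal (Galg d) I" "w_two 1 1 0 \<in> I"
  have p: "D2 1 2 \<in> pol I" using I(2) by (simp add: w_two_eq pol_def del: One_nat_def)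
  have yz: "y_var 1 * z_var 1 \<in> mixed d"
    using YZ_mixed[of "[1]" d "[1]"] one_two by simp
  \<comment> \<open>Substituting x_1 x_1 for x_2, which acts as y_1 z_1 from both sides, turns the
    commutator into y_1 z_1 (y_1 - z_1).\<close>
  have "subst (usub (\<lambda>i. if i = 1 then x_gen 1 else of_yz (y_var 1 * z_var 1))) (D2 1 2) \<in> pol I"
    by (rule pol_ideal_subst[OF I(1) p]) (use one_two carrier_x_gen yz in auto)
  then have "y_var 1 * (y_var 1 * z_var 1) - y_var 1 * z_var 1 * z_var 1 \<in> pol I"
    by (simp add: subst.hom_mult subst.hom_minus)
  then show "{w_row 3 2 - w_row 3 1, w_two 2 1 1} \<subseteq> I"
    using pol_ideal_mult(1)[OF I(1) p one_two(1)] unfolding w_two_eq w_row_def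
    by (simp add: pol_def of_yz_simps power2_eq_square mult.assoc)
next
  fix W assume W: "GL_space d W" "V \<subseteq> W" "{w_row 3 2 - w_row 3 1, w_two 2 1 1} \<subseteq> W"
  interpret gv_space d \<beta> W by (rule space[OF W(1,2)])
  show "tau_ideal d \<inter> G_hom d (2 + 1) \<subseteq> W"
    using tau_hom3_subset W(3) unfolding w_two_eq w_row_def by (simp add: pol_def of_yz_simps)
qed auto

text \<open>For \<gamma>1 = \<gamma>2 the products of f by y_1 and by z_1 agree modulo V, so a third
  element is used: the part linear in c of f under x_1 to x_1 + c x_1 x_1. With A = y^3 z and B =
  y^2 z^2 it is congruent to (\<gamma>1 + \<gamma>2)(A + 2B). The two products then give B with the
  factors \<gamma>2 - 2 \<gamma>1 and \<gamma>1 - 2 \<gamma>2, which vanish together only if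
  \<gamma>1 + \<gamma>2 = 0.\<close>

lemma consequences_iv:
  assumes \<gamma>: "\<gamma>1 + \<gamma>2 \<noteq> 0"
  shows "consequences_equiv d \<beta> \<beta> 3 (gscale \<gamma>1 (w_row 3 2) + gscale \<gamma>2 (w_row 3 1)) {w_row 4 3, w_row 4 2}"
proof (rule consequences_equivI[OF _ _ _ _ T_yz V_yz])
  let ?y = "y_var 1 :: 'k yzpoly" and ?z = "z_var 1 :: 'k yzpoly"
  let ?p = "pconst \<gamma>1 * (?y ^ 2 * ?z) + pconst \<gamma>2 * (?y * ?z ^ 2)"
  have f_eq: "gscale \<gamma>1 (w_row 3 2) + gscale \<gamma>2 (w_row 3 1) = of_yz ?p"
    by (simp add: w_row_def of_yz_simps)
  show f: "gscale \<gamma>1 (w_row 3 2) + gscale \<gamma>2 (w_row 3 1) \<in> G"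
    by (intro hom_G[of _ 3] G_hom_add G_hom_scale w_row_hom) auto
  then show "gscale \<gamma>1 (w_row 3 2) + gscale \<gamma>2 (w_row 3 1) \<in> yz_ideal d"
    unfolding f_eq by (simp add: yz_ideal_iff)
  show "{w_row 4 3, w_row 4 2} \<subseteq> G_hom d (3 + 1)"
    using w_row_hom[of 2 4] w_row_hom[of 3 4] by simp
  fix I :: "'k gelem set"
  assume I: "T_ideal (Galg d) I" "V \<subseteq> I" "gscale \<gamma>1 (w_row 3 2) + gscale \<gamma>2 (w_row 3 1) \<in> I"
  note LC = lin_closed_pol_ideal[OF I(1)]
  note PD = lin_closedD[OF LC]
  have p: "?p \<in> pol I" using I(3) unfolding f_eq by (simp add: pol_def)
  define A where "A = ?y * ?y * ?y * ?z"
  define B where "B = ?y * ?y * ?z * ?z"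
  define A' where "A' = ?y * ?z * ?z * ?z"
  have "YZ 3 (replicate 4 1) - YZ 1 (replicate 4 1) \<in> pol V"
    using one_two by (intro YZ_3_1_V) auto
  then have AA: "A - A' \<in> pol I"
    using I(2) by (auto simp: YZ_replicate pol_def A_def A'_def power3_eq_cube mult_ac numeral_eq_Suc YZ_def)
  have e1: "pconst \<gamma>1 * A + pconst \<gamma>2 * B \<in> pol I"
    using pol_ideal_mult(1)[OF I(1) p one_two(1)] by (simp add: A_def B_def power2_eq_square algebra_simps)
  have e2: "pconst \<gamma>1 * B + pconst \<gamma>2 * A' \<in> pol I"
    using pol_ideal_mult(2)[OF I(1) p one_two(1)] by (simp add: A'_def B_def power2_eq_square algebra_simps)
  \<comment> \<open>The image of f under x_1 to x_1 + t x_1 x_1 as a polynomial in t; its values at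
    scalars lie in \<open>pol I\<close>, hence so do its coefficients.\<close>
  define F where "F = [:pconst \<gamma>1:] * ([:?y, ?y * ?z:] ^ 2 * [:?z, ?y * ?z:])
      + [:pconst \<gamma>2:] * ([:?y, ?y * ?z:] * [:?z, ?y * ?z:] ^ 2)"
  have "poly F (pconst c) \<in> pol I" for c
  proof -
    have yz: "of_yz (?y * ?z) \<in> G" using YZ_mixed[of "[1]" d "[1]"] one_two by simp
    have "subst (usub (\<lambda>i. if i = 1 then x_gen 1 + gscale c (of_yz (?y * ?z)) else x_gen i)) ?p \<in> pol I"
      by (rule pol_ideal_subst[OF I(1) p]) (use one_two yz carrier_x_gen in \<open>auto intro!: carrier_add carrier_scale\<close>)
    also have "subst (usub (\<lambda>i. if i = 1 then x_gen 1 + gscale c (of_yz (?y * ?z)) else x_gen i)) ?p = poly F (pconst c)"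
      by (simp add: F_def subst.hom_add subst.hom_mult subst.hom_power algebra_simps)
    finally show ?thesis .
  qed
  then have "coeff F 1 \<in> pol I" by (rule lin_closed_extract[OF LC])
  also have "coeff F 1 = pconst \<gamma>1 * (A + 2 * B) + pconst \<gamma>2 * (A' + 2 * B)"
    by (simp add: F_def A_def B_def A'_def power2_eq_square algebra_simps)
  finally have "pconst \<gamma>1 * (A + 2 * B) + pconst \<gamma>2 * (A' + 2 * B) + pconst \<gamma>2 * (A - A') \<in> pol I"
    by (rule PD(2)) (rule PD(3)[OF AA])
  also have "pconst \<gamma>1 * (A + 2 * B) + pconst \<gamma>2 * (A' + 2 * B) + pconst \<gamma>2 * (A - A')
      = pconst (\<gamma>1 + \<gamma>2) * (A + 2 * B)"
    by (simp add: pconst.hom_add algebra_simps)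
  finally have S: "A + 2 * B \<in> pol I" using lin_closed_cancel[OF LC] \<gamma> by blast
  have "pconst \<gamma>1 * A + pconst \<gamma>2 * B - pconst \<gamma>1 * (A + 2 * B) \<in> pol I"
    by (intro PD(5,3) e1 S)
  then have B1: "pconst (\<gamma>2 - 2 * \<gamma>1) * B \<in> pol I"
    by (simp add: pconst.hom_minus pconst.hom_mult algebra_simps)
  have "pconst \<gamma>1 * B + pconst \<gamma>2 * A' + pconst \<gamma>2 * (A - A') - pconst \<gamma>2 * (A + 2 * B) \<in> pol I"
    by (intro PD(5,3,2) e2 S AA)
  then have B2: "pconst (\<gamma>1 - 2 * \<gamma>2) * B \<in> pol I"
    by (simp add: pconst.hom_minus pconst.hom_mult algebra_simps)
  have B: "B \<in> pol I"
  proof (cases "\<gamma>2 - 2 * \<gamma>1 = 0")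
    case True
    then have "\<gamma>1 - 2 * \<gamma>2 = - (\<gamma>1 + \<gamma>2)" by simp
    then have "\<gamma>1 - 2 * \<gamma>2 \<noteq> 0" using \<gamma> by (metis neg_equal_0_iff_equal)
    then show ?thesis by (rule lin_closed_cancel[OF LC B2])
  qed (use lin_closed_cancel[OF LC B1] in blast)
  have "A + 2 * B - pconst 2 * B \<in> pol I" by (intro PD(5,3) S B)
  then have "A \<in> pol I" by simp
  with B show "{w_row 4 3, w_row 4 2} \<subseteq> I"
    by (simp add: w_row_def pol_def A_def B_def power2_eq_square power3_eq_cube mult.assoc)
next
  fix W assume W: "GL_space d W" "V \<subseteq> W" "{w_row 4 3, w_row 4 2} \<subseteq> W"
  interpret gv_space d \<beta> W by (rule space[OF W(1,2)])
  show "yz_ideal d \<inter> G_hom d (3 + 1) \<subseteq> W"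
    using hom4_subset W(3) unfolding w_row_def by (simp add: pol_def le_infI2)
qed auto

text \<open>Shared by (v) and (vi), whose lists and bounding T-ideals agree.\<close>

lemma w4_diff:
  shows "{w_row 4 3 - w_row 4 2} \<subseteq> G_hom d (3 + 1)"
    and "GL_space d W \<Longrightarrow> V \<subseteq> W \<Longrightarrow> {w_row 4 3 - w_row 4 2} \<subseteq> W \<Longrightarrow> tau_ideal d \<inter> G_hom d (3 + 1) \<subseteq> W"
proof -
  show "{w_row 4 3 - w_row 4 2} \<subseteq> G_hom d (3 + 1)"
    by (simp add: G_hom_diff w_row_hom)
  assume W: "GL_space d W" "V \<subseteq> W" "{w_row 4 3 - w_row 4 2} \<subseteq> W"
  interpret gv_space d \<beta> W by (rule space[OF W(1,2)])
  show "tau_ideal d \<inter> G_hom d (3 + 1) \<subseteq> W"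
    using tau_hom4_subset W(3) unfolding w_row_def by (simp add: pol_def of_yz_simps)
qed

lemma consequences_v: "consequences_equiv d \<beta> \<beta> 3 (w_row 3 2 - w_row 3 1) {w_row 4 3 - w_row 4 2}"
proof (rule consequences_equivI[OF _ w4_diff(1) _ _ T_tau V_tau _ w4_diff(2)])
  have f_eq: "w_row 3 2 - w_row 3 1 = of_yz (y_var 1 ^ 2 * z_var 1 - y_var 1 * z_var 1 ^ 2)"
    by (simp add: w_row_def of_yz_simps)
  show f: "w_row 3 2 - w_row 3 1 \<in> G"
    by (intro hom_G[of _ 3] G_hom_diff w_row_hom) auto
  then show "w_row 3 2 - w_row 3 1 \<in> tau_ideal d"
    unfolding f_eq by (simp add: tau_ideal_iff tau.hom_minus tau.hom_mult tau.hom_power power2_eq_square)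
  fix I :: "'k gelem set" assume I: "T_ideal (Galg d) I" "w_row 3 2 - w_row 3 1 \<in> I"
  then have "y_var 1 * (y_var 1 ^ 2 * z_var 1 - y_var 1 * z_var 1 ^ 2) \<in> pol I"
    unfolding f_eq by (intro pol_ideal_mult[OF _ _ one_two(1)]) (simp_all add: pol_def)
  then show "{w_row 4 3 - w_row 4 2} \<subseteq> I"
    by (simp add: w_row_def of_yz_simps pol_def power2_eq_square power3_eq_cube algebra_simps)
qed auto

lemma consequences_vi: "consequences_equiv d \<beta> \<beta> 3 (w_two 2 1 1) {w_row 4 3 - w_row 4 2}"
proof (rule consequences_equivI[OF _ w4_diff(1) _ _ T_tau V_tau _ w4_diff(2)])
  show f: "w_two 2 1 1 \<in> G" by (rule hom_G[OF w_two_G_hom(2)[OF d_ge]])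
  then show "w_two 2 1 1 \<in> tau_ideal d"
    unfolding w_two_eq by (simp add: tau_ideal_iff tau.hom_minus tau.hom_mult)
  fix I :: "'k gelem set" assume I: "T_ideal (Galg d) I" "w_two 2 1 1 \<in> I"
  have p: "y_var 1 * D2 1 2 \<in> pol I" using I(2) unfolding w_two_eq by (simp add: pol_def)
  have yz: "y_var 1 * z_var 1 \<in> mixed d"
    using YZ_mixed[of "[1]" d "[1]"] one_two by simp
  \<comment> \<open>With x_1 x_1 in place of x_2, y_1 \<open>D2 1 2\<close> becomes y_1^2 z_1 (y_1 -
    z_1).\<close>
  have "subst (usub (\<lambda>i. if i = 1 then x_gen 1 else of_yz (y_var 1 * z_var 1))) (y_var 1 * D2 1 2) \<in> pol I"
    by (rule pol_ideal_subst[OF I(1) p]) (use one_two carrier_x_gen yz in auto)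
  then show "{w_row 4 3 - w_row 4 2} \<subseteq> I"
    by (simp add: w_row_def of_yz_simps pol_def power2_eq_square power3_eq_cube algebra_simps subst.hom_mult subst.hom_minus)
qed auto

lemma consequences_vii:
  assumes \<gamma>: "\<gamma>1 + \<gamma>2 \<noteq> 0"
  shows "consequences_equiv d \<beta> \<beta> 4 (gscale \<gamma>1 (w_row 4 3) + gscale \<gamma>2 (w_row 4 2)) {w_row 5 4}"
proof (rule consequences_equivI[OF _ _ _ _ T_yz V_yz])
  let ?y = "y_var 1 :: 'k yzpoly" and ?z = "z_var 1 :: 'k yzpoly"
  let ?p = "pconst \<gamma>1 * (?y ^ 3 * ?z) + pconst \<gamma>2 * (?y ^ 2 * ?z ^ 2)"
  have f_eq: "gscale \<gamma>1 (w_row 4 3) + gscale \<gamma>2 (w_row 4 2) = of_yz ?p"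
    by (simp add: w_row_def of_yz_simps)
  show f: "gscale \<gamma>1 (w_row 4 3) + gscale \<gamma>2 (w_row 4 2) \<in> G"
    by (intro hom_G[of _ 4] G_hom_add G_hom_scale w_row_hom) auto
  then show "gscale \<gamma>1 (w_row 4 3) + gscale \<gamma>2 (w_row 4 2) \<in> yz_ideal d"
    unfolding f_eq by (simp add: yz_ideal_iff)
  show "{w_row 5 4} \<subseteq> G_hom d (4 + 1)"
    using w_row_hom[of 4 5] by simp
  fix I :: "'k gelem set"
  assume I: "T_ideal (Galg d) I" "V \<subseteq> I" "gscale \<gamma>1 (w_row 4 3) + gscale \<gamma>2 (w_row 4 2) \<in> I"
  note LC = lin_closed_pol_ideal[OF I(1)]
  have e: "?y * ?p \<in> pol I"
    using I(3) unfolding f_eq by (intro pol_ideal_mult[OF I(1)] one_two) (simp add: pol_def)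
  \<comment> \<open>This makes y^3 z^2 congruent to y^4 z, so that y_1 f is congruent to \<gamma>1 +
    \<gamma>2 times y^4 z.\<close>
  have "Ymon [1, 1, 1] * Zmon [1] * (?y - ?z) \<in> pol V"
    using one_two by (intro YZ_diff_V) auto
  then have "?y * ?y * ?y * ?z * (?y - ?z) \<in> pol I" using I(2) by (auto simp: pol_def mult_ac)
  then have "?y * ?p + pconst \<gamma>2 * (?y * ?y * ?y * ?z * (?y - ?z)) \<in> pol I"
    using e by (intro lin_closedD(2,3)[OF LC])
  also have "?y * ?p + pconst \<gamma>2 * (?y * ?y * ?y * ?z * (?y - ?z)) = pconst (\<gamma>1 + \<gamma>2) * (?y ^ 4 * ?z)"
    by (simp add: pconst.hom_add power2_eq_square power3_eq_cube power4_eq_xxxx algebra_simps)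
  finally have "?y ^ 4 * ?z \<in> pol I" using lin_closed_cancel[OF LC] \<gamma> by blast
  then show "{w_row 5 4} \<subseteq> I" by (simp add: w_row_def pol_def)
next
  fix W assume W: "GL_space d W" "V \<subseteq> W" "{w_row 5 4} \<subseteq> W"
  interpret gv_space d \<beta> W by (rule space[OF W(1,2)])
  show "yz_ideal d \<inter> G_hom d (4 + 1) \<subseteq> W"
    using hom_large_subset[of 5] W(3) unfolding w_row_def by (simp add: pol_def le_infI2)
qed auto

lemma GL_space_V: "GL_space d V"
  using ideal T_idealD(2)[OF T] unfolding GL_space_def GL_action_def alg_auto_def alg_ideal_def by blast

lemma consequences_viii: "consequences d \<beta> \<beta> 5 (w_row 4 3 - w_row 4 2) = {azero (GV d \<beta> \<beta>)}"
proof
  have f_eq: "w_row 4 3 - w_row 4 2 = of_yz (y_var 1 ^ 3 * z_var 1 - y_var 1 ^ 2 * z_var 1 ^ 2)"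
    by (simp add: w_row_def of_yz_simps)
  have "w_row 4 3 - w_row 4 2 \<in> G"
    by (intro hom_G[of _ 4] G_hom_diff w_row_hom) auto
  then have f: "w_row 4 3 - w_row 4 2 \<in> tau_ideal d"
    unfolding f_eq by (simp add: tau_ideal_iff tau.hom_minus tau.hom_mult tau.hom_power power2_eq_square power3_eq_cube mult_ac)
  \<comment> \<open>With V itself as the GL-stable subspace, the bound says that the degree 5 part
    of the kernel of \<open>tau\<close> is zero in the quotient.\<close>
  interpret gv_space d \<beta> V by (rule space[OF GL_space_V order_refl])
  have "tau_ideal d \<inter> G_hom d 5 \<subseteq> V" by (rule tau_hom_large_subset) simp
  then have "cs ` (tau_ideal d \<inter> G_hom d 5) \<subseteq> {cs 0}" using cs_eq_iff[of _ 0] by auto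
  then show "consequences d \<beta> \<beta> 5 (w_row 4 3 - w_row 4 2) \<subseteq> {azero (GV d \<beta> \<beta>)}"
    using consequences_subset[OF T_tau V_tau f, of 5] unfolding GV_simps quot_carrier(2) by blast
  show "{azero (GV d \<beta> \<beta>)} \<subseteq> consequences d \<beta> \<beta> 5 (w_row 4 3 - w_row 4 2)"
    using zero_in_consequences unfolding GV_simps quot_carrier(2) by blast
qed

lemma consequences_ix:
  assumes n: "n \<ge> 5"
  shows "consequences_equiv d \<beta> \<beta> n (w_row n (n - 1)) {w_row (n + 1) n}"
proof (rule consequences_equivI[OF _ _ _ _ T_yz V_yz])
  show f: "w_row n (n - 1) \<in> G"
    by (rule hom_G[OF w_row_hom]) (use n in auto)
  then show "w_row n (n - 1) \<in> yz_ideal d" by (simp add: w_row_def yz_ideal_iff)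
  show "{w_row (n + 1) n} \<subseteq> G_hom d (n + 1)"
    using w_row_hom[of n "n + 1"] n by simp
  fix I :: "'k gelem set" assume I: "T_ideal (Galg d) I" "w_row n (n - 1) \<in> I"
  have "y_var 1 * (y_var 1 ^ (n - 1) * z_var 1 ^ (n - (n - 1))) \<in> pol I"
    using I(2) by (intro pol_ideal_mult[OF I(1)] one_two) (simp add: pol_def w_row_def)
  moreover have "y_var 1 * (y_var 1 ^ (n - 1) * z_var 1 ^ (n - (n - 1))) = y_var 1 ^ n * (z_var 1 :: 'k yzpoly)"
    using n power_Suc[of "y_var 1 :: 'k yzpoly" "n - 1"] by (simp flip: mult.assoc)
  ultimately show "{w_row (n + 1) n} \<subseteq> I" by (simp add: w_row_def pol_def)
next
  fix W assume W: "GL_space d W" "V \<subseteq> W" "{w_row (n + 1) n} \<subseteq> W"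
  interpret gv_space d \<beta> W by (rule space[OF W(1,2)])
  show "yz_ideal d \<inter> G_hom d (n + 1) \<subseteq> W"
    using hom_large_subset[of "n + 1"] W(3) n unfolding w_row_def by (simp add: pol_def le_infI2)
qed (use n in auto)

end

theorem theorem4p10:
  fixes \<beta>1 \<beta>2 :: "'k::field_char_0" and d :: nat
  assumes "d \<ge> 2"
    and "(\<beta>1, \<beta>2) \<noteq> (0, 0)"
    and "\<beta>1 - \<beta>2 = 0"
  shows
    "consequences_equiv d \<beta>1 \<beta>2 1 (x_gen 1) {w_row 2 1, w_two 1 1 0}
   \<and> consequences_equiv d \<beta>1 \<beta>2 2 (w_row 2 1) {w_row 3 2, w_row 3 1, w_two 2 1 1}
   \<and> consequences_equiv d \<beta>1 \<beta>2 2 (w_two 1 1 0) {w_row 3 2 - w_row 3 1, w_two 2 1 1}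
   \<and> (\<forall>\<gamma>1 \<gamma>2. \<gamma>1 + \<gamma>2 \<noteq> 0 \<longrightarrow>
        consequences_equiv d \<beta>1 \<beta>2 3 (gscale \<gamma>1 (w_row 3 2) + gscale \<gamma>2 (w_row 3 1))
          {w_row 4 3, w_row 4 2})
   \<and> consequences_equiv d \<beta>1 \<beta>2 3 (w_row 3 2 - w_row 3 1) {w_row 4 3 - w_row 4 2}
   \<and> consequences_equiv d \<beta>1 \<beta>2 3 (w_two 2 1 1) {w_row 4 3 - w_row 4 2}
   \<and> (\<forall>\<gamma>1 \<gamma>2. \<gamma>1 + \<gamma>2 \<noteq> 0 \<longrightarrow>
        consequences_equiv d \<beta>1 \<beta>2 4 (gscale \<gamma>1 (w_row 4 3) + gscale \<gamma>2 (w_row 4 2))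
          {w_row 5 4})
   \<and> consequences d \<beta>1 \<beta>2 5 (w_row 4 3 - w_row 4 2) = {azero (GV d \<beta>1 \<beta>2)}
   \<and> (\<forall>n\<ge>5. consequences_equiv d \<beta>1 \<beta>2 n (w_row n (n - 1)) {w_row (n + 1) n})"
proof -
  have \<beta>: "\<beta>2 = \<beta>1" "\<beta>1 \<noteq> 0" using assms(2,3) by auto
  interpret gv_eq d \<beta>1 by unfold_locales (use assms(1) \<beta> in auto)
  show ?thesis
    unfolding \<beta>(1)
    using consequences_i consequences_ii consequences_iii consequences_iv consequences_v consequences_vi consequences_vii consequences_viii consequences_ix
    by blast
qed

end
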